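(* Let $A$ be an associative unital algebra over a field $\Bbbk$ of characteristic $0$. With the operations $\vdash,\dashv,\cup$ on Hochschild cochains defined in the context: (i) The operation $f\vee g:=f\vdash g-f\dashv g$ and the Hochschild differential $\mathsf b$ give the space $C(A,A_t)_{\ge2}:=\bigoplus_{p,k\ge2}C^p(A,A^{\otimes k})$ the structure of an associative DG algebra, i.e. for all $f,g,h$ in this space, with $f\in C^p(A,A^{\otimes k})$, $$f\vee(g\vee h)=(f\vee g)\vee h,\qquad \mathsf b(f\vee g)=(\mathsf b f)\vee g+(-1)^{p-1}f\vee(\mathsf b g).$$ (ii) The cup product $\cup$ is associative, and for all $p,q\ge1$ the map it induces on cohomology, $$H^p(A,A^{\otimes k})\otimes H^q(A,A^{\otimes m})\xrightarrow{\ \cup\ }H^{p+q}(A,A^{\otimes(k+m-1)}),$$ is zero whenever $k\ge2$ or $m\ge2$. (iii) The following compatibility identities hold for $f,g,h\in C(A,A_t)_{\ge2}$: $$(f\cup g)\vee h=f\cup(g\vee h),\qquad f\vee(g\cup h)=(f\vee g)\cup h.$$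
   Context: $\otimes=\otimes_\Bbbk$. $A^{\otimes k}$ ($k\ge1$) is an $A$-bimodule via the outer structure $b(a'\otimes u\otimes a'')c=(ba')\otimes u\otimes(a''c)$. $C^p(A,M)=\mathrm{Hom}_\Bbbk(A^{\otimes p},M)$ is the space of Hochschild $p$-cochains with values in a bimodule $M$; $H^p(A,M)$ is Hochschild cohomology; and $$(\mathsf b f)(a_1,\dots,a_{p+1})=a_1f(a_2,\dots,a_{p+1})+\sum_{i=1}^p(-1)^if(\dots,a_ia_{i+1},\dots)+(-1)^{p+1}f(a_1,\dots,a_p)a_{p+1}.$$ $A_t=A*\Bbbk[t]$ is the free product algebra, identified with $\bigoplus_{k\ge1}A^{\otimes k}$ via $a_1ta_2t\cdots ta_k\leftrightarrow a_1\otimes\cdots\otimes a_k$; its product is $(a_1\otimes\dots\otimes a_k)(b_1\otimes\dots\otimes b_m)=a_1\otimes\dots\otimes a_{k-1}\otimes a_kb_1\otimes b_2\otimes\dots\otimes b_m$. For $f\in C^p(A,A^{\otimes k})$ and $g\in C^q(A,A^{\otimes m})$: - $f\cup g\in C^{p+q}(A,A^{\otimes(k+m-1)})$ is $(f\cup g)(a_1,\dots,a_{p+q})=f(a_1,\dots,a_p)\,g(a_{p+1},\dots,a_{p+q})$, with the product taken in $A_t$. - $f\vdash g:=f^{[1,p]}\circ g^{[p,p+q-1]}$ and $f\dashv g:=g^{[k,k+q-1]}\circ f^{[1,p]}$, both in $C^{p+q-1}(A,A^{\otimes(k+m-1)})$, where $f^{[i,j]}$ means applying $f$ to the consecutive tensor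 components $i,i+1,\dots,j$: $f^{[i,j]}(a_1\otimes\dots\otimes a_\ell)=a_1\otimes\dots\otimes a_{i-1}\otimes f(a_i\otimes\dots\otimes a_j)\otimes a_{j+1}\otimes\dots\otimes a_\ell$. *)

theory Defs
  imports Complex_Main "HOL-Library.Poly_Mapping" "HOL-Library.Function_Algebras"
begin

section \<open>Quotient vector spaces\<close>

text \<open>
  The quotient of a vector space by a subspace \<open>N\<close> is realised on a linear complement of \<open>N\<close>:
  the quotient map is a chosen linear projection \<open>P\<close> with kernel \<open>N\<close>, and \<open>U/N\<close> is \<open>P ` U\<close>.
  Thus quotients are again subspaces of an ordinary type, and equality of classes is equality.
\<close>

definition quotient_map :: "('k::field \<Rightarrow> 'v \<Rightarrow> 'v::ab_group_add) \<Rightarrow> 'v set \<Rightarrow> 'v \<Rightarrow> 'v" where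
  "quotient_map s N = (SOME P. Vector_Spaces.linear s s P \<and> P \<circ> P = P \<and> {v. P v = 0} = N)"

lemma quotient_map:
  assumes "vector_space s" and "module.subspace s N"
  shows "Vector_Spaces.linear s s (quotient_map s N)"
    and "quotient_map s N (quotient_map s N v) = quotient_map s N v"
    and "quotient_map s N v = 0 \<longleftrightarrow> v \<in> N"
proof -
  interpret vector_space s by fact
  interpret vector_space_pair s s by unfold_locales
  obtain g where g: "range g \<subseteq> N" "Vector_Spaces.linear s s g" "\<forall>v\<in>N. g v = v"
    using linear_exists_left_inverse_on[of "\<lambda>x. x" N] assms(2) linear_ident by auto
  have "Vector_Spaces.linear s s (\<lambda>v. v - g v)"
    using g(2) linear_ident linear_compose_sub by blast
  moreover have "(\<lambda>v. v - g v) \<circ> (\<lambda>v. v - g v) = (\<lambda>v. v - g v)"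
    using g by (auto simp: fun_eq_iff linear_diff)
  moreover have "{v. v - g v = 0} = N"
    using g by (auto simp: image_subset_iff) (metis)
  ultimately have "\<exists>P. Vector_Spaces.linear s s P \<and> P \<circ> P = P \<and> {v. P v = 0} = N"
    by blast
  then have *: "Vector_Spaces.linear s s (quotient_map s N) \<and>
      quotient_map s N \<circ> quotient_map s N = quotient_map s N \<and> {v. quotient_map s N v = 0} = N"
    unfolding quotient_map_def by (rule someI_ex)
  then show "Vector_Spaces.linear s s (quotient_map s N)"
    and "quotient_map s N v = 0 \<longleftrightarrow> v \<in> N" by auto
  show "quotient_map s N (quotient_map s N v) = quotient_map s N v"
    using * by (metis comp_apply)
qed


section \<open>Tensor products\<close>

text \<open>\<open>'v list \<Rightarrow>\<^sub>0 'k\<close> is the free vector space on words over \<open>'v\<close>.\<close>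

definition fscale :: "'k::field \<Rightarrow> ('w \<Rightarrow>\<^sub>0 'k) \<Rightarrow> ('w \<Rightarrow>\<^sub>0 'k)" where
  "fscale c x = Poly_Mapping.map ((*) c) x"

lemma lookup_fscale [simp]: "Poly_Mapping.lookup (fscale c x) w = c * Poly_Mapping.lookup x w"
  by (simp add: fscale_def Poly_Mapping.map.rep_eq when_def)

lemma vector_space_fscale: "vector_space fscale"
  by unfold_locales (auto intro!: poly_mapping_eqI simp: lookup_add algebra_simps)

definition formal_sums :: "'v set list \<Rightarrow> ('v list \<Rightarrow>\<^sub>0 'k::field) set" where
  "formal_sums Vs = {x. Poly_Mapping.keys x \<subseteq> listset Vs}"

definition tensor_relations ::
    "('k::field \<Rightarrow> 'v \<Rightarrow> 'v::ab_group_add) \<Rightarrow> 'v set list \<Rightarrow> ('v list \<Rightarrow>\<^sub>0 'k) set" where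
  "tensor_relations s Vs = module.span fscale
     ({Poly_Mapping.single (us @ (x + y) # vs) 1 - Poly_Mapping.single (us @ x # vs) 1
         - Poly_Mapping.single (us @ y # vs) 1
       | us x y vs. us @ x # vs \<in> listset Vs \<and> us @ y # vs \<in> listset Vs}
      \<union> {Poly_Mapping.single (us @ s c x # vs) 1 - Poly_Mapping.single (us @ x # vs) c
         | us c x vs. us @ x # vs \<in> listset Vs})"

definition tensor_space ::
    "('k::field \<Rightarrow> 'v \<Rightarrow> 'v::ab_group_add) \<Rightarrow> 'v set list \<Rightarrow> ('v list \<Rightarrow>\<^sub>0 'k) set" where
  "tensor_space s Vs = quotient_map fscale (tensor_relations s Vs) ` formal_sums Vs"

definition pure_tensor ::
    "('k::field \<Rightarrow> 'v \<Rightarrow> 'v::ab_group_add) \<Rightarrow> 'v set list \<Rightarrow> 'v list \<Rightarrow> ('v list \<Rightarrow>\<^sub>0 'k)" where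
  "pure_tensor s Vs w = quotient_map fscale (tensor_relations s Vs) (Poly_Mapping.single w 1)"

text \<open>
  An element of a tensor space is a formal sum of words representing itself, so the linear map
  induced by a multilinear \<open>\<phi>\<close> is the linear extension of \<open>\<phi>\<close> from words to formal sums;
  see \<open>lin_ext_pure_tensor\<close> below.
\<close>

definition lin_ext :: "('k::field \<Rightarrow> 'u \<Rightarrow> 'u::ab_group_add) \<Rightarrow> ('w \<Rightarrow> 'u) \<Rightarrow> ('w \<Rightarrow>\<^sub>0 'k) \<Rightarrow> 'u" where
  "lin_ext t \<phi> x = (\<Sum>w\<in>Poly_Mapping.keys x. t (Poly_Mapping.lookup x w) (\<phi> w))"

lemma lin_ext_superset:
  assumes "vector_space t" "finite S" "Poly_Mapping.keys x \<subseteq> S"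
  shows "lin_ext t \<phi> x = (\<Sum>w\<in>S. t (Poly_Mapping.lookup x w) (\<phi> w))"
proof -
  interpret vector_space t by fact
  show ?thesis
    unfolding lin_ext_def using assms(2,3)
    by (intro sum.mono_neutral_left) (auto simp: in_keys_iff)
qed

lemma linear_lin_ext:
  fixes t :: "'k::field \<Rightarrow> 'u \<Rightarrow> 'u::ab_group_add" and \<phi> :: "'w \<Rightarrow> 'u"
  assumes "vector_space t"
  shows "Vector_Spaces.linear fscale t (lin_ext t \<phi>)"
proof -
  interpret T: vector_space t by fact
  interpret F: vector_space "fscale :: 'k \<Rightarrow> ('w \<Rightarrow>\<^sub>0 'k) \<Rightarrow> _" by (rule vector_space_fscale)
  interpret vector_space_pair "fscale :: 'k \<Rightarrow> ('w \<Rightarrow>\<^sub>0 'k) \<Rightarrow> _" t by unfold_locales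
  show ?thesis
  proof (unfold Vector_Spaces.linear_iff, intro conjI allI)
    fix x y :: "'w \<Rightarrow>\<^sub>0 'k"
    let ?S = "Poly_Mapping.keys x \<union> Poly_Mapping.keys y"
    have "Poly_Mapping.keys (x + y) \<subseteq> ?S" by (rule Poly_Mapping.keys_add)
    then show "lin_ext t \<phi> (x + y) = lin_ext t \<phi> x + lin_ext t \<phi> y"
      by (simp add: lin_ext_superset[OF assms, of ?S] lookup_add T.scale_left_distrib sum.distrib)
  next
    show "vector_space (fscale :: 'k \<Rightarrow> ('w \<Rightarrow>\<^sub>0 'k) \<Rightarrow> _)" "vector_space t"
      by unfold_locales
  next
    fix c and x :: "'w \<Rightarrow>\<^sub>0 'k"
    have "Poly_Mapping.keys (fscale c x) \<subseteq> Poly_Mapping.keys x"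
      by (auto simp: in_keys_iff)
    then show "lin_ext t \<phi> (fscale c x) = t c (lin_ext t \<phi> x)"
      by (simp add: lin_ext_superset[OF assms, of "Poly_Mapping.keys x"] T.scale_sum_right)
  qed
qed

lemma lin_ext_single:
  assumes "vector_space t"
  shows "lin_ext t \<phi> (Poly_Mapping.single w c) = t c (\<phi> w)"
  by (subst lin_ext_superset[OF assms, of "{w}"]) auto

lemma lin_ext_pure_tensor:
  fixes s :: "'k::field \<Rightarrow> 'v \<Rightarrow> 'v::ab_group_add"
    and t :: "'k \<Rightarrow> 'u \<Rightarrow> 'u::ab_group_add" and \<phi> :: "'v list \<Rightarrow> 'u"
  assumes t: "vector_space t"
    and add: "\<And>us x y vs. us @ x # vs \<in> listset Vs \<Longrightarrow> us @ y # vs \<in> listset Vs \<Longrightarrow>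
        \<phi> (us @ (x + y) # vs) = \<phi> (us @ x # vs) + \<phi> (us @ y # vs)"
    and scale: "\<And>us c x vs. us @ x # vs \<in> listset Vs \<Longrightarrow>
        \<phi> (us @ s c x # vs) = t c (\<phi> (us @ x # vs))"
  shows "lin_ext t \<phi> (pure_tensor s Vs w) = \<phi> w"
proof -
  interpret T: vector_space t by fact
  interpret F: vector_space "fscale :: 'k \<Rightarrow> ('v list \<Rightarrow>\<^sub>0 'k) \<Rightarrow> _" by (rule vector_space_fscale)
  interpret vector_space_pair "fscale :: 'k \<Rightarrow> ('v list \<Rightarrow>\<^sub>0 'k) \<Rightarrow> _" t by unfold_locales
  let ?L = "lin_ext t \<phi>" and ?N = "tensor_relations s Vs"
  have lin: "Vector_Spaces.linear fscale t ?L" by (rule linear_lin_ext[OF t])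
  have sub: "F.subspace ?N" unfolding tensor_relations_def by (rule F.subspace_span)
  note Q = quotient_map[OF F.vector_space_axioms sub]
  have kill: "?L n = 0" if "n \<in> ?N" for n
  proof -
    have "F.subspace {n. ?L n = 0}" using lin by (rule linear_subspace_kernel)
    then show ?thesis using that unfolding tensor_relations_def
      by (auto elim!: F.span_induct
          simp: linear_diff[OF lin] lin_ext_single[OF t] add scale)
  qed
  have Qlin: "Vector_Spaces.linear fscale fscale (quotient_map fscale ?N)" by (rule Q(1))
  then have "quotient_map fscale ?N (quotient_map fscale ?N v - v) = 0" for v
  proof -
    interpret QQ: Vector_Spaces.linear fscale fscale "quotient_map fscale ?N" by (rule Q(1))
    show ?thesis by (simp add: QQ.diff Q(2))
  qed
  then have "quotient_map fscale ?N v - v \<in> ?N" for v using Q(3) by blast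
  from kill[OF this] have "?L (quotient_map fscale ?N v) = ?L v" for v
    by (simp add: linear_diff[OF lin])
  then show ?thesis by (simp add: pure_tensor_def lin_ext_single[OF t])
qed

text \<open>Linear maps between subspaces are extended by \<open>0\<close>, so that they can be compared by equality.\<close>

definition hom_space ::
    "('k::field \<Rightarrow> 'u \<Rightarrow> 'u::ab_group_add) \<Rightarrow> ('k \<Rightarrow> 'v \<Rightarrow> 'v::ab_group_add) \<Rightarrow>
     'u set \<Rightarrow> 'v set \<Rightarrow> ('u \<Rightarrow> 'v) set" where
  "hom_space s t U V = {f. (\<forall>x\<in>U. f x \<in> V)
     \<and> (\<forall>x\<in>U. \<forall>y\<in>U. f (x + y) = f x + f y) \<and> (\<forall>c. \<forall>x\<in>U. f (s c x) = t c (f x))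
     \<and> (\<forall>x. x \<notin> U \<longrightarrow> f x = 0)}"

definition zero_outside :: "'u set \<Rightarrow> ('u \<Rightarrow> 'v::zero) \<Rightarrow> 'u \<Rightarrow> 'v" where
  "zero_outside U f = (\<lambda>x. if x \<in> U then f x else 0)"


section \<open>Algebras and their tensor powers\<close>

text \<open>The sort \<open>{ring, monoid_mult}\<close> is that of unital rings in which \<open>0 = 1\<close> is allowed.\<close>

locale unital_algebra = vector_space scale
  for scale :: "'k::field_char_0 \<Rightarrow> 'a::{ring, monoid_mult} \<Rightarrow> 'a" +
  assumes scale_mult_left: "scale c x * y = scale c (x * y)"
    and scale_mult_right: "x * scale c y = scale c (x * y)"

type_synonym ('a, 'k) tensor = "'a list \<Rightarrow>\<^sub>0 'k"
type_synonym ('a, 'k) cochain = "('a, 'k) tensor \<Rightarrow> ('a, 'k) tensor"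

definition tpow :: "('k::field \<Rightarrow> 'a \<Rightarrow> 'a::ab_group_add) \<Rightarrow> nat \<Rightarrow> ('a, 'k) tensor set" where
  "tpow s k = tensor_space s (replicate k UNIV)"

definition tens :: "('k::field \<Rightarrow> 'a \<Rightarrow> 'a::ab_group_add) \<Rightarrow> 'a list \<Rightarrow> ('a, 'k) tensor" where
  "tens s as = pure_tensor s (replicate (length as) UNIV) as"

text \<open>
  The product of the free product with \<open>\<k>[t]\<close> and the outer bimodule structure;
  only meaningful on tensor powers of exponent at least 1.
\<close>

definition At_mult ::
    "('k::field \<Rightarrow> 'a \<Rightarrow> 'a::{ring, monoid_mult}) \<Rightarrow> ('a, 'k) tensor \<Rightarrow> ('a, 'k) tensor \<Rightarrow> ('a, 'k) tensor" where
  "At_mult s x y = lin_ext fscale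
     (\<lambda>u. lin_ext fscale (\<lambda>v. tens s (butlast u @ (last u * hd v) # tl v)) y) x"

definition lact ::
    "('k::field \<Rightarrow> 'a \<Rightarrow> 'a::{ring, monoid_mult}) \<Rightarrow> 'a \<Rightarrow> ('a, 'k) tensor \<Rightarrow> ('a, 'k) tensor" where
  "lact s b x = lin_ext fscale (\<lambda>u. tens s ((b * hd u) # tl u)) x"

definition ract ::
    "('k::field \<Rightarrow> 'a \<Rightarrow> 'a::{ring, monoid_mult}) \<Rightarrow> ('a, 'k) tensor \<Rightarrow> 'a \<Rightarrow> ('a, 'k) tensor" where
  "ract s x c = lin_ext fscale (\<lambda>u. tens s (butlast u @ [last u * c])) x"


section \<open>Hochschild cochains\<close>

text \<open>Since \<open>f\<close> does not determine its bidegree \<open>(p, k)\<close>, the operations take it as an argument.\<close>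

definition cochains ::
    "('k::field \<Rightarrow> 'a \<Rightarrow> 'a::{ring, monoid_mult}) \<Rightarrow> nat \<Rightarrow> nat \<Rightarrow> ('a, 'k) cochain set" where
  "cochains s p k = hom_space fscale fscale (tpow s p) (tpow s k)"

definition cscale :: "'k::field \<Rightarrow> ('a, 'k) cochain \<Rightarrow> ('a, 'k) cochain" where
  "cscale c f = (\<lambda>x. fscale c (f x))"

definition cochain_of ::
    "('k::field \<Rightarrow> 'a \<Rightarrow> 'a::{ring, monoid_mult}) \<Rightarrow> nat \<Rightarrow> ('a list \<Rightarrow> ('a, 'k) tensor) \<Rightarrow> ('a, 'k) cochain" where
  "cochain_of s p \<phi> = zero_outside (tpow s p) (lin_ext fscale \<phi>)"

text \<open>Lists are indexed from 0: \<open>as ! (i - 1)\<close> is the \<open>i\<close>-th argument.\<close>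

definition hochschild ::
    "('k::field \<Rightarrow> 'a \<Rightarrow> 'a::{ring, monoid_mult}) \<Rightarrow> nat \<Rightarrow> ('a, 'k) cochain \<Rightarrow> ('a, 'k) cochain" where
  "hochschild s p f = cochain_of s (p + 1) (\<lambda>as.
       lact s (hd as) (f (tens s (tl as)))
     + (\<Sum>i = 1..p. fscale ((-1) ^ i)
          (f (tens s (take (i - 1) as @ (as ! (i - 1) * as ! i) # drop (i + 1) as))))
     + fscale ((-1) ^ (p + 1)) (ract s (f (tens s (butlast as))) (last as)))"

definition cup ::
    "('k::field \<Rightarrow> 'a \<Rightarrow> 'a::{ring, monoid_mult}) \<Rightarrow> nat \<Rightarrow> nat \<Rightarrow>
     ('a, 'k) cochain \<Rightarrow> ('a, 'k) cochain \<Rightarrow> ('a, 'k) cochain" where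
  "cup s p q f g = cochain_of s (p + q)
     (\<lambda>as. At_mult s (f (tens s (take p as))) (g (tens s (drop p as))))"

text \<open>\<open>f\<^sup>[\<^sup>i\<^sup>,\<^sup>j\<^sup>]\<close> on tensors of any length \<open>\<ge> j\<close>.\<close>

definition apply_at ::
    "('k::field \<Rightarrow> 'a \<Rightarrow> 'a::{ring, monoid_mult}) \<Rightarrow> ('a, 'k) cochain \<Rightarrow> nat \<Rightarrow> nat \<Rightarrow> ('a, 'k) cochain" where
  "apply_at s f i j = lin_ext fscale (\<lambda>as.
     lin_ext fscale (\<lambda>u. tens s (take (i - 1) as @ u @ drop j as))
       (f (tens s (take (j + 1 - i) (drop (i - 1) as)))))"

definition vdash_op ::
    "('k::field \<Rightarrow> 'a \<Rightarrow> 'a::{ring, monoid_mult}) \<Rightarrow> nat \<Rightarrow> nat \<Rightarrow>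
     ('a, 'k) cochain \<Rightarrow> ('a, 'k) cochain \<Rightarrow> ('a, 'k) cochain" where
  "vdash_op s p q f g = zero_outside (tpow s (p + q - 1))
     (apply_at s f 1 p \<circ> apply_at s g p (p + q - 1))"

definition dashv_op ::
    "('k::field \<Rightarrow> 'a \<Rightarrow> 'a::{ring, monoid_mult}) \<Rightarrow> nat \<Rightarrow> nat \<Rightarrow> nat \<Rightarrow>
     ('a, 'k) cochain \<Rightarrow> ('a, 'k) cochain \<Rightarrow> ('a, 'k) cochain" where
  "dashv_op s p q k f g = zero_outside (tpow s (p + q - 1))
     (apply_at s g k (k + q - 1) \<circ> apply_at s f 1 p)"

definition vee ::
    "('k::field \<Rightarrow> 'a \<Rightarrow> 'a::{ring, monoid_mult}) \<Rightarrow> nat \<Rightarrow> nat \<Rightarrow> nat \<Rightarrow>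
     ('a, 'k) cochain \<Rightarrow> ('a, 'k) cochain \<Rightarrow> ('a, 'k) cochain" where
  "vee s p q k f g = vdash_op s p q f g - dashv_op s p q k f g"


section \<open>Hochschild cohomology\<close>

definition cocycles ::
    "('k::field \<Rightarrow> 'a \<Rightarrow> 'a::{ring, monoid_mult}) \<Rightarrow> nat \<Rightarrow> nat \<Rightarrow> ('a, 'k) cochain set" where
  "cocycles s p k = {f \<in> cochains s p k. hochschild s p f = 0}"

definition coboundaries ::
    "('k::field \<Rightarrow> 'a \<Rightarrow> 'a::{ring, monoid_mult}) \<Rightarrow> nat \<Rightarrow> nat \<Rightarrow> ('a, 'k) cochain set" where
  "coboundaries s p k = (case p of 0 \<Rightarrow> {0} | Suc p' \<Rightarrow> hochschild s p' ` cochains s p' k)"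

definition coh_class ::
    "('k::field \<Rightarrow> 'a \<Rightarrow> 'a::{ring, monoid_mult}) \<Rightarrow> nat \<Rightarrow> nat \<Rightarrow> ('a, 'k) cochain \<Rightarrow> ('a, 'k) cochain" where
  "coh_class s p k = quotient_map cscale (coboundaries s p k)"

definition cohomology ::
    "('k::field \<Rightarrow> 'a \<Rightarrow> 'a::{ring, monoid_mult}) \<Rightarrow> nat \<Rightarrow> nat \<Rightarrow> ('a, 'k) cochain set" where
  "cohomology s p k = coh_class s p k ` cocycles s p k"

text \<open>
  The map induced by the cup product on \<open>H\<^sup>p(A, A\<^sup>\<otimes>\<^sup>k) \<otimes> H\<^sup>q(A, A\<^sup>\<otimes>\<^sup>m)\<close>. A class is
  itself a cocycle representing it, so no choice of representatives appears in the formula.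
\<close>

definition coh_cup ::
    "('k::field \<Rightarrow> 'a \<Rightarrow> 'a::{ring, monoid_mult}) \<Rightarrow> nat \<Rightarrow> nat \<Rightarrow> nat \<Rightarrow> nat \<Rightarrow>
     (('a, 'k) cochain list \<Rightarrow>\<^sub>0 'k) \<Rightarrow> ('a, 'k) cochain" where
  "coh_cup s p k q m = zero_outside (tensor_space cscale [cohomology s p k, cohomology s q m])
     (lin_ext cscale (\<lambda>w. coh_class s (p + q) (k + m - 1) (cup s p q (w ! 0) (w ! 1))))"


section \<open>Direct sums of cochain spaces\<close>

text \<open>The direct sum of the cochain spaces of bidegree \<open>(p, k)\<close> with \<open>p \<ge> p0\<close> and \<open>k \<ge> k0\<close>.\<close>

type_synonym ('a, 'k) cochain_family = "nat \<Rightarrow> nat \<Rightarrow> ('a, 'k) cochain"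

definition cochain_sum ::
    "('k::field \<Rightarrow> 'a \<Rightarrow> 'a::{ring, monoid_mult}) \<Rightarrow> nat \<Rightarrow> nat \<Rightarrow> ('a, 'k) cochain_family set" where
  "cochain_sum s p0 k0 = {F. (\<forall>p k. if p0 \<le> p \<and> k0 \<le> k then F p k \<in> cochains s p k else F p k = 0)
     \<and> finite {(p, k). F p k \<noteq> 0}}"

definition sum_scale :: "'k::field \<Rightarrow> ('a, 'k) cochain_family \<Rightarrow> ('a, 'k) cochain_family" where
  "sum_scale c F = (\<lambda>p k. cscale c (F p k))"

definition homogeneous :: "nat \<Rightarrow> nat \<Rightarrow> ('a, 'k::field) cochain \<Rightarrow> ('a, 'k) cochain_family" where
  "homogeneous p k f = (\<lambda>p' k'. if p' = p \<and> k' = k then f else 0)"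

definition sum_b ::
    "('k::field \<Rightarrow> 'a \<Rightarrow> 'a::{ring, monoid_mult}) \<Rightarrow> ('a, 'k) cochain_family \<Rightarrow> ('a, 'k) cochain_family" where
  "sum_b s F = (\<lambda>r n. case r of 0 \<Rightarrow> 0 | Suc p \<Rightarrow> hochschild s p (F p n))"

definition sum_vee ::
    "('k::field \<Rightarrow> 'a \<Rightarrow> 'a::{ring, monoid_mult}) \<Rightarrow>
     ('a, 'k) cochain_family \<Rightarrow> ('a, 'k) cochain_family \<Rightarrow> ('a, 'k) cochain_family" where
  "sum_vee s F G = (\<lambda>r n. \<Sum>(p, q)\<in>{(p, q). p + q = r + 1}. \<Sum>(k, m)\<in>{(k, m). k + m = n + 1}.
     vee s p q k (F p k) (G q m))"

definition sum_cup ::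
    "('k::field \<Rightarrow> 'a \<Rightarrow> 'a::{ring, monoid_mult}) \<Rightarrow>
     ('a, 'k) cochain_family \<Rightarrow> ('a, 'k) cochain_family \<Rightarrow> ('a, 'k) cochain_family" where
  "sum_cup s F G = (\<lambda>r n. \<Sum>(p, q)\<in>{(p, q). p + q = r}. \<Sum>(k, m)\<in>{(k, m). k + m = n + 1}.
     cup s p q (F p k) (G q m))"

text \<open>The degree for which \<open>\<or>\<close> and \<open>b\<close> have degrees 0 and 1 is \<open>p - 1\<close>.\<close>

definition cochain_degree ::
    "('k::field \<Rightarrow> 'a \<Rightarrow> 'a::{ring, monoid_mult}) \<Rightarrow> nat \<Rightarrow> ('a, 'k) cochain_family set" where
  "cochain_degree s d = {F \<in> cochain_sum s 2 2. \<forall>p k. F p k \<noteq> 0 \<longrightarrow> p = d + 1}"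


section \<open>Associative DG algebras\<close>

text \<open>
  Non-unital, with underlying space a subspace \<open>C\<close> which is the direct sum of the \<open>V n\<close>.
\<close>

locale dg_algebra = vector_space scale
  for scale :: "'k::field \<Rightarrow> 'v \<Rightarrow> 'v::ab_group_add" +
  fixes C :: "'v set" and V :: "nat \<Rightarrow> 'v set"
    and mult :: "'v \<Rightarrow> 'v \<Rightarrow> 'v" and d :: "'v \<Rightarrow> 'v"
  assumes subspace_V: "subspace (V n)"
    and carrier: "C = span (\<Union>n. V n)"
    and direct: "finite I \<Longrightarrow> (\<And>n. n \<in> I \<Longrightarrow> x n \<in> V n) \<Longrightarrow> (\<Sum>n\<in>I. x n) = 0 \<Longrightarrow> n \<in> I \<Longrightarrow> x n = 0"
    and mult_closed: "u \<in> V m \<Longrightarrow> v \<in> V n \<Longrightarrow> mult u v \<in> V (m + n)"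
    and mult_add_left: "u \<in> C \<Longrightarrow> v \<in> C \<Longrightarrow> w \<in> C \<Longrightarrow> mult (u + v) w = mult u w + mult v w"
    and mult_add_right: "u \<in> C \<Longrightarrow> v \<in> C \<Longrightarrow> w \<in> C \<Longrightarrow> mult u (v + w) = mult u v + mult u w"
    and mult_scale_left: "u \<in> C \<Longrightarrow> v \<in> C \<Longrightarrow> mult (scale c u) v = scale c (mult u v)"
    and mult_scale_right: "u \<in> C \<Longrightarrow> v \<in> C \<Longrightarrow> mult u (scale c v) = scale c (mult u v)"
    and mult_assoc: "u \<in> C \<Longrightarrow> v \<in> C \<Longrightarrow> w \<in> C \<Longrightarrow> mult u (mult v w) = mult (mult u v) w"
    and d_closed: "u \<in> V n \<Longrightarrow> d u \<in> V (n + 1)"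
    and d_add: "u \<in> C \<Longrightarrow> v \<in> C \<Longrightarrow> d (u + v) = d u + d v"
    and d_scale: "u \<in> C \<Longrightarrow> d (scale c u) = scale c (d u)"
    and d_square: "u \<in> C \<Longrightarrow> d (d u) = 0"
    and Leibniz: "u \<in> V n \<Longrightarrow> v \<in> C \<Longrightarrow>
      d (mult u v) = mult (d u) v + scale ((-1) ^ n) (mult u (d v))"

end

theory Submission
  imports Defs
begin


text \<open>Every operation in the theorem is a composite of maps that apply one cochain to a block
  of consecutive tensor factors. \<open>act s f a p\<close> applies \<open>f\<close>, of arity
  \<open>p\<close>, to the block that has \<open>a\<close> factors to its left, and the product of
  \<open>A\<close> joins in as a cochain \<open>mu\<close> of bidegree (2, 1). Two relations then
  suffice. Operators on disjoint blocks commute up to a shift of position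
  (\<open>act_commute\<close>), and \<open>mu\<close> is associative (\<open>act_mu_assoc\<close>).
  The lemmas \<open>act_cup\<close>, \<open>act_vdash\<close>, \<open>act_dashv\<close> and
  \<open>act_coface_0\<close>, \<open>act_coface_mid\<close>, \<open>act_coface_last\<close> expand
  a composite cochain into such operators, also when it is applied inside a longer word. An identity
  between cochains thereby becomes a comparison of two words in these operators.

  The differential b is the alternating sum of p + 2 cofaces (\<open>hochschild_eq\<close>), and the
  cosimplicial identities give b b = 0 (\<open>hochschild_hochschild\<close>). Write |- and -| for
  \<open>vdash_op\<close> and \<open>dashv_op\<close>. In f |- g the last argument of f is the first
  factor of the value of g. Most cofaces of f and of g are cofaces of f |- g. The product of an
  argument of f with the first factor of the value of g occurs once as a coface of f and once as a
  coface of g, with opposite signs. The right action on the value of f is left over, and it produces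
  a cup product. For f of arity p and g with values in at least two factors this gives b(f |- g) =
  bf |- g + (-1)^(p-1) (f |- bg - f cup g), and the mirror image holds for -| if f has values in at
  least two factors (\<open>vdash_Leibniz\<close>, \<open>dashv_Leibniz\<close>).

  These two formulas carry both main claims. In their difference the cup products cancel, so b is a
  derivation for \<open>vee\<close> (\<open>vee_Leibniz\<close>). Read for cocycles, each one
  exhibits f cup g, up to sign, as the differential of f |- g or of f -| g; hence the cup product
  vanishes in cohomology as soon as one of the two formulas applies
  (\<open>cup_cocycle_coboundary\<close>).

  Associativity of \<open>vee\<close> splits into four identities such as f |- (g -| h) = (f |- g)
  -| h. The two mixed ones need the middle cochain to have two factors in its value, respectively
  two arguments, so that f and h do not compete for the same one (\<open>vee_assoc\<close>). The
  identities for \<open>cup\<close> follow the same pattern.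

  Families are sums of homogeneous ones, so additivity carries the identities over to direct sums.
  The map induced on the tensor product of cohomology spaces is reached through bilinearity of the
  cup product.\<close>

interpretation fscale: vector_space "fscale :: 'k::field \<Rightarrow> ('w \<Rightarrow>\<^sub>0 'k) \<Rightarrow> _"
  by (rule vector_space_fscale)

section \<open>Linear maps out of a free vector space\<close>

section \<open>Linear extensions\<close>

lemma lin_ext_add:
  assumes "vector_space t"
  shows "lin_ext t \<phi> (x + y) = lin_ext t \<phi> x + lin_ext t \<phi> y"
  using linear_lin_ext[OF assms, of \<phi>] by (simp add: Vector_Spaces.linear_iff)

lemma lin_ext_scale:
  assumes "vector_space t"
  shows "lin_ext t \<phi> (fscale c x) = t c (lin_ext t \<phi> x)"
  using linear_lin_ext[OF assms, of \<phi>] by (simp add: Vector_Spaces.linear_iff)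

lemma lin_ext_fun_add:
  assumes "vector_space t"
  shows "lin_ext t (\<lambda>w. \<phi> w + \<psi> w) x = lin_ext t \<phi> x + lin_ext t \<psi> x"
proof -
  interpret vector_space t by fact
  show ?thesis by (simp add: lin_ext_def scale_right_distrib sum.distrib)
qed

lemma lin_ext_fun_scale:
  assumes "vector_space t"
  shows "lin_ext t (\<lambda>w. t c (\<phi> w)) x = t c (lin_ext t \<phi> x)"
proof -
  interpret vector_space t by fact
  show ?thesis by (simp add: lin_ext_def scale_sum_right mult.commute)
qed

lemmas lin_ext_linear =
  lin_ext_add[OF vector_space_fscale] lin_ext_scale[OF vector_space_fscale]

lemmas lin_ext_fun_linear =
  lin_ext_fun_add[OF vector_space_fscale] lin_ext_fun_scale[OF vector_space_fscale]

lemma lin_ext_single_id: "lin_ext fscale (\<lambda>w. Poly_Mapping.single w 1) x = x"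
proof (rule poly_mapping_eqI)
  fix v
  show "Poly_Mapping.lookup (lin_ext fscale (\<lambda>w. Poly_Mapping.single w 1) x) v = Poly_Mapping.lookup x v"
    by (cases "v \<in> Poly_Mapping.keys x")
      (auto simp: lin_ext_def lookup_sum lookup_single when_def in_keys_iff if_distrib
        sum.delta' cong: if_cong)
qed

lemma linear_lin_ext_comp:
  assumes "Vector_Spaces.linear fscale t L"
  shows "L (lin_ext fscale \<phi> x) = lin_ext t (\<lambda>w. L (\<phi> w)) x"
proof -
  interpret Vector_Spaces.linear fscale t L by fact
  show ?thesis by (simp add: lin_ext_def sum scale)
qed

lemma linear_eq_lin_ext:
  assumes "Vector_Spaces.linear fscale t L"
  shows "L x = lin_ext t (\<lambda>w. L (Poly_Mapping.single w 1)) x"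
  using linear_lin_ext_comp[OF assms, of "\<lambda>w. Poly_Mapping.single w 1" x]
  by (simp add: lin_ext_single_id)

lemma lin_ext_in_subspace:
  assumes "vector_space t" "module.subspace t S" "\<And>w. w \<in> Poly_Mapping.keys x \<Longrightarrow> \<phi> w \<in> S"
  shows "lin_ext t \<phi> x \<in> S"
proof -
  interpret vector_space t by fact
  show ?thesis unfolding lin_ext_def using assms(2,3)
    by (intro subspace_sum subspace_scale) auto
qed


section \<open>Multilinear maps, tensor powers and induction over pure tensors\<close>

section \<open>Tensor spaces\<close>

lemma subspace_tensor_relations: "module.subspace fscale (tensor_relations s Vs)"
  unfolding tensor_relations_def by (rule fscale.subspace_span)

lemma linear_tensor_quotient:
  "Vector_Spaces.linear fscale fscale (quotient_map fscale (tensor_relations s Vs))"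
  by (rule quotient_map(1)[OF vector_space_fscale subspace_tensor_relations])

lemma tensor_quotient_eq_lin_ext:
  "quotient_map fscale (tensor_relations s Vs) x = lin_ext fscale (pure_tensor s Vs) x"
  unfolding pure_tensor_def[abs_def] by (rule linear_eq_lin_ext[OF linear_tensor_quotient])

lemma subspace_formal_sums: "module.subspace fscale (formal_sums Vs)"
  unfolding fscale.subspace_def formal_sums_def
  by (auto dest!: set_mp[OF Poly_Mapping.keys_add] simp: in_keys_iff)

lemma subspace_tensor_space: "module.subspace fscale (tensor_space s Vs)"
proof -
  interpret Q: Vector_Spaces.linear fscale fscale "quotient_map fscale (tensor_relations s Vs)"
    by (rule linear_tensor_quotient)
  show ?thesis
    unfolding tensor_space_def by (rule Q.subspace_image[OF subspace_formal_sums])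
qed

lemma pure_tensor_in: "w \<in> listset Vs \<Longrightarrow> pure_tensor s Vs w \<in> tensor_space s Vs"
  unfolding pure_tensor_def tensor_space_def formal_sums_def by auto

text \<open>The quotient map sends a word to its pure tensor, and there the extension of a
  multilinear \<open>\<phi>\<close> takes the value of \<open>\<phi>\<close> on the word. Passing to
  the chosen representative of a class therefore does not change the value.\<close>

lemma lin_ext_tensor_quotient:
  fixes s :: "'k::field \<Rightarrow> 'v \<Rightarrow> 'v::ab_group_add"
    and t :: "'k \<Rightarrow> 'u \<Rightarrow> 'u::ab_group_add"
  assumes t: "vector_space t"
    and add: "\<And>us x y vs. us @ x # vs \<in> listset Vs \<Longrightarrow> us @ y # vs \<in> listset Vs \<Longrightarrow>
        \<phi> (us @ (x + y) # vs) = \<phi> (us @ x # vs) + \<phi> (us @ y # vs)"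
    and scale: "\<And>us c x vs. us @ x # vs \<in> listset Vs \<Longrightarrow>
        \<phi> (us @ s c x # vs) = t c (\<phi> (us @ x # vs))"
  shows "lin_ext t \<phi> (quotient_map fscale (tensor_relations s Vs) v) = lin_ext t \<phi> v"
  unfolding tensor_quotient_eq_lin_ext linear_lin_ext_comp[OF linear_lin_ext[OF t]]
  by (simp add: lin_ext_pure_tensor[OF assms])

lemma pure_tensor_add:
  assumes "us @ x # vs \<in> listset Vs" "us @ y # vs \<in> listset Vs"
  shows "pure_tensor s Vs (us @ (x + y) # vs) = pure_tensor s Vs (us @ x # vs) + pure_tensor s Vs (us @ y # vs)"
proof -
  interpret Q: Vector_Spaces.linear fscale fscale "quotient_map fscale (tensor_relations s Vs)"
    by (rule linear_tensor_quotient)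
  have "Poly_Mapping.single (us @ (x + y) # vs) 1 - Poly_Mapping.single (us @ x # vs) 1
         - Poly_Mapping.single (us @ y # vs) 1 \<in> tensor_relations s Vs"
    unfolding tensor_relations_def by (rule fscale.span_base) (use assms in blast)
  then have "pure_tensor s Vs (us @ (x + y) # vs) - pure_tensor s Vs (us @ x # vs)
      - pure_tensor s Vs (us @ y # vs) = 0"
    unfolding pure_tensor_def Q.diff[symmetric]
    using quotient_map(3)[OF vector_space_fscale subspace_tensor_relations] by blast
  then show ?thesis by (simp add: algebra_simps)
qed

lemma pure_tensor_scale:
  fixes s :: "'k::field \<Rightarrow> 'v \<Rightarrow> 'v::ab_group_add"
  assumes "us @ x # vs \<in> listset Vs"
  shows "pure_tensor s Vs (us @ s c x # vs) = fscale c (pure_tensor s Vs (us @ x # vs))"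
proof -
  interpret Q: Vector_Spaces.linear fscale fscale "quotient_map fscale (tensor_relations s Vs)"
    by (rule linear_tensor_quotient)
  have single: "Poly_Mapping.single (us @ x # vs) c = fscale c (Poly_Mapping.single (us @ x # vs) (1::'k))"
    by (rule poly_mapping_eqI) (simp add: lookup_single when_def)
  have "Poly_Mapping.single (us @ s c x # vs) 1 - Poly_Mapping.single (us @ x # vs) c
      \<in> tensor_relations s Vs"
    unfolding tensor_relations_def by (rule fscale.span_base) (use assms in blast)
  then have "quotient_map fscale (tensor_relations s Vs) (Poly_Mapping.single (us @ s c x # vs) 1
      - Poly_Mapping.single (us @ x # vs) c) = 0"
    using quotient_map(3)[OF vector_space_fscale subspace_tensor_relations] by blast
  then show ?thesis by (simp add: pure_tensor_def Q.diff single Q.scale)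
qed

lemma listset_replicate_UNIV [simp]: "listset (replicate n UNIV) = {w. length w = n}"
  by (induction n) (auto simp: set_Cons_def length_Suc_conv)

lemma tens_add:
  "tens s (us @ (x + y) # vs) = tens s (us @ x # vs) + tens s (us @ y # vs)"
  unfolding tens_def
  using pure_tensor_add[of us x vs "replicate (length (us @ x # vs)) UNIV" y s]
  by (simp del: replicate.simps listset.simps)

lemma tens_scale: "tens s (us @ s c x # vs) = fscale c (tens s (us @ x # vs))"
  unfolding tens_def
  using pure_tensor_scale[of us x vs "replicate (length (us @ x # vs)) UNIV" s c]
  by (simp del: replicate.simps listset.simps)

lemma tens_in: "length w = n \<Longrightarrow> tens s w \<in> tpow s n"
  unfolding tens_def tpow_def by (simp add: pure_tensor_in)

lemma subspace_tpow: "module.subspace fscale (tpow s n)"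
  unfolding tpow_def by (rule subspace_tensor_space)

lemmas tpow_closed =
  fscale.subspace_0[OF subspace_tpow] fscale.subspace_add[OF subspace_tpow]
  fscale.subspace_diff[OF subspace_tpow] fscale.subspace_scale[OF subspace_tpow]
  fscale.subspace_sum[OF subspace_tpow]

lemma tpow_eq_span: "tpow s n = module.span fscale (tens s ` {w. length w = n})"
proof
  show "tpow s n \<subseteq> module.span fscale (tens s ` {w. length w = n})"
  proof
    fix x assume "x \<in> tpow s n"
    then obtain v where v: "v \<in> formal_sums (replicate n UNIV)"
      and x: "x = lin_ext fscale (pure_tensor s (replicate n UNIV)) v"
      by (auto simp: tpow_def tensor_space_def tensor_quotient_eq_lin_ext)
    have len: "length w = n" if "w \<in> Poly_Mapping.keys v" for w
      using v that by (auto simp: formal_sums_def)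
    have "lin_ext fscale (pure_tensor s (replicate n UNIV)) v
        \<in> module.span fscale (tens s ` {w. length w = n})"
    proof (rule lin_ext_in_subspace[OF vector_space_fscale fscale.subspace_span])
      fix w assume "w \<in> Poly_Mapping.keys v"
      then have "pure_tensor s (replicate n UNIV) w = tens s w" "length w = n"
        using len by (auto simp: tens_def)
      then show "pure_tensor s (replicate n UNIV) w \<in> module.span fscale (tens s ` {w. length w = n})"
        by (auto intro!: fscale.span_base)
    qed
    with x show "x \<in> module.span fscale (tens s ` {w. length w = n})" by simp
  qed
  show "module.span fscale (tens s ` {w. length w = n}) \<subseteq> tpow s n"
    by (rule fscale.span_minimal) (auto intro: tens_in subspace_tpow)
qed

text \<open>Pure tensors span the tensor power. There is no separate case for 0, because
  \<open>scale\<close> with the scalar 0 supplies it.\<close>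

lemma tpow_induct [consumes 1, case_names tens add scale]:
  assumes "x \<in> tpow s n"
    and tens: "\<And>w. length w = n \<Longrightarrow> P (tens s w)"
    and add: "\<And>x y. x \<in> tpow s n \<Longrightarrow> y \<in> tpow s n \<Longrightarrow> P x \<Longrightarrow> P y \<Longrightarrow> P (x + y)"
    and scale: "\<And>c x. x \<in> tpow s n \<Longrightarrow> P x \<Longrightarrow> P (fscale c x)"
  shows "P x"
proof -
  have zero: "P 0"
    using scale[of "tens s (replicate n 0)" 0] tens[of "replicate n 0"] by (simp add: tens_in)
  have "x \<in> tpow s n \<and> P x"
  proof (rule fscale.span_induct_alt[of x "tens s ` {w. length w = n}"])
    show "x \<in> module.span fscale (tens s ` {w. length w = n})"
      using assms(1) by (simp add: tpow_eq_span)
  qed (auto simp: zero tpow_closed intro!: tpow_closed add scale tens tens_in)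
  then show ?thesis by blast
qed

text \<open>Linearity is asked for on the tensor power only: a cochain is extended by 0 to the
  ambient space of formal sums and is in general not linear there.\<close>

definition tensor_linear ::
    "('k::field \<Rightarrow> 'a \<Rightarrow> 'a::ab_group_add) \<Rightarrow> nat \<Rightarrow> (('a, 'k) tensor \<Rightarrow> ('a, 'k) tensor) \<Rightarrow> bool" where
  "tensor_linear s n F \<longleftrightarrow> (\<forall>x\<in>tpow s n. \<forall>y\<in>tpow s n. F (x + y) = F x + F y)
     \<and> (\<forall>c. \<forall>x\<in>tpow s n. F (fscale c x) = fscale c (F x))"

lemma tensor_linear_eq:
  assumes "tensor_linear s n F" "tensor_linear s n G" "x \<in> tpow s n"
    and "\<And>w. length w = n \<Longrightarrow> F (tens s w) = G (tens s w)"
  shows "F x = G x"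
  using assms(3) by (induction rule: tpow_induct) (use assms in \<open>auto simp: tensor_linear_def\<close>)

text \<open>Identifies a formula given on words with an operator already known to be linear. The
  multilinearity of \<open>\<phi>\<close> comes for free from that of \<open>tens\<close>.\<close>

lemma lin_ext_eq_on_tpow:
  fixes s :: "'k::field \<Rightarrow> 'a \<Rightarrow> 'a::ab_group_add"
  assumes F: "tensor_linear s n F" and \<phi>: "\<And>w. length w = n \<Longrightarrow> \<phi> w = F (tens s w)"
    and x: "x \<in> tpow s n"
  shows "lin_ext fscale \<phi> x = F x"
proof (rule tensor_linear_eq[OF _ F x])
  show "tensor_linear s n (lin_ext fscale \<phi>)"
    by (simp add: tensor_linear_def lin_ext_linear)
  fix w :: "'a list" assume "length w = n"
  moreover have "lin_ext fscale \<phi> (pure_tensor s (replicate n UNIV) w) = \<phi> w"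
    using F by (intro lin_ext_pure_tensor[OF vector_space_fscale])
      (auto simp: \<phi> tens_add tens_scale tensor_linear_def tens_in)
  ultimately show "lin_ext fscale \<phi> (tens s w) = F (tens s w)"
    by (simp add: tens_def \<phi>)
qed


section \<open>Operators on blocks of tensor factors and their commutation\<close>

section \<open>Cochains acting on consecutive tensor factors\<close>

lemma cochain_add: "f \<in> cochains s p k \<Longrightarrow> x \<in> tpow s p \<Longrightarrow> y \<in> tpow s p \<Longrightarrow> f (x + y) = f x + f y"
  and cochain_scale: "f \<in> cochains s p k \<Longrightarrow> x \<in> tpow s p \<Longrightarrow> f (fscale c x) = fscale c (f x)"
  and cochain_in: "f \<in> cochains s p k \<Longrightarrow> x \<in> tpow s p \<Longrightarrow> f x \<in> tpow s k"
  and cochain_outside: "f \<in> cochains s p k \<Longrightarrow> x \<notin> tpow s p \<Longrightarrow> f x = 0"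
  by (auto simp: cochains_def hom_space_def)

lemma zero_outside_in_cochains:
  assumes "tensor_linear s p F" "\<And>x. x \<in> tpow s p \<Longrightarrow> F x \<in> tpow s k"
  shows "zero_outside (tpow s p) F \<in> cochains s p k"
  using assms by (auto simp: zero_outside_def cochains_def hom_space_def tensor_linear_def tpow_closed)

text \<open>The map sending x to the tensor product of \<open>l\<close>, x and \<open>r\<close>; it
  carries identities between cochains into longer words.\<close>

definition sandwich ::
    "('k::field \<Rightarrow> 'a \<Rightarrow> 'a::ab_group_add) \<Rightarrow> 'a list \<Rightarrow> 'a list \<Rightarrow> ('a, 'k) tensor \<Rightarrow> ('a, 'k) tensor" where
  "sandwich s l r = lin_ext fscale (\<lambda>u. tens s (l @ u @ r))"

text \<open>\<open>act s f a p\<close> is \<open>f\<close>, of arity \<open>p\<close>, with \<open>a\<close> tensor factors to its left.\<close>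

definition act ::
    "('k::field \<Rightarrow> 'a \<Rightarrow> 'a::{ring, monoid_mult}) \<Rightarrow> ('a, 'k) cochain \<Rightarrow> nat \<Rightarrow> nat \<Rightarrow> ('a, 'k) cochain" where
  "act s f a p = apply_at s f (Suc a) (a + p)"

text \<open>\<open>tens s w\<close> is a formal sum chosen to represent a class, not the word
  \<open>w\<close> itself; for a multilinear \<open>\<phi>\<close> the difference is
  invisible.\<close>

lemma lin_ext_tens:
  fixes s :: "'k::field \<Rightarrow> 'v \<Rightarrow> 'v::ab_group_add" and \<phi> :: "'v list \<Rightarrow> ('w \<Rightarrow>\<^sub>0 'k)"
  assumes "\<And>us x y vs. length w = Suc (length us + length vs) \<Longrightarrow>
        \<phi> (us @ (x + y) # vs) = \<phi> (us @ x # vs) + \<phi> (us @ y # vs)"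
    and "\<And>us c x vs. length w = Suc (length us + length vs) \<Longrightarrow>
        \<phi> (us @ s c x # vs) = fscale c (\<phi> (us @ x # vs))"
  shows "lin_ext fscale \<phi> (tens s w) = \<phi> w"
  unfolding tens_def by (rule lin_ext_pure_tensor[OF vector_space_fscale]) (simp_all add: assms)

lemma sandwich_tens: "sandwich s l r (tens s u) = tens s (l @ u @ r)"
  unfolding sandwich_def
  using tens_add[of s "l @ us" _ _ "vs @ r" for us vs] tens_scale[of s "l @ us" _ _ "vs @ r" for us vs]
  by (subst lin_ext_tens) auto

lemma sandwich_linear:
  "sandwich s l r (x + y) = sandwich s l r x + sandwich s l r y"
  "sandwich s l r (fscale c x) = fscale c (sandwich s l r x)"
  by (simp_all add: sandwich_def lin_ext_linear)

lemma sandwich_left_linear: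
  "sandwich s (us @ (a + b) # vs) r x = sandwich s (us @ a # vs) r x + sandwich s (us @ b # vs) r x"
  "sandwich s (us @ s c a # vs) r x = fscale c (sandwich s (us @ a # vs) r x)"
  by (simp_all add: sandwich_def tens_add tens_scale lin_ext_fun_linear)

lemma sandwich_right_linear:
  "sandwich s l (us @ (a + b) # vs) x = sandwich s l (us @ a # vs) x + sandwich s l (us @ b # vs) x"
  "sandwich s l (us @ s c a # vs) x = fscale c (sandwich s l (us @ a # vs) x)"
  using tens_add[of s "l @ u @ us" _ _ vs for u] tens_scale[of s "l @ u @ us" _ _ vs for u]
  by (simp_all add: sandwich_def lin_ext_fun_linear)

lemma sandwich_in:
  "x \<in> tpow s n \<Longrightarrow> m = length l + n + length r \<Longrightarrow> sandwich s l r x \<in> tpow s m"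
  by (induction rule: tpow_induct)
    (auto simp: sandwich_tens sandwich_linear tpow_closed intro!: tens_in)

lemma sandwich_sandwich:
  "x \<in> tpow s n \<Longrightarrow> sandwich s l r (sandwich s l' r' x) = sandwich s (l @ l') (r' @ r) x"
  by (induction rule: tpow_induct) (simp_all add: sandwich_tens sandwich_linear)

lemma sandwich_Nil: "x \<in> tpow s n \<Longrightarrow> sandwich s [] [] x = x"
  by (induction rule: tpow_induct) (simp_all add: sandwich_tens sandwich_linear)

lemma act_eq:
  "act s f a p = lin_ext fscale
     (\<lambda>w. sandwich s (take a w) (drop (a + p) w) (f (tens s (take p (drop a w)))))"
  by (simp add: act_def apply_at_def sandwich_def)

lemma act_linear:
  "act s f a p (x + y) = act s f a p x + act s f a p y"
  "act s f a p (fscale c x) = fscale c (act s f a p x)"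
  by (simp_all add: act_eq lin_ext_linear)

lemma position_cases:
  fixes a u p :: nat
  obtains d where "a = Suc (u + d)" | d e where "u = a + d" "p = Suc (d + e)" | "u \<ge> a + p"
proof (cases "u < a")
  case True
  then show ?thesis using that(1) less_iff_Suc_add by metis
next
  case False
  then obtain d where d: "u = a + d" by (metis nat_le_iff_add linorder_not_le)
  show ?thesis
  proof (cases "d < p")
    case True
    then show ?thesis using that(2) d less_iff_Suc_add by metis
  next
    case False
    then show ?thesis using that(3) d by simp
  qed
qed

text \<open>What has to be seen is that the formula in \<open>act_eq\<close> is multilinear in the
  word.\<close>

lemma act_tens:
  assumes f: "f \<in> cochains s p k" and l: "length l = a" and m: "length m = p"
  shows "act s f a p (tens s (l @ m @ r)) = sandwich s l r (f (tens s m))"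
proof -
  let ?\<phi> = "\<lambda>w. sandwich s (take a w) (drop (a + p) w) (f (tens s (take p (drop a w))))"
  have "?\<phi> (us @ (x + y) # vs) = ?\<phi> (us @ x # vs) + ?\<phi> (us @ y # vs)
      \<and> ?\<phi> (us @ s c x # vs) = fscale c (?\<phi> (us @ x # vs))"
    if len: "length (l @ m @ r) = Suc (length us + length vs)" for us x y c vs
  proof -
    show ?thesis
    \<comment> \<open>The varying slot lies to the right of \<open>us\<close>: left of the block,
      inside it, or beyond it. Linearity then comes from the left word, from \<open>f\<close>, or
      from the right word.\<close>
    proof (cases rule: position_cases[where a = a and u = "length us" and p = p])
      case 1
      then show ?thesis by (simp add: sandwich_left_linear)
    next
      case (2 d e)
      then have e: "e \<le> length vs" using l m len by simp
      have "tens s (drop a us @ z # take e vs) \<in> tpow s p" for z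
        using 2 e by (intro tens_in) simp
      then show ?thesis using 2
        by (simp add: tens_add tens_scale cochain_add[OF f] cochain_scale[OF f] sandwich_linear)
    next
      case 3
      then show ?thesis by (simp add: sandwich_right_linear)
    qed
  qed
  then have "act s f a p (tens s (l @ m @ r)) = ?\<phi> (l @ m @ r)"
    unfolding act_eq by (intro lin_ext_tens) blast+
  then show ?thesis using l m by simp
qed

lemma word_split:
  assumes "length w = n" "a + p \<le> n"
  obtains l m r where "w = l @ m @ r" "length l = a" "length m = p" "length r = n - a - p"
proof
  show "w = take a w @ take p (drop a w) @ drop (a + p) w"
    by (metis add.commute append_take_drop_id drop_drop)
qed (use assms in auto)

lemma act_sandwich:
  assumes f: "f \<in> cochains s p k" and l: "length l = a" and x: "x \<in> tpow s p"
  shows "act s f a p (sandwich s l r x) = sandwich s l r (f x)"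
  using x by (induction rule: tpow_induct)
    (simp_all add: sandwich_tens sandwich_linear act_linear act_tens[OF f l]
      cochain_add[OF f] cochain_scale[OF f])

lemma act_0: "f \<in> cochains s p k \<Longrightarrow> x \<in> tpow s p \<Longrightarrow> act s f 0 p x = f x"
  using act_sandwich[of f s p k "[]" 0 x "[]"]
  by (metis cochain_in list.size(3) sandwich_Nil)

lemma act_in:
  assumes f: "f \<in> cochains s p k" and x: "x \<in> tpow s N" and "a + p \<le> N" "M + p = N + k"
  shows "act s f a p x \<in> tpow s M"
  using x
proof (induction rule: tpow_induct)
  case (tens w)
  then obtain l m r where w: "w = l @ m @ r" "length l = a" "length m = p" "length r = N - a - p"
    using word_split assms(3) by metis
  then show ?case
    using assms by (auto simp: act_tens[OF f] intro!: sandwich_in cochain_in[OF f] tens_in)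
qed (simp_all add: act_linear tpow_closed)

lemma sandwich_act:
  assumes f: "f \<in> cochains s p k" and y: "y \<in> tpow s n" and "a + p \<le> n" and c: "c = length l + a"
  shows "sandwich s l r (act s f a p y) = act s f c p (sandwich s l r y)"
  using y
proof (induction rule: tpow_induct)
  case (tens w)
  then obtain l' m' r' where w: "w = l' @ m' @ r'" "length l' = a" "length m' = p"
    using word_split assms(3) by metis
  have "f (tens s m') \<in> tpow s k" using w by (intro cochain_in[OF f] tens_in)
  then show ?case
    using w c act_tens[OF f, of "l @ l'" c m' "r' @ r"]
    by (simp add: act_tens[OF f] sandwich_sandwich sandwich_tens)
qed (simp_all add: act_linear sandwich_linear)

text \<open>Applying \<open>f\<close> first replaces \<open>p\<close> factors to the left of the
  block of \<open>g\<close> by \<open>k\<close>, which moves that block from \<open>b\<close> to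
  \<open>b'\<close>. The relation is stated additively to avoid truncated subtraction.\<close>

lemma act_commute:
  assumes f: "f \<in> cochains s p k" and g: "g \<in> cochains s q m" and x: "x \<in> tpow s N"
    and ab: "a + p \<le> b" "b + q \<le> N" and b': "b' + p = b + k"
  shows "act s f a p (act s g b q x) = act s g b' q (act s f a p x)"
  using x
proof (induction rule: tpow_induct)
  case (tens w)
  obtain l1 m2 r where w1: "w = l1 @ m2 @ r" "length l1 = b" "length m2 = q"
    using word_split[OF tens ab(2)] by metis
  obtain l m1 l' where w2: "l1 = l @ m1 @ l'" "length l = a" "length m1 = p"
    using word_split[OF w1(2) ab(1)] by metis
  define z where "z = f (tens s m1)"
  define y where "y = g (tens s m2)"
  have z: "z \<in> tpow s k" unfolding z_def using w2 by (intro cochain_in[OF f] tens_in)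
  have y: "y \<in> tpow s m" unfolding y_def using w1 by (intro cochain_in[OF g] tens_in)
  have w: "w = l @ m1 @ l' @ m2 @ r" using w1 w2 by simp
  \<comment> \<open>Neither value is a word, so both orders are compared with one expression that is
    linear in \<open>y\<close> and in \<open>z\<close>: insert each term of \<open>z\<close> between
    \<open>l\<close> and \<open>l'\<close>. One side is settled by induction on \<open>y\<close>,
    the other by induction on \<open>z\<close>.\<close>
  have L: "act s f a p (sandwich s (l @ m1 @ l') r y) = lin_ext fscale (\<lambda>u. sandwich s (l @ u @ l') r y) z"
    using y
  proof (induction rule: tpow_induct)
    case (tens v)
    then show ?case
      using act_tens[OF f w2(2,3), of "l' @ v @ r"]
      by (simp add: sandwich_tens z_def) (simp add: sandwich_def)
  qed (simp_all add: sandwich_linear act_linear lin_ext_fun_linear)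
  have R: "act s g b' q (sandwich s l (l' @ m2 @ r) z) = lin_ext fscale (\<lambda>u. sandwich s (l @ u @ l') r y) z"
    using z
  proof (induction rule: tpow_induct)
    case (tens u)
    then have "length (l @ u @ l') = b'" using w1 w2 b' by simp
    moreover have "lin_ext fscale (\<lambda>u. sandwich s (l @ u @ l') r y) (tens s u) = sandwich s (l @ u @ l') r y"
      using sandwich_left_linear[of s "l @ us" _ _ "vs @ l'" r y for us vs]
      by (intro lin_ext_tens) auto
    ultimately show ?case
      using act_tens[OF g _ w1(3), of "l @ u @ l'" b' r] by (simp add: sandwich_tens y_def)
  qed (simp_all add: sandwich_linear act_linear lin_ext_linear)
  have "act s g b q (tens s w) = sandwich s (l @ m1 @ l') r y"
    using act_tens[OF g w1(2,3), of r] w1 w2 by (simp add: y_def)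
  moreover have "act s f a p (tens s w) = sandwich s l (l' @ m2 @ r) z"
    using act_tens[OF f w2(2,3), of "l' @ m2 @ r"] w by (simp add: z_def)
  ultimately show ?case using L R by simp
qed (simp_all add: act_linear)

text \<open>A description of \<open>h\<close> by operators compatible with \<open>sandwich\<close> is inherited by \<open>act s h c n\<close>.\<close>

lemma act_shift:
  assumes h: "h \<in> cochains s n l" and "c + n \<le> N" and x: "x \<in> tpow s N"
    and \<Phi>: "\<And>y. y \<in> tpow s n \<Longrightarrow> h y = \<Phi> y"
    and \<Psi>: "\<And>l r y. length l = c \<Longrightarrow> y \<in> tpow s n \<Longrightarrow> sandwich s l r (\<Phi> y) = \<Psi> (sandwich s l r y)"
    and lin: "\<And>x y. \<Psi> (x + y) = \<Psi> x + \<Psi> y" "\<And>a x. \<Psi> (fscale a x) = fscale a (\<Psi> x)"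
  shows "act s h c n x = \<Psi> x"
  using x
proof (induction rule: tpow_induct)
  case (tens w)
  then obtain l' m' r' where w: "w = l' @ m' @ r'" "length l' = c" "length m' = n"
    using word_split assms(2) by metis
  then have "act s h c n (tens s w) = sandwich s l' r' (\<Phi> (tens s m'))"
    by (simp add: act_tens[OF h] \<Phi> tens_in)
  also have "\<dots> = \<Psi> (tens s w)"
    using w by (simp add: \<Psi> tens_in sandwich_tens)
  finally show ?case .
qed (simp_all add: act_linear lin)

text \<open>The two-operator case of \<open>act_shift\<close>: with \<open>c\<close> more factors on
  the left, both positions in the factorization of \<open>h\<close> move by
  \<open>c\<close>.\<close>

lemma act_comp:
  fixes s :: "'k::field \<Rightarrow> 'a \<Rightarrow> 'a::{ring, monoid_mult}"
  assumes h: "h \<in> cochains s n l" and f: "f \<in> cochains s p k" and g: "g \<in> cochains s q m"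
    and "c + n \<le> N" "b + q \<le> n" "a + p + q \<le> n + m" "a' = c + a" "b' = c + b" and x: "x \<in> tpow s N"
    and hfg: "\<And>y. y \<in> tpow s n \<Longrightarrow> h y = act s f a p (act s g b q y)"
  shows "act s h c n x = act s f a' p (act s g b' q x)"
proof (rule act_shift[OF h assms(4) x hfg])
  fix l r :: "'a list" and y :: "('a, 'k) tensor"
  assume l: "length l = c" and y: "y \<in> tpow s n"
  have "act s g b q y \<in> tpow s (n + m - q)"
    using assms by (intro act_in[OF g y]) auto
  then show "sandwich s l r (act s f a p (act s g b q y))
      = act s f a' p (act s g b' q (sandwich s l r y))"
    using assms l by (simp add: sandwich_act[OF f, of _ "n + m - q"] sandwich_act[OF g y])
qed (simp_all add: act_linear)


section \<open>Products and cofaces as words in block operators\<close>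

section \<open>The operations as operators\<close>

text \<open>Off the tensor power both cochains are 0. On it, \<open>act\<close> at position 0 is
  evaluation, which is the form in which the expansions below apply.\<close>

lemma cochain_eqI:
  assumes "f \<in> cochains s n l" "g \<in> cochains s n l'"
    and "\<And>x. x \<in> tpow s n \<Longrightarrow> act s f 0 n x = act s g 0 n x"
  shows "f = g"
proof
  fix x
  show "f x = g x"
    using assms by (cases "x \<in> tpow s n") (auto simp: act_0 cochain_outside)
qed

lemma cochain_of_eq:
  assumes "tensor_linear s n \<Phi>" "\<And>w. length w = n \<Longrightarrow> \<phi> w = \<Phi> (tens s w)"
  shows "cochain_of s n \<phi> = zero_outside (tpow s n) \<Phi>"
  unfolding cochain_of_def zero_outside_def using lin_ext_eq_on_tpow[OF assms] by auto

context unital_algebra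
begin

text \<open>The product of \<open>A\<close> as a 2-cochain with values in the first tensor power, so
  that it obeys the same commutation rule as every other cochain.\<close>

definition mu :: "('a, 'k) cochain" where
  "mu = cochain_of scale 2 (\<lambda>as. tens scale [as ! 0 * as ! 1])"

lemma lin_ext_mu:
  assumes "length w = 2"
  shows "lin_ext fscale (\<lambda>as. tens scale [as ! 0 * as ! 1]) (tens scale w) = tens scale [w ! 0 * w ! 1]"
proof (rule lin_ext_tens)
  fix us vs :: "'a list" and x y :: 'a and c
  assume "length w = Suc (length us + length vs)"
  then consider v where "us = []" "vs = [v]" | u where "us = [u]" "vs = []"
    using assms by (cases us; cases vs) auto
  then show "tens scale [(us @ (x + y) # vs) ! 0 * (us @ (x + y) # vs) ! 1]
        = tens scale [(us @ x # vs) ! 0 * (us @ x # vs) ! 1]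
          + tens scale [(us @ y # vs) ! 0 * (us @ y # vs) ! 1]"
    and "tens scale [(us @ scale c x # vs) ! 0 * (us @ scale c x # vs) ! 1]
        = fscale c (tens scale [(us @ x # vs) ! 0 * (us @ x # vs) ! 1])"
    using tens_add[of scale "[]" _ _ "[]"] tens_scale[of scale "[]" _ _ "[]"]
    by (cases; simp add: algebra_simps scale_mult_left scale_mult_right)+
qed

lemma mu_in: "mu \<in> cochains scale 2 1"
  unfolding mu_def cochain_of_def
proof (rule zero_outside_in_cochains)
  fix x :: "('a, 'k) tensor"
  assume "x \<in> tpow scale 2"
  then show "lin_ext fscale (\<lambda>as. tens scale [as ! 0 * as ! 1]) x \<in> tpow scale 1"
    by (induction rule: tpow_induct)
      (auto simp: lin_ext_mu[simplified] lin_ext_linear tpow_closed intro!: tens_in)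
qed (simp add: tensor_linear_def lin_ext_linear)

lemma mu_tens: "mu (tens scale [a, b]) = tens scale [a * b]"
  using lin_ext_mu[of "[a, b]"] by (simp add: mu_def cochain_of_def zero_outside_def tens_in)

lemma act_mu_tens:
  "length l = a \<Longrightarrow> act scale mu a 2 (tens scale (l @ x # y # r)) = tens scale (l @ (x * y) # r)"
  using act_tens[OF mu_in, of l a "[x, y]" r] by (simp add: mu_tens sandwich_tens)

text \<open>This is where associativity of \<open>A\<close> enters; the later identities between
  cochains rest on it and on \<open>act_commute\<close>.\<close>

lemma act_mu_assoc:
  assumes x: "x \<in> tpow scale N" and "a + 3 \<le> N" "b = Suc a"
  shows "act scale mu a 2 (act scale mu b 2 x) = act scale mu a 2 (act scale mu a 2 x)"
  using x
proof (induction rule: tpow_induct)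
  case (tens w)
  then obtain l m r where w: "w = l @ m @ r" "length l = a" "length m = 3"
    using word_split assms(2) by metis
  then obtain x y z where "m = [x, y, z]"
    by (auto simp: length_Suc_conv numeral_3_eq_3)
  then show ?case
    using w assms(3) act_mu_tens[of "l @ [x]" "Suc a" y z r]
    by (simp add: act_mu_tens mult.assoc)
qed (simp_all add: act_linear)

lemma lact_eq:
  assumes "x \<in> tpow scale k" "k \<ge> 1"
  shows "lact scale b x = act scale mu 0 2 (sandwich scale [b] [] x)"
  unfolding lact_def
proof (rule lin_ext_eq_on_tpow[OF _ _ assms(1)])
  fix w :: "'a list" assume "length w = k"
  then obtain h t where "w = h # t" using assms(2) by (cases w) auto
  then show "tens scale ((b * hd w) # tl w) = act scale mu 0 2 (sandwich scale [b] [] (tens scale w))"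
    using act_mu_tens[of "[]"] by (simp add: sandwich_tens)
qed (simp add: tensor_linear_def act_linear sandwich_linear)

lemma ract_eq:
  assumes "x \<in> tpow scale (Suc k)"
  shows "ract scale x c = act scale mu k 2 (sandwich scale [] [c] x)"
  unfolding ract_def
proof (rule lin_ext_eq_on_tpow[OF _ _ assms])
  fix w :: "'a list" assume "length w = Suc k"
  then obtain h t where "w = t @ [h]" "length t = k" by (cases w rule: rev_cases) auto
  then show "tens scale (butlast w @ [last w * c])
      = act scale mu k 2 (sandwich scale [] [c] (tens scale w))"
    using act_mu_tens[of t] by (simp add: sandwich_tens)
qed (simp add: tensor_linear_def act_linear sandwich_linear)

lemma At_mult_tens:
  assumes y: "y \<in> tpow scale m" "m \<ge> 1" and w: "length w = Suc k"
  shows "lin_ext fscale (\<lambda>v. tens scale (butlast w @ (last w * hd v) # tl v)) y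
     = act scale mu k 2 (sandwich scale w [] y)"
proof (rule lin_ext_eq_on_tpow[OF _ _ y(1)])
  fix v :: "'a list" assume "length v = m"
  then obtain h t where "v = h # t" using y(2) by (cases v) auto
  moreover obtain h' t' where "w = t' @ [h']" "length t' = k" using w by (cases w rule: rev_cases) auto
  ultimately show "tens scale (butlast w @ (last w * hd v) # tl v)
      = act scale mu k 2 (sandwich scale w [] (tens scale v))"
    using act_mu_tens[of t' k] by (simp add: sandwich_tens)
qed (simp add: tensor_linear_def act_linear sandwich_linear)

text \<open>The arguments \<open>v\<close> of \<open>g\<close> travel to the right of
  \<open>x\<close>, so that evaluating \<open>g\<close> also becomes a block operator on one longer
  word.\<close>

lemma At_mult_eq:
  assumes x: "x \<in> tpow scale (Suc k)" and g: "g \<in> cochains scale q m" "m \<ge> 1" and v: "length v = q"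
  shows "At_mult scale x (g (tens scale v))
     = act scale mu k 2 (act scale g (Suc k) q (sandwich scale [] v x))"
  unfolding At_mult_def
proof (rule lin_ext_eq_on_tpow[OF _ _ x])
  fix w :: "'a list" assume w: "length w = Suc k"
  have "g (tens scale v) \<in> tpow scale m" by (rule cochain_in[OF g(1) tens_in[OF v]])
  from At_mult_tens[OF this g(2) w]
  show "lin_ext fscale (\<lambda>v. tens scale (butlast w @ (last w * hd v) # tl v)) (g (tens scale v))
      = act scale mu k 2 (act scale g (Suc k) q (sandwich scale [] v (tens scale w)))"
    using act_tens[OF g(1) w v, of "[]"] by (simp add: sandwich_tens)
qed (simp add: tensor_linear_def act_linear sandwich_linear)

text \<open>\<open>g\<close> acts right after the \<open>Suc k\<close> factors of the value of
  \<open>f\<close>, and \<open>mu\<close> at \<open>k\<close> merges the two factors that meet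
  there.\<close>

lemma cup_eq:
  assumes f: "f \<in> cochains scale p (Suc k)" and g: "g \<in> cochains scale q m" "m \<ge> 1"
  shows "cup scale p q f g = zero_outside (tpow scale (p + q))
     (\<lambda>x. act scale mu k 2 (act scale g (Suc k) q (act scale f 0 p x)))"
  unfolding cup_def
proof (rule cochain_of_eq)
  fix w :: "'a list" assume w: "length w = p + q"
  then have "f (tens scale (take p w)) \<in> tpow scale (Suc k)"
    by (intro cochain_in[OF f] tens_in) simp
  from At_mult_eq[OF this g, of "drop p w"]
  show "At_mult scale (f (tens scale (take p w))) (g (tens scale (drop p w)))
      = act scale mu k 2 (act scale g (Suc k) q (act scale f 0 p (tens scale w)))"
    using act_tens[OF f, of "[]" 0 "take p w" "drop p w"] w by simp
qed (simp add: tensor_linear_def act_linear)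

lemma cup_in:
  assumes f: "f \<in> cochains scale p (Suc k)" and g: "g \<in> cochains scale q m" "m \<ge> 1"
  shows "cup scale p q f g \<in> cochains scale (p + q) (k + m)"
  unfolding cup_eq[OF assms] using g(2)
  by (intro zero_outside_in_cochains act_in[OF mu_in] act_in[OF g(1)] act_in[OF f])
    (auto simp: tensor_linear_def act_linear add.commute)

lemma act_cup:
  assumes f: "f \<in> cochains scale p (Suc k)" and g: "g \<in> cochains scale q m" "m \<ge> 1"
    and "c + p + q \<le> N" and x: "x \<in> tpow scale N" and "a = c + k" "b = Suc a" "n = p + q"
  shows "act scale (cup scale p q f g) c n x
     = act scale mu a 2 (act scale g b q (act scale f c p x))"
proof (rule act_shift[where N = N and l = "k + m"])
  show "cup scale p q f g y = act scale mu k 2 (act scale g (Suc k) q (act scale f 0 p y))"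
    if "y \<in> tpow scale n" for y
    using that assms(8) by (simp add: cup_eq[OF f g] zero_outside_def)
next
  fix l r :: "'a list" and y :: "('a, 'k) tensor"
  assume l: "length l = c" and y: "y \<in> tpow scale n"
  have 1: "act scale f 0 p y \<in> tpow scale (Suc k + q)"
    using assms by (intro act_in[OF f y]) auto
  have 2: "act scale g (Suc k) q (act scale f 0 p y) \<in> tpow scale (Suc k + m)"
    by (intro act_in[OF g(1) 1]) auto
  show "sandwich scale l r (act scale mu k 2 (act scale g (Suc k) q (act scale f 0 p y)))
      = act scale mu a 2 (act scale g b q (act scale f c p (sandwich scale l r y)))"
    using assms l
    by (simp add: sandwich_act[OF mu_in 2, where c = a] sandwich_act[OF g(1) 1, where c = b]
        sandwich_act[OF f y, where c = c])
qed (use assms cup_in[OF f g] in \<open>auto simp: act_linear\<close>)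

text \<open>Relative to \<open>c\<close>, the operator of \<open>g\<close> stands at
  \<open>p\<close>, the place of the last of the \<open>Suc p\<close> arguments of \<open>f\<close>:
  there \<open>f\<close> consumes the first factor of the value of \<open>g\<close>.\<close>

lemma act_vdash:
  assumes f: "f \<in> cochains scale (Suc p) k" and g: "g \<in> cochains scale q m" "m \<ge> 1"
    and "c + p + q \<le> N" and x: "x \<in> tpow scale N" and "a = c + p" "n = p + q" "p' = Suc p"
  shows "vdash_op scale p' q f g \<in> cochains scale n (k + m - 1)"
    and "act scale (vdash_op scale p' q f g) c n x = act scale f c p' (act scale g a q x)"
proof -
  have eq: "vdash_op scale p' q f g
      = zero_outside (tpow scale n) (\<lambda>y. act scale f 0 p' (act scale g p q y))"
    using assms by (simp add: vdash_op_def act_def comp_def)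
  then have val: "y \<in> tpow scale n \<Longrightarrow> vdash_op scale p' q f g y
      = act scale f 0 p' (act scale g p q y)" for y
    by (simp add: zero_outside_def)
  show mem: "vdash_op scale p' q f g \<in> cochains scale n (k + m - 1)"
    unfolding eq using assms(7,8) g(2)
    by (intro zero_outside_in_cochains act_in[OF f[folded assms(8)]] act_in[OF g(1)])
      (auto simp: tensor_linear_def act_linear)
  show "act scale (vdash_op scale p' q f g) c n x = act scale f c p' (act scale g a q x)"
    using assms
    by (intro act_comp[OF mem f[folded assms(8)] g(1), where N = N and a = 0 and b = p] val) auto
qed

text \<open>Relative to \<open>c\<close>, the operator of \<open>g\<close> stands at
  \<open>k\<close>, on the last of the \<open>Suc k\<close> factors of the value of
  \<open>f\<close>, which becomes its first argument.\<close>

lemma act_dashv: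
  assumes f: "f \<in> cochains scale p (Suc k)" and g: "g \<in> cochains scale (Suc q) m"
    and "c + p + q \<le> N" and x: "x \<in> tpow scale N" and "a = c + k" "n = p + q" "q' = Suc q" "k' = Suc k"
  shows "dashv_op scale p q' k' f g \<in> cochains scale n (k + m)"
    and "act scale (dashv_op scale p q' k' f g) c n x = act scale g a q' (act scale f c p x)"
proof -
  have eq: "dashv_op scale p q' k' f g
      = zero_outside (tpow scale n) (\<lambda>y. act scale g k q' (act scale f 0 p y))"
    using assms by (simp add: dashv_op_def act_def comp_def)
  then have val: "y \<in> tpow scale n \<Longrightarrow> dashv_op scale p q' k' f g y
      = act scale g k q' (act scale f 0 p y)" for y
    by (simp add: zero_outside_def)
  show mem: "dashv_op scale p q' k' f g \<in> cochains scale n (k + m)"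
    unfolding eq using assms(6,7,8)
    by (intro zero_outside_in_cochains act_in[OF g[folded assms(7)]] act_in[OF f])
      (auto simp: tensor_linear_def act_linear add.commute)
  show "act scale (dashv_op scale p q' k' f g) c n x = act scale g a q' (act scale f c p x)"
    using assms
    by (intro act_comp[OF mem g[folded assms(7)] f, where N = N and a = k and b = 0] val) auto
qed

text \<open>The cosimplicial structure behind the Hochschild complex: left action on the value,
  products of neighbouring arguments, right action on the value. The exponent \<open>k\<close> is
  needed to locate the factor on which the right action falls.\<close>

definition coface :: "nat \<Rightarrow> nat \<Rightarrow> nat \<Rightarrow> ('a, 'k) cochain \<Rightarrow> ('a, 'k) cochain" where
  "coface p k i f = zero_outside (tpow scale (Suc p)) (\<lambda>x.
     if i = 0 then act scale mu 0 2 (act scale f 1 p x)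
     else if i \<le> p then act scale f 0 p (act scale mu (i - 1) 2 x)
     else act scale mu (k - 1) 2 (act scale f 0 p x))"

lemma coface_in:
  assumes f: "f \<in> cochains scale p k" and k: "k \<ge> 1"
  shows "coface p k i f \<in> cochains scale (Suc p) k"
  unfolding coface_def
proof (rule zero_outside_in_cochains)
  fix x :: "('a, 'k) tensor" assume x: "x \<in> tpow scale (Suc p)"
  have "act scale mu 0 2 (act scale f 1 p x) \<in> tpow scale k"
    using k by (intro act_in[OF mu_in] act_in[OF f x]) auto
  moreover have "act scale mu (k - 1) 2 (act scale f 0 p x) \<in> tpow scale k"
    using k by (intro act_in[OF mu_in] act_in[OF f x]) auto
  moreover have "act scale f 0 p (act scale mu (i - 1) 2 x) \<in> tpow scale k" if "i \<noteq> 0" "i \<le> p"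
    using that by (intro act_in[OF f] act_in[OF mu_in x]) auto
  ultimately show "(if i = 0 then act scale mu 0 2 (act scale f 1 p x)
     else if i \<le> p then act scale f 0 p (act scale mu (i - 1) 2 x)
     else act scale mu (k - 1) 2 (act scale f 0 p x)) \<in> tpow scale k" by simp
qed (simp add: tensor_linear_def act_linear)

text \<open>\<open>Suc a = c + k\<close> says that \<open>a\<close> is the position of the last of
  the \<open>k\<close> factors of the value, the one the right action multiplies.\<close>

lemma
  assumes f: "f \<in> cochains scale p k" and k: "k \<ge> 1" and "c + Suc p \<le> N" and x: "x \<in> tpow scale N"
    and n: "n = Suc p"
  shows act_coface_0: "act scale (coface p k 0 f) c n x = act scale mu c 2 (act scale f (Suc c) p x)"
    and act_coface_mid: "i < p \<Longrightarrow> a = c + i \<Longrightarrow>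
      act scale (coface p k (Suc i) f) c n x = act scale f c p (act scale mu a 2 x)"
    and act_coface_last: "Suc a = c + k \<Longrightarrow>
      act scale (coface p k (Suc p) f) c n x = act scale mu a 2 (act scale f c p x)"
proof -
  note mem = coface_in[OF f k]
  show "act scale (coface p k 0 f) c n x = act scale mu c 2 (act scale f (Suc c) p x)"
    unfolding n using assms
    by (intro act_comp[OF mem mu_in f, where N = N and a = 0 and b = 1])
      (auto simp: coface_def zero_outside_def)
  show "act scale (coface p k (Suc i) f) c n x = act scale f c p (act scale mu a 2 x)"
    if "i < p" "a = c + i"
    unfolding n using assms that
    by (intro act_comp[OF mem f mu_in, where N = N and a = 0 and b = i])
      (auto simp: coface_def zero_outside_def)
  show "act scale (coface p k (Suc p) f) c n x = act scale mu a 2 (act scale f c p x)"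
    if "Suc a = c + k"
    unfolding n using assms that
    by (intro act_comp[OF mem mu_in f, where N = N and a = "k - 1" and b = 0])
      (auto simp: coface_def zero_outside_def)
qed

end


section \<open>Linearity of the operations in their cochain arguments\<close>

interpretation cscale: vector_space "cscale :: 'k::field \<Rightarrow> ('a, 'k) cochain \<Rightarrow> _"
  by unfold_locales (auto simp: cscale_def fun_eq_iff fscale.scale_right_distrib fscale.scale_left_distrib)

lemma sum_fun_apply: "(\<Sum>i\<in>I. F i) x = (\<Sum>i\<in>I. F i x)"
  by (induction I rule: infinite_finite_induct) auto

lemma cscale_apply [simp]: "cscale c f x = fscale c (f x)"
  by (simp add: cscale_def)

lemma zero_cochain_in: "0 \<in> cochains s p k"
  by (simp add: cochains_def hom_space_def tpow_closed)

lemma subspace_cochains: "module.subspace cscale (cochains s p k)"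
  unfolding cscale.subspace_def
  by (auto simp: zero_cochain_in) (auto simp: cochains_def hom_space_def tpow_closed
      fscale.scale_right_distrib fscale.scale_left_commute mult.commute)

lemma linear_cochainI:
  assumes "\<And>f g. L (f + g) = L f + L g" "\<And>c f. L (cscale c f) = cscale c (L f)"
  shows "Vector_Spaces.linear cscale cscale L"
  using assms by (simp add: Vector_Spaces.linear_iff cscale.vector_space_axioms)

lemma linear_cochain_sum:
  assumes "Vector_Spaces.linear cscale cscale L"
  shows "L (\<Sum>i\<in>I. cscale (c i) (F i)) = (\<Sum>i\<in>I. cscale (c i) (L (F i)))"
proof -
  interpret Vector_Spaces.linear cscale cscale L by fact
  show ?thesis by (simp add: sum scale)
qed

lemma linear_cochain:
  assumes "Vector_Spaces.linear cscale cscale L"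
  shows "L 0 = 0" "L (f + g) = L f + L g" "L (f - g) = L f - L g" "L (cscale c f) = cscale c (L f)"
proof -
  interpret Vector_Spaces.linear cscale cscale L by fact
  show "L 0 = 0" "L (f + g) = L f + L g" "L (f - g) = L f - L g" "L (cscale c f) = cscale c (L f)"
    by (simp_all add: add diff scale)
qed

text \<open>Both the cochain and the tensor enter through \<open>lin_ext\<close>, so additivity
  holds for arbitrary maps and formal sums. The operations are thus linear on the whole ambient
  space, without membership conditions.\<close>

lemma apply_at_linear:
  "apply_at s f i j (x + y) = apply_at s f i j x + apply_at s f i j y"
  "apply_at s f i j (fscale c x) = fscale c (apply_at s f i j x)"
  "apply_at s (f + g) i j x = apply_at s f i j x + apply_at s g i j x"
  "apply_at s (cscale c f) i j x = fscale c (apply_at s f i j x)"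
  by (simp_all add: apply_at_def lin_ext_linear lin_ext_fun_linear)

lemma act_add_cochain: "act s (f + g) a p x = act s f a p x + act s g a p x"
  and act_cscale: "act s (cscale c f) a p x = fscale c (act s f a p x)"
  by (simp_all add: act_def apply_at_linear)

lemma linear_vdash_left: "Vector_Spaces.linear cscale cscale (\<lambda>f. vdash_op s p q f g)"
  and linear_vdash_right: "Vector_Spaces.linear cscale cscale (vdash_op s p q f)"
  and linear_dashv_left: "Vector_Spaces.linear cscale cscale (\<lambda>f. dashv_op s p q k f g)"
  and linear_dashv_right: "Vector_Spaces.linear cscale cscale (dashv_op s p q k f)"
  by (rule linear_cochainI; simp add: vdash_op_def dashv_op_def zero_outside_def fun_eq_iff apply_at_linear)+

lemma linear_vee_left: "Vector_Spaces.linear cscale cscale (\<lambda>f. vee s p q k f g)"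
  and linear_vee_right: "Vector_Spaces.linear cscale cscale (vee s p q k f)"
  by (rule linear_cochainI; simp add: vee_def linear_cochain[OF linear_vdash_left]
      linear_cochain[OF linear_vdash_right] linear_cochain[OF linear_dashv_left]
      linear_cochain[OF linear_dashv_right] cscale.scale_right_diff_distrib)+

lemma linear_cochain_of:
  assumes "\<And>f g w. \<phi> (f + g) w = \<phi> f w + \<phi> g w" "\<And>c f w. \<phi> (cscale c f) w = fscale c (\<phi> f w)"
  shows "Vector_Spaces.linear cscale cscale (\<lambda>f. cochain_of s p (\<phi> f))"
proof -
  have eqs: "\<phi> (f + g) = (\<lambda>w. \<phi> f w + \<phi> g w)" "\<phi> (cscale c f) = (\<lambda>w. fscale c (\<phi> f w))" for f g c
    by (simp_all add: fun_eq_iff assms)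
  show ?thesis
    by (intro linear_cochainI ext) (simp_all add: cochain_of_def zero_outside_def eqs lin_ext_fun_linear)
qed

lemma At_mult_linear:
  "At_mult s (x + y) z = At_mult s x z + At_mult s y z"
  "At_mult s (fscale c x) z = fscale c (At_mult s x z)"
  "At_mult s z (x + y) = At_mult s z x + At_mult s z y"
  "At_mult s z (fscale c x) = fscale c (At_mult s z x)"
  by (simp_all add: At_mult_def lin_ext_linear lin_ext_fun_linear)

lemma linear_cup_left: "Vector_Spaces.linear cscale cscale (\<lambda>f. cup s p q f g)"
  and linear_cup_right: "Vector_Spaces.linear cscale cscale (cup s p q f)"
  unfolding cup_def by (rule linear_cochain_of; simp add: At_mult_linear)+

lemma linear_hochschild: "Vector_Spaces.linear cscale cscale (hochschild s p)"
  unfolding hochschild_def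
  by (rule linear_cochain_of)
    (simp_all add: lact_def ract_def lin_ext_linear fscale.scale_right_distrib
      sum.distrib fscale.scale_right_diff_distrib fscale.scale_sum_right mult.commute)

section \<open>The Hochschild complex: alternating sums of cofaces\<close>

lemma alternating_double_sum:
  fixes Y :: "nat \<Rightarrow> nat \<Rightarrow> 'v::ab_group_add"
  assumes "\<And>i j. i \<le> j \<Longrightarrow> j \<le> n \<Longrightarrow> Y (Suc j) i = - Y i j"
  shows "(\<Sum>j\<le>Suc n. \<Sum>i\<le>n. Y j i) = 0"
proof -
  let ?A = "{(j, i). i < j \<and> j \<le> Suc n}" and ?B = "{(j, i). j \<le> i \<and> i \<le> n}"
  have fin: "finite ?A" "finite ?B"
    by (auto intro: finite_subset[of _ "{..Suc n} \<times> {..Suc n}"])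
  have "{..Suc n} \<times> {..n} = ?A \<union> ?B" by auto
  then have "(\<Sum>j\<le>Suc n. \<Sum>i\<le>n. Y j i) = (\<Sum>(j, i)\<in>?A. Y j i) + (\<Sum>(j, i)\<in>?B. Y j i)"
    unfolding sum.cartesian_product using fin by (simp add: sum.union_disjoint disjoint_iff)
  \<comment> \<open>The pair (j, i) with i < j is matched with (i, j - 1), which lies in
    \<open>?B\<close>; by assumption matched terms are opposite.\<close>
  also have "(\<Sum>(j, i)\<in>?A. Y j i) = (\<Sum>(j, i)\<in>?B. Y (Suc i) j)"
    by (rule sum.reindex_bij_witness[of _ "\<lambda>(j, i). (Suc i, j)" "\<lambda>(j, i). (i, j - 1)"]) auto
  also have "\<dots> = - (\<Sum>(j, i)\<in>?B. Y j i)"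
    unfolding sum_negf[symmetric] by (rule sum.cong) (auto simp: assms)
  finally show ?thesis by simp
qed

context unital_algebra
begin

text \<open>On a word the three kinds of summands of the differential are the three kinds of
  cofaces, with the same signs.\<close>

lemma hochschild_eq:
  assumes f: "f \<in> cochains scale p k" and k: "k \<ge> 1"
  shows "hochschild scale p f = (\<Sum>i\<le>Suc p. cscale ((-1) ^ i) (coface p k i f))"
proof -
  obtain k' where k': "k = Suc k'" using k by (cases k) auto
  let ?\<Phi> = "\<lambda>x. (act scale mu 0 2 (act scale f 1 p x)
      + (\<Sum>i = 1..p. fscale ((-1) ^ i) (act scale f 0 p (act scale mu (i - 1) 2 x))))
      + fscale ((-1) ^ (p + 1)) (act scale mu (k - 1) 2 (act scale f 0 p x))"
  have "hochschild scale p f = zero_outside (tpow scale (p + 1)) ?\<Phi>"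
    unfolding hochschild_def
  proof (rule cochain_of_eq)
    show "tensor_linear scale (p + 1) ?\<Phi>"
      by (auto simp: tensor_linear_def act_linear fscale.scale_right_distrib fscale.scale_right_diff_distrib sum.distrib
          fscale.scale_sum_right mult.commute)
  next
    fix w :: "'a list" assume w: "length w = p + 1"
    have in_k: "f (tens scale v) \<in> tpow scale k" if "length v = p" for v
      by (rule cochain_in[OF f tens_in[OF that]])
    obtain h t where ht: "w = h # t" "length t = p" using w by (cases w) auto
    obtain h' t' where ht': "w = t' @ [h']" "length t' = p" using w by (cases w rule: rev_cases) auto
    have "lact scale (hd w) (f (tens scale (tl w))) = act scale mu 0 2 (act scale f 1 p (tens scale w))"
      using ht act_tens[OF f _ ht(2), of "[h]" 1 "[]"] by (simp add: lact_eq[OF in_k k])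
    moreover have "ract scale (f (tens scale (butlast w))) (last w)
        = act scale mu (k - 1) 2 (act scale f 0 p (tens scale w))"
      using ht' act_tens[OF f _ ht'(2), of "[]" 0 "[h']"]
      by (simp add: k' ract_eq[OF in_k[unfolded k']])
    moreover have "f (tens scale (take (i - 1) w @ (w ! (i - 1) * w ! i) # drop (i + 1) w))
        = act scale f 0 p (act scale mu (i - 1) 2 (tens scale w))" if i: "i \<in> {1..p}" for i
    proof -
      have "w = take (i - 1) w @ w ! (i - 1) # w ! i # drop (i + 1) w"
        using i w by (cases i) (auto simp: Cons_nth_drop_Suc)
      moreover have "length (take (i - 1) w) = i - 1" using i w by auto
      ultimately have "act scale mu (i - 1) 2 (tens scale w)
          = tens scale (take (i - 1) w @ (w ! (i - 1) * w ! i) # drop (i + 1) w)"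
        using act_mu_tens by metis
      then show ?thesis
        using i w by (auto simp: act_0[OF f] tens_in)
    qed
    ultimately show "lact scale (hd w) (f (tens scale (tl w)))
        + (\<Sum>i = 1..p. fscale ((-1) ^ i)
            (f (tens scale (take (i - 1) w @ (w ! (i - 1) * w ! i) # drop (i + 1) w))))
        + fscale ((-1) ^ (p + 1)) (ract scale (f (tens scale (butlast w))) (last w)) = ?\<Phi> (tens scale w)"
      by simp
  qed
  also have "\<dots> = (\<Sum>i\<le>Suc p. cscale ((-1) ^ i) (coface p k i f))"
  proof
    fix x
    have "(\<Sum>i\<le>Suc p. cscale ((-1) ^ i) (coface p k i f)) x
        = coface p k 0 f x + (\<Sum>i = 1..p. fscale ((-1) ^ i) (coface p k i f x))
          + fscale ((-1) ^ Suc p) (coface p k (Suc p) f x)"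
      unfolding sum_fun_apply cscale_apply
      by (simp add: atMost_atLeast0 sum.atLeast_Suc_atMost[OF le0, of _ p])
    then show "zero_outside (tpow scale (p + 1)) ?\<Phi> x = (\<Sum>i\<le>Suc p. cscale ((-1) ^ i) (coface p k i f)) x"
      by (simp add: coface_def zero_outside_def)
  qed
  finally show ?thesis .
qed

lemma hochschild_in:
  assumes "f \<in> cochains scale p k" "k \<ge> 1"
  shows "hochschild scale p f \<in> cochains scale (Suc p) k"
  unfolding hochschild_eq[OF assms]
  by (intro cscale.subspace_sum[OF subspace_cochains] cscale.subspace_scale[OF subspace_cochains]
      coface_in[OF assms])

text \<open>Two cofaces that touch disjoint factors commute. Where two products share a factor, the
  identity is associativity of \<open>A\<close>.\<close>

lemma cosimplicial:
  assumes f: "f \<in> cochains scale p k" and k: "k \<ge> 1" and ij: "i \<le> j" "j \<le> Suc p"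
  shows "coface (Suc p) k (Suc j) (coface p k i f) = coface (Suc p) k i (coface p k j f)"
proof (rule cochain_eqI)
  obtain k' where k': "k = Suc k'" using k by (cases k) auto
  note cf = coface_in[OF f k]
  show "coface (Suc p) k (Suc j) (coface p k i f) \<in> cochains scale (Suc (Suc p)) k"
    and "coface (Suc p) k i (coface p k j f) \<in> cochains scale (Suc (Suc p)) k"
    by (intro coface_in cf k)+
  fix x :: "('a, 'k) tensor" assume x: "x \<in> tpow scale (Suc (Suc p))"
  have mu_x: "act scale mu a 2 x \<in> tpow scale (Suc p)" if "a \<le> p" for a
    using that by (intro act_in[OF mu_in x]) auto
  have f_x: "act scale f a p x \<in> tpow scale (Suc (Suc k))" if "a \<le> 2" for a
    using that by (intro act_in[OF f x]) auto
  have f_mu: "act scale f 0 p (act scale mu p 2 x) = act scale mu k 2 (act scale f 0 p x)"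
    by (intro act_commute[OF f mu_in x]) auto
  have mu_f: "act scale f (Suc 0) p (act scale mu 0 2 x)
      = act scale mu 0 2 (act scale f (Suc (Suc 0)) p x)"
    by (rule act_commute[OF mu_in f x, symmetric]) auto
  have mu_mu: "act scale mu i 2 (act scale mu (Suc j) 2 x) = act scale mu j 2 (act scale mu i 2 x)"
    if "i \<le> j" "j < p" for i j
  proof (cases "i = j")
    case True
    show ?thesis unfolding True using that by (intro act_mu_assoc[OF x]) auto
  next
    case False
    then show ?thesis using that by (intro act_commute[OF mu_in mu_in x]) auto
  qed
  \<comment> \<open>Left and right action on the value commute. If the value has one factor, this is
    associativity; otherwise the two actions touch different factors.\<close>
  have mu_mu_f: "act scale mu 0 2 (act scale mu k 2 (act scale f (Suc 0) p x))
      = act scale mu k' 2 (act scale mu 0 2 (act scale f (Suc 0) p x))"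
  proof (cases k')
    case 0
    show ?thesis unfolding k' 0 using k' by (intro act_mu_assoc[OF f_x]) auto
  next
    case (Suc d)
    then show ?thesis using k' by (intro act_commute[OF mu_in mu_in f_x]) auto
  qed
  have mu_mu_f': "act scale mu k' 2 (act scale mu k 2 (act scale f 0 p x))
      = act scale mu k' 2 (act scale mu k' 2 (act scale f 0 p x))"
    using k' by (intro act_mu_assoc[OF f_x]) auto
  have mu_mu_f0: "act scale mu 0 2 (act scale mu (Suc 0) 2 (act scale f (Suc (Suc 0)) p x))
      = act scale mu 0 2 (act scale mu 0 2 (act scale f (Suc (Suc 0)) p x))"
    using k by (intro act_mu_assoc[OF f_x]) auto
  note outer = act_coface_0[OF cf k _ x refl, where c = 0, simplified]
    act_coface_mid[OF cf k _ x refl, where c = 0, simplified]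
    act_coface_last[OF cf k _ x refl, where c = 0 and a = k', simplified]
  note inner = act_coface_0[OF f k _ x refl] act_coface_mid[OF f k _ x refl _ refl]
    act_coface_last[OF f k _ x refl, where c = 0 and a = k', simplified]
    act_coface_last[OF f k _ x refl, where c = "Suc 0" and a = k, simplified]
  note inner_mu = act_coface_0[OF f k _ mu_x refl, where c = 0, simplified]
    act_coface_mid[OF f k _ mu_x refl, where c = 0, simplified]
    act_coface_last[OF f k _ mu_x refl, where c = 0 and a = k', simplified]
  \<comment> \<open>The cases record whether each coface is the left action, an inner product or the
    right action.\<close>
  consider "i = 0" "j = 0" | j' where "i = 0" "j = Suc j'" "j' < p" | "i = 0" "j = Suc p"
    | i' j' where "i = Suc i'" "j = Suc j'" "j' < p" "i' \<le> j'"
    | i' where "i = Suc i'" "i' < p" "j = Suc p" | "i = Suc p" "j = Suc p"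
    using ij by (cases i; cases j) (auto simp: le_less)
  then show "act scale (coface (Suc p) k (Suc j) (coface p k i f)) 0 (Suc (Suc p)) x
      = act scale (coface (Suc p) k i (coface p k j f)) 0 (Suc (Suc p)) x"
    \<comment> \<open>Three stages: expand the outer coface, expand the inner one, then rearrange.
      The first two keep \<open>k\<close> folded, the last one unfolds it to
      \<open>Suc k'\<close>.\<close>
    by cases (simp add: outer k'[symmetric]; (simp add: inner inner_mu k'[symmetric])?; (simp add: k' f_mu[unfolded k'] mu_f mu_mu
        mu_mu_f[unfolded k'] mu_mu_f'[unfolded k'] mu_mu_f0)?)+
qed

lemma linear_coface: "Vector_Spaces.linear cscale cscale (coface p k i)"
  by (rule linear_cochainI)
    (simp_all add: coface_def zero_outside_def fun_eq_iff act_linear act_add_cochain act_cscale)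

lemma hochschild_hochschild:
  assumes f: "f \<in> cochains scale p k" and k: "k \<ge> 1"
  shows "hochschild scale (Suc p) (hochschild scale p f) = 0"
proof -
  have "hochschild scale (Suc p) (hochschild scale p f)
      = (\<Sum>j\<le>Suc (Suc p). \<Sum>i\<le>Suc p.
          cscale ((-1) ^ (i + j)) (coface (Suc p) k j (coface p k i f)))"
    unfolding hochschild_eq[OF hochschild_in[OF assms] k]
    by (simp only: hochschild_eq[OF assms] linear_cochain_sum[OF linear_coface] cscale.scale_sum_right cscale.scale_scale
        power_add mult.commute)
  also have "\<dots> = 0"
    by (rule alternating_double_sum) (simp add: cosimplicial[OF assms] add.commute)
  finally show ?thesis .
qed

end


section \<open>How the differential distributes over the products\<close>

section \<open>Leibniz rules\<close>

context unital_algebra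
begin

lemma vdash_in:
  assumes "f \<in> cochains scale (Suc p) (Suc k)" "g \<in> cochains scale q (Suc m)"
  shows "vdash_op scale (Suc p) q f g \<in> cochains scale (p + q) (Suc (k + m))"
  using act_vdash(1)[OF assms _ _ tpow_closed(1) refl refl refl, of 0 "p + q"] by simp

lemma dashv_in:
  assumes "f \<in> cochains scale p (Suc k)" "g \<in> cochains scale (Suc q) (Suc m)"
  shows "dashv_op scale p (Suc q) (Suc k) f g \<in> cochains scale (p + q) (Suc (k + m))"
  using act_dashv(1)[OF assms _ tpow_closed(1) refl refl refl refl, of 0 "p + q"] by simp

lemma cup_in_Suc:
  assumes "f \<in> cochains scale p (Suc k)" "g \<in> cochains scale q (Suc m)"
  shows "cup scale p q f g \<in> cochains scale (p + q) (Suc (k + m))"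
  using cup_in[OF assms] by simp

text \<open>The seam is the factor that \<open>g\<close> produces first and \<open>f\<close>
  consumes last. Cofaces away from it are cofaces of the composite. Multiplying into it from the
  left is both the last inner product of \<open>f\<close> and the left action on the value of
  \<open>g\<close>. If it only meets the value of \<open>f\<close> through the right action, the
  composite is the cup product. For the right action on the value of \<open>g\<close>,
  \<open>m \<ge> 1\<close> keeps the last factor apart from the seam.\<close>

lemma
  assumes f: "f \<in> cochains scale (Suc p) (Suc k)" and g: "g \<in> cochains scale q (Suc m)"
  shows vdash_coface_low: "i \<le> p \<Longrightarrow>
      vdash_op scale (Suc (Suc p)) q (coface (Suc p) (Suc k) i f) g
        = coface (p + q) (Suc (k + m)) i (vdash_op scale (Suc p) q f g)"
    and vdash_coface_mid: "vdash_op scale (Suc (Suc p)) q (coface (Suc p) (Suc k) (Suc p) f) g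
        = vdash_op scale (Suc p) (Suc q) f (coface q (Suc m) 0 g)"
    and vdash_coface_last: "vdash_op scale (Suc (Suc p)) q (coface (Suc p) (Suc k) (Suc (Suc p)) f) g
        = cup scale (Suc p) q f g"
    and vdash_coface_high: "m \<ge> 1 \<Longrightarrow> j \<le> q \<Longrightarrow>
      vdash_op scale (Suc p) (Suc q) f (coface q (Suc m) (Suc j) g)
        = coface (p + q) (Suc (k + m)) (Suc (p + j)) (vdash_op scale (Suc p) q f g)"
proof -
  have k: "Suc k \<ge> 1" and m: "Suc m \<ge> 1" and K: "Suc (k + m) \<ge> 1" by simp_all
  note cf = coface_in[OF f k] and cg = coface_in[OF g m] and fg = vdash_in[OF f g]
  have cfg: "vdash_op scale (Suc (Suc p)) q (coface (Suc p) (Suc k) i f) g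
      \<in> cochains scale (Suc (p + q)) (Suc (k + m))" for i
    using vdash_in[OF cf g] by simp
  have fcg: "vdash_op scale (Suc p) (Suc q) f (coface q (Suc m) j g)
      \<in> cochains scale (Suc (p + q)) (Suc (k + m))" for j
    using vdash_in[OF f cg] by simp
  have cup: "cup scale (Suc p) q f g \<in> cochains scale (Suc (p + q)) (Suc (k + m))"
    using cup_in_Suc[OF f g] by simp
  note cfgh = coface_in[OF fg K]
  let ?eq = "\<lambda>h h' x. act scale h 0 (Suc (p + q)) x = act scale h' 0 (Suc (p + q)) x"
  have main: "(i \<le> p \<longrightarrow> ?eq (vdash_op scale (Suc (Suc p)) q (coface (Suc p) (Suc k) i f) g)
        (coface (p + q) (Suc (k + m)) i (vdash_op scale (Suc p) q f g)) x)
      \<and> ?eq (vdash_op scale (Suc (Suc p)) q (coface (Suc p) (Suc k) (Suc p) f) g)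
        (vdash_op scale (Suc p) (Suc q) f (coface q (Suc m) 0 g)) x
      \<and> ?eq (vdash_op scale (Suc (Suc p)) q (coface (Suc p) (Suc k) (Suc (Suc p)) f) g)
        (cup scale (Suc p) q f g) x
      \<and> (m \<ge> 1 \<longrightarrow> j \<le> q \<longrightarrow> ?eq (vdash_op scale (Suc p) (Suc q) f (coface q (Suc m) (Suc j) g))
        (coface (p + q) (Suc (k + m)) (Suc (p + j)) (vdash_op scale (Suc p) q f g)) x)"
    if x: "x \<in> tpow scale (Suc (p + q))" for x i j
  proof (intro conjI impI)
    have mu_x: "act scale mu a 2 x \<in> tpow scale (p + q)" if "a < p + q" for a
      using that by (intro act_in[OF mu_in x]) auto
    have g_x: "act scale g a q x \<in> tpow scale (Suc (Suc (p + m)))" if "a \<le> Suc p" for a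
      using that by (intro act_in[OF g x]) auto
    have f_mu: "act scale f 0 (Suc p) (act scale mu (m + p) 2 (act scale g p q x))
        = act scale mu (k + m) 2 (act scale f 0 (Suc p) (act scale g p q x))" if "m \<ge> 1"
      using that by (intro act_commute[OF f mu_in g_x]) auto
    have g_mu: "act scale g p q (act scale mu i 2 x) = act scale mu i 2 (act scale g (Suc p) q x)"
      if "i < p" for i
      using that by (intro act_commute[OF mu_in g x, symmetric]) auto
    have f_g: "act scale f 0 (Suc p) (act scale g (Suc p) q x)
        = act scale g (Suc k) q (act scale f 0 (Suc p) x)"
      by (intro act_commute[OF f g x]) auto
    note cf_g = act_vdash(2)[OF cf g m _ x refl refl refl, where c = 0, simplified]
    note f_cg = act_vdash(2)[OF f cg m _ x refl refl refl, where c = 0, simplified]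
    note f_g_x = act_vdash(2)[OF f g m _ x refl refl refl, simplified]
    note f_g_mu = act_vdash(2)[OF f g m _ mu_x refl refl refl, where c = 0, simplified]
    note c_fg = act_coface_0[OF fg K _ x refl, where c = 0, simplified]
      act_coface_mid[OF fg K _ x refl, where c = 0, simplified]
      act_coface_last[OF fg K _ x refl, where c = 0 and a = "k + m", simplified]
    note cf_gx = act_coface_0[OF f k _ g_x refl, where c = 0, simplified]
      act_coface_mid[OF f k _ g_x refl, where c = 0, simplified]
      act_coface_last[OF f k _ g_x refl, where c = 0 and a = k, simplified]
    note cg_x = act_coface_0[OF g m _ x refl, where c = p, simplified]
      act_coface_mid[OF g m _ x refl, where c = p, simplified]
      act_coface_last[OF g m _ x refl, where c = p and a = "m + p", simplified]
    show "?eq (vdash_op scale (Suc (Suc p)) q (coface (Suc p) (Suc k) i f) g)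
        (coface (p + q) (Suc (k + m)) i (vdash_op scale (Suc p) q f g)) x" if "i \<le> p"
      using that by (cases i) (simp_all add: cf_g f_g_x f_g_mu c_fg cf_gx g_mu)
    show "?eq (vdash_op scale (Suc (Suc p)) q (coface (Suc p) (Suc k) (Suc p) f) g)
        (vdash_op scale (Suc p) (Suc q) f (coface q (Suc m) 0 g)) x"
      by (simp add: cf_g f_cg cf_gx cg_x)
    show "?eq (vdash_op scale (Suc (Suc p)) q (coface (Suc p) (Suc k) (Suc (Suc p)) f) g)
        (cup scale (Suc p) q f g) x"
      by (simp add: cf_g cf_gx f_g act_cup[OF f g m _ x, where c = 0])
    show "?eq (vdash_op scale (Suc p) (Suc q) f (coface q (Suc m) (Suc j) g))
        (coface (p + q) (Suc (k + m)) (Suc (p + j)) (vdash_op scale (Suc p) q f g)) x"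
      if "m \<ge> 1" "j \<le> q"
      using that by (cases "j = q") (simp_all add: f_cg cg_x c_fg f_g_x f_g_mu f_mu)
  qed
  show "vdash_op scale (Suc (Suc p)) q (coface (Suc p) (Suc k) i f) g
        = coface (p + q) (Suc (k + m)) i (vdash_op scale (Suc p) q f g)" if "i \<le> p" for i
    using that main by (intro cochain_eqI[OF cfg cfgh]) blast
  show "vdash_op scale (Suc (Suc p)) q (coface (Suc p) (Suc k) (Suc p) f) g
        = vdash_op scale (Suc p) (Suc q) f (coface q (Suc m) 0 g)"
    using main by (intro cochain_eqI[OF cfg fcg]) blast
  show "vdash_op scale (Suc (Suc p)) q (coface (Suc p) (Suc k) (Suc (Suc p)) f) g
        = cup scale (Suc p) q f g"
    using main by (intro cochain_eqI[OF cfg cup]) blast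
  show "vdash_op scale (Suc p) (Suc q) f (coface q (Suc m) (Suc j) g)
        = coface (p + q) (Suc (k + m)) (Suc (p + j)) (vdash_op scale (Suc p) q f g)"
    if "m \<ge> 1" "j \<le> q" for j
    using that main by (intro cochain_eqI[OF fcg cfgh]) blast
qed


text \<open>The mirror image: the seam is now the last factor of the value of \<open>f\<close> and
  the first argument of \<open>g\<close>. The cup product arises from the left action on the value
  of \<open>g\<close>, and \<open>k \<ge> 1\<close> protects the first factor of the value of
  \<open>f\<close> when the left action falls on it.\<close>

lemma
  assumes f: "f \<in> cochains scale p (Suc k)" and g: "g \<in> cochains scale (Suc q) (Suc m)"
  shows dashv_coface_low: "k \<ge> 1 \<Longrightarrow> i \<le> p \<Longrightarrow>
      dashv_op scale (Suc p) (Suc q) (Suc k) (coface p (Suc k) i f) g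
        = coface (p + q) (Suc (k + m)) i (dashv_op scale p (Suc q) (Suc k) f g)"
    and dashv_coface_mid:
      "dashv_op scale (Suc p) (Suc q) (Suc k) (coface p (Suc k) (Suc p) f) g
        = dashv_op scale p (Suc (Suc q)) (Suc k) f (coface (Suc q) (Suc m) 1 g)"
    and dashv_coface_first:
      "dashv_op scale p (Suc (Suc q)) (Suc k) f (coface (Suc q) (Suc m) 0 g) = cup scale p (Suc q) f g"
    and dashv_coface_high: "j \<le> q \<Longrightarrow>
      dashv_op scale p (Suc (Suc q)) (Suc k) f (coface (Suc q) (Suc m) (Suc (Suc j)) g)
        = coface (p + q) (Suc (k + m)) (Suc (p + j)) (dashv_op scale p (Suc q) (Suc k) f g)"
proof -
  have k: "Suc k \<ge> 1" and m: "Suc m \<ge> 1" and K: "Suc (k + m) \<ge> 1" by simp_all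
  note cf = coface_in[OF f k] and cg = coface_in[OF g m] and fg = dashv_in[OF f g]
  have cfg: "dashv_op scale (Suc p) (Suc q) (Suc k) (coface p (Suc k) i f) g
      \<in> cochains scale (Suc (p + q)) (Suc (k + m))" for i
    using dashv_in[OF cf g] by simp
  have fcg: "dashv_op scale p (Suc (Suc q)) (Suc k) f (coface (Suc q) (Suc m) j g)
      \<in> cochains scale (Suc (p + q)) (Suc (k + m))" for j
    using dashv_in[OF f cg] by simp
  have cup: "cup scale p (Suc q) f g \<in> cochains scale (Suc (p + q)) (Suc (k + m))"
    using cup_in_Suc[OF f g] by simp
  note cfgh = coface_in[OF fg K]
  let ?eq = "\<lambda>h h' x. act scale h 0 (Suc (p + q)) x = act scale h' 0 (Suc (p + q)) x"
  have main: "(k \<ge> 1 \<longrightarrow> i \<le> p \<longrightarrow>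
        ?eq (dashv_op scale (Suc p) (Suc q) (Suc k) (coface p (Suc k) i f) g)
          (coface (p + q) (Suc (k + m)) i (dashv_op scale p (Suc q) (Suc k) f g)) x)
      \<and> ?eq (dashv_op scale (Suc p) (Suc q) (Suc k) (coface p (Suc k) (Suc p) f) g)
        (dashv_op scale p (Suc (Suc q)) (Suc k) f (coface (Suc q) (Suc m) 1 g)) x
      \<and> ?eq (dashv_op scale p (Suc (Suc q)) (Suc k) f (coface (Suc q) (Suc m) 0 g))
        (cup scale p (Suc q) f g) x
      \<and> (j \<le> q \<longrightarrow> ?eq (dashv_op scale p (Suc (Suc q)) (Suc k) f (coface (Suc q) (Suc m) (Suc (Suc j)) g))
        (coface (p + q) (Suc (k + m)) (Suc (p + j)) (dashv_op scale p (Suc q) (Suc k) f g)) x)"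
    if x: "x \<in> tpow scale (Suc (p + q))" for x i j
  proof (intro conjI impI)
    have mu_x: "act scale mu a 2 x \<in> tpow scale (p + q)" if "a < p + q" for a
      using that by (intro act_in[OF mu_in x]) auto
    have f_x: "act scale f a p x \<in> tpow scale (Suc (Suc (k + q)))" if "a \<le> Suc q" for a
      using that by (intro act_in[OF f x]) auto
    have f_mu: "act scale f 0 p (act scale mu (p + j) 2 x)
        = act scale mu (Suc (k + j)) 2 (act scale f 0 p x)" if "j < q" for j
      using that by (intro act_commute[OF f mu_in x]) auto
    have mu_g: "act scale mu 0 2 (act scale g (Suc k) (Suc q) (act scale f (Suc 0) p x))
        = act scale g k (Suc q) (act scale mu 0 2 (act scale f (Suc 0) p x))" if "k \<ge> 1"
      using that by (intro act_commute[OF mu_in g f_x]) auto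
    note cf_g = act_dashv(2)[OF cf g _ x refl refl refl refl, where c = 0, simplified]
    note f_cg = act_dashv(2)[OF f cg _ x refl refl refl refl, where c = 0, simplified]
    note f_g_x = act_dashv(2)[OF f g _ x refl refl refl refl, simplified]
    note f_g_mu = act_dashv(2)[OF f g _ mu_x refl refl refl refl, where c = 0, simplified]
    note c_fg = act_coface_0[OF fg K _ x refl, where c = 0, simplified]
      act_coface_mid[OF fg K _ x refl, where c = 0, simplified]
      act_coface_last[OF fg K _ x refl, where c = 0 and a = "k + m", simplified]
    note cf_x = act_coface_0[OF f k _ x refl, where c = 0, simplified]
      act_coface_mid[OF f k _ x refl, where c = 0, simplified]
      act_coface_last[OF f k _ x refl, where c = 0 and a = k, simplified]
    note cg_fx = act_coface_0[OF g m _ f_x refl, where c = k, simplified]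
      act_coface_mid[OF g m _ f_x refl, where c = k, simplified]
      act_coface_last[OF g m _ f_x refl, where c = k and a = "k + m", simplified]
    show "?eq (dashv_op scale (Suc p) (Suc q) (Suc k) (coface p (Suc k) i f) g)
        (coface (p + q) (Suc (k + m)) i (dashv_op scale p (Suc q) (Suc k) f g)) x" if "k \<ge> 1" "i \<le> p"
      using that by (cases i) (simp_all add: cf_g f_g_x f_g_mu c_fg cf_x mu_g)
    show "?eq (dashv_op scale (Suc p) (Suc q) (Suc k) (coface p (Suc k) (Suc p) f) g)
        (dashv_op scale p (Suc (Suc q)) (Suc k) f (coface (Suc q) (Suc m) 1 g)) x"
      by (simp add: cf_g f_cg cf_x cg_fx)
    show "?eq (dashv_op scale p (Suc (Suc q)) (Suc k) f (coface (Suc q) (Suc m) 0 g))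
        (cup scale p (Suc q) f g) x"
      by (simp add: f_cg cg_fx act_cup[OF f g m _ x, where c = 0])
    show "?eq (dashv_op scale p (Suc (Suc q)) (Suc k) f (coface (Suc q) (Suc m) (Suc (Suc j)) g))
        (coface (p + q) (Suc (k + m)) (Suc (p + j)) (dashv_op scale p (Suc q) (Suc k) f g)) x"
      if "j \<le> q"
      using that by (cases "j = q") (simp_all add: f_cg cg_fx c_fg f_g_x f_g_mu f_mu)
  qed
  show "dashv_op scale (Suc p) (Suc q) (Suc k) (coface p (Suc k) i f) g
        = coface (p + q) (Suc (k + m)) i (dashv_op scale p (Suc q) (Suc k) f g)"
    if "k \<ge> 1" "i \<le> p" for i
    using that main by (intro cochain_eqI[OF cfg cfgh]) blast
  show "dashv_op scale (Suc p) (Suc q) (Suc k) (coface p (Suc k) (Suc p) f) g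
        = dashv_op scale p (Suc (Suc q)) (Suc k) f (coface (Suc q) (Suc m) 1 g)"
    using main by (intro cochain_eqI[OF cfg fcg]) blast
  show "dashv_op scale p (Suc (Suc q)) (Suc k) f (coface (Suc q) (Suc m) 0 g) = cup scale p (Suc q) f g"
    using main by (intro cochain_eqI[OF fcg cup]) blast
  show "dashv_op scale p (Suc (Suc q)) (Suc k) f (coface (Suc q) (Suc m) (Suc (Suc j)) g)
        = coface (p + q) (Suc (k + m)) (Suc (p + j)) (dashv_op scale p (Suc q) (Suc k) f g)"
    if "j \<le> q" for j
    using that main by (intro cochain_eqI[OF fcg cfgh]) blast
qed

text \<open>The middle identity is (x a) y = x (a y) for the values x of \<open>f\<close> and y of
  \<open>g\<close>: the argument a between them may be absorbed on either side.\<close>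

lemma
  assumes f: "f \<in> cochains scale p (Suc k)" and g: "g \<in> cochains scale q (Suc m)"
  shows cup_coface_low: "i \<le> p \<Longrightarrow>
      cup scale (Suc p) q (coface p (Suc k) i f) g
        = coface (p + q) (Suc (k + m)) i (cup scale p q f g)"
    and cup_coface_mid: "cup scale (Suc p) q (coface p (Suc k) (Suc p) f) g
        = cup scale p (Suc q) f (coface q (Suc m) 0 g)"
    and cup_coface_high: "j \<le> q \<Longrightarrow>
      cup scale p (Suc q) f (coface q (Suc m) (Suc j) g)
        = coface (p + q) (Suc (k + m)) (Suc (p + j)) (cup scale p q f g)"
proof -
  have k: "Suc k \<ge> 1" and m: "Suc m \<ge> 1" and K: "Suc (k + m) \<ge> 1" by simp_all
  note cf = coface_in[OF f k] and cg = coface_in[OF g m] and fg = cup_in_Suc[OF f g]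
  have cfg: "cup scale (Suc p) q (coface p (Suc k) i f) g
      \<in> cochains scale (Suc (p + q)) (Suc (k + m))" for i
    using cup_in_Suc[OF cf g] by simp
  have fcg: "cup scale p (Suc q) f (coface q (Suc m) j g)
      \<in> cochains scale (Suc (p + q)) (Suc (k + m))" for j
    using cup_in_Suc[OF f cg] by simp
  note cfgh = coface_in[OF fg K]
  let ?eq = "\<lambda>h h' x. act scale h 0 (Suc (p + q)) x = act scale h' 0 (Suc (p + q)) x"
  have main: "(i \<le> p \<longrightarrow> ?eq (cup scale (Suc p) q (coface p (Suc k) i f) g)
          (coface (p + q) (Suc (k + m)) i (cup scale p q f g)) x)
      \<and> ?eq (cup scale (Suc p) q (coface p (Suc k) (Suc p) f) g)
        (cup scale p (Suc q) f (coface q (Suc m) 0 g)) x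
      \<and> (j \<le> q \<longrightarrow> ?eq (cup scale p (Suc q) f (coface q (Suc m) (Suc j) g))
        (coface (p + q) (Suc (k + m)) (Suc (p + j)) (cup scale p q f g)) x)"
    if x: "x \<in> tpow scale (Suc (p + q))" for x i j
  proof (intro conjI impI)
    have mu_x: "act scale mu a 2 x \<in> tpow scale (p + q)" if "a < p + q" for a
      using that by (intro act_in[OF mu_in x]) auto
    have f_x: "act scale f a p x \<in> tpow scale (Suc (Suc (k + q)))" if "a \<le> Suc q" for a
      using that by (intro act_in[OF f x]) auto
    have g_f_x: "act scale g b q (act scale f a p x) \<in> tpow scale (Suc (Suc (Suc (k + m))))"
      if "a \<le> Suc q" "b \<le> Suc (Suc k)" for a b
      using that by (intro act_in[OF g f_x]) auto
    have f_mu: "act scale f 0 p (act scale mu (p + j) 2 x)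
        = act scale mu (Suc (k + j)) 2 (act scale f 0 p x)" if "j < q" for j
      using that by (intro act_commute[OF f mu_in x]) auto
    have g_mu: "act scale g (Suc k) q (act scale mu i 2 (act scale f a p x))
        = act scale mu i 2 (act scale g (Suc (Suc k)) q (act scale f a p x))"
      if "i \<le> k" "a \<le> Suc q" for i a
      using that by (intro act_commute[OF mu_in g f_x, symmetric]) auto
    \<comment> \<open>For \<open>k = 0\<close> the value of \<open>f\<close> is a single factor
      multiplied on both sides, which calls for associativity; for larger \<open>k\<close> the two
      products are disjoint.\<close>
    have mu_mu_0: "act scale mu 0 2 (act scale mu (Suc k) 2 y) = act scale mu k 2 (act scale mu 0 2 y)"
      if y: "y \<in> tpow scale (Suc (Suc (Suc (k + m))))" for y
      by (cases k) (use y in \<open>auto intro: act_mu_assoc[OF y] act_commute[OF mu_in mu_in y]\<close>)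
    have mu_mu_k: "act scale mu k 2 (act scale mu (Suc k) 2 y) = act scale mu k 2 (act scale mu k 2 y)"
      if y: "y \<in> tpow scale (Suc (Suc (Suc (k + m))))" for y
      by (rule act_mu_assoc[OF y]) auto
    have mu_mu_m: "act scale mu k 2 (act scale mu (Suc (k + m)) 2 y)
        = act scale mu (k + m) 2 (act scale mu k 2 y)"
      if y: "y \<in> tpow scale (Suc (Suc (Suc (k + m))))" for y
      by (cases m) (use y in \<open>auto intro: act_mu_assoc[OF y] act_commute[OF mu_in mu_in y]\<close>)
    note cf_g = act_cup[OF cf g m _ x refl refl refl, where c = 0, simplified]
    note f_cg = act_cup[OF f cg m _ x refl refl refl, where c = 0, simplified]
    note f_g_x = act_cup[OF f g m _ x refl refl refl, simplified]
    note f_g_mu = act_cup[OF f g m _ mu_x refl refl refl, where c = 0, simplified]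
    note c_fg = act_coface_0[OF fg K _ x refl, where c = 0, simplified]
      act_coface_mid[OF fg K _ x refl, where c = 0, simplified]
      act_coface_last[OF fg K _ x refl, where c = 0 and a = "k + m", simplified]
    note cf_x = act_coface_0[OF f k _ x refl, where c = 0, simplified]
      act_coface_mid[OF f k _ x refl, where c = 0, simplified]
      act_coface_last[OF f k _ x refl, where c = 0 and a = k, simplified]
    note cg_fx = act_coface_0[OF g m _ f_x refl, where c = "Suc k", simplified]
      act_coface_mid[OF g m _ f_x refl, where c = "Suc k", simplified]
      act_coface_last[OF g m _ f_x refl, where c = "Suc k" and a = "Suc (k + m)", simplified]
    show "?eq (cup scale (Suc p) q (coface p (Suc k) i f) g)
        (coface (p + q) (Suc (k + m)) i (cup scale p q f g)) x" if "i \<le> p"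
      using that by (cases i) (simp_all add: cf_g f_g_x f_g_mu c_fg cf_x g_mu mu_mu_0 g_f_x)
    show "?eq (cup scale (Suc p) q (coface p (Suc k) (Suc p) f) g)
        (cup scale p (Suc q) f (coface q (Suc m) 0 g)) x"
      by (simp add: cf_g f_cg cf_x cg_fx g_mu mu_mu_k g_f_x)
    show "?eq (cup scale p (Suc q) f (coface q (Suc m) (Suc j) g))
        (coface (p + q) (Suc (k + m)) (Suc (p + j)) (cup scale p q f g)) x"
      if "j \<le> q"
      using that by (cases "j = q") (simp_all add: f_cg cg_fx c_fg f_g_x f_g_mu f_mu mu_mu_m g_f_x)
  qed
  show "cup scale (Suc p) q (coface p (Suc k) i f) g
        = coface (p + q) (Suc (k + m)) i (cup scale p q f g)"
    if "i \<le> p" for i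
    using that main by (intro cochain_eqI[OF cfg cfgh]) blast
  show "cup scale (Suc p) q (coface p (Suc k) (Suc p) f) g
        = cup scale p (Suc q) f (coface q (Suc m) 0 g)"
    using main by (intro cochain_eqI[OF cfg fcg]) blast
  show "cup scale p (Suc q) f (coface q (Suc m) (Suc j) g)
        = coface (p + q) (Suc (k + m)) (Suc (p + j)) (cup scale p q f g)"
    if "j \<le> q" for j
    using that main by (intro cochain_eqI[OF fcg cfgh]) blast
qed

end


lemma sum_atMost_add:
  "(\<Sum>i\<le>n + l. F i) = (\<Sum>i\<le>n. F i) + (\<Sum>j<l. F (Suc (n + j)))" for F :: "nat \<Rightarrow> 'v::comm_monoid_add"
  by (induction l) (simp_all add: add.assoc)

lemma sum_atMost_first:
  "(\<Sum>i\<le>n. F i) = F 0 + (\<Sum>j<n. F (Suc j))" for F :: "nat \<Rightarrow> 'v::comm_monoid_add"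
  using sum_atMost_add[of F 0 n] by simp

context unital_algebra
begin

text \<open>The first p + 1 cofaces of the cup product come from \<open>f\<close>, the others from
  \<open>g\<close>. The term \<open>?Y\<close> is the last coface of \<open>f\<close> with sign
  (-1)^(p+1) and the zeroth coface of \<open>g\<close> with total sign (-1)^p, and so drops
  out.\<close>

lemma cup_Leibniz:
  assumes f: "f \<in> cochains scale p (Suc k)" and g: "g \<in> cochains scale q (Suc m)"
  shows "hochschild scale (p + q) (cup scale p q f g)
     = cup scale (Suc p) q (hochschild scale p f) g
       + cscale ((-1) ^ p) (cup scale p (Suc q) f (hochschild scale q g))"
proof -
  have m1: "Suc m \<ge> 1" by simp
  let ?D = "\<lambda>i. coface (p + q) (Suc (k + m)) i (cup scale p q f g)"
  let ?Y = "cup scale p (Suc q) f (coface q (Suc m) 0 g)"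
  have 1: "hochschild scale (p + q) (cup scale p q f g)
      = (\<Sum>i\<le>p. cscale ((-1) ^ i) (?D i)) + (\<Sum>j<Suc q. cscale ((-1) ^ Suc (p + j)) (?D (Suc (p + j))))"
    using hochschild_eq[OF cup_in_Suc[OF f g]]
      sum_atMost_add[of "\<lambda>i. cscale ((-1) ^ i) (?D i)" p "Suc q"] by simp
  have 2: "cup scale (Suc p) q (hochschild scale p f) g
      = (\<Sum>i\<le>p. cscale ((-1) ^ i) (?D i)) + cscale ((-1) ^ Suc p) ?Y"
    by (simp add: hochschild_eq[OF f] linear_cochain_sum[OF linear_cup_left] linear_cochain[OF linear_cup_left]
        cup_coface_low[OF f g] cup_coface_mid[OF f g] del: sum.lessThan_Suc)
  have "cup scale p (Suc q) f (hochschild scale q g)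
      = (\<Sum>j\<le>Suc q. cscale ((-1) ^ j) (cup scale p (Suc q) f (coface q (Suc m) j g)))"
    by (simp only: hochschild_eq[OF g m1] linear_cochain_sum[OF linear_cup_right])
  also have "\<dots> = ?Y + (\<Sum>j<Suc q. cscale ((-1) ^ Suc j) (?D (Suc (p + j))))"
    by (simp add: sum_atMost_first[of _ "Suc q"] cup_coface_high[OF f g] del: sum.lessThan_Suc sum.atMost_Suc)
  finally have 3: "cscale ((-1) ^ p) (cup scale p (Suc q) f (hochschild scale q g))
      = cscale ((-1) ^ p) ?Y + (\<Sum>j<Suc q. cscale ((-1) ^ Suc (p + j)) (?D (Suc (p + j))))"
    by (simp add: cscale.scale_right_distrib cscale.scale_sum_right power_add del: sum.lessThan_Suc)
  show ?thesis unfolding 1 2 3 by simp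
qed

text \<open>As for the cup product, the term \<open>?Y\<close> cancels. Here \<open>f\<close> has
  one coface more than the composite can absorb: the last one contributes a cup product with sign
  (-1)^(p+2), which the formula subtracts again.\<close>

lemma vdash_Leibniz:
  assumes f: "f \<in> cochains scale (Suc p) (Suc k)" and g: "g \<in> cochains scale q (Suc m)" and m: "m \<ge> 1"
  shows "hochschild scale (p + q) (vdash_op scale (Suc p) q f g)
     = vdash_op scale (Suc (Suc p)) q (hochschild scale (Suc p) f) g
       + cscale ((-1) ^ p) (vdash_op scale (Suc p) (Suc q) f (hochschild scale q g) - cup scale (Suc p) q f g)"
proof -
  have m1: "Suc m \<ge> 1" by simp
  let ?D = "\<lambda>i. coface (p + q) (Suc (k + m)) i (vdash_op scale (Suc p) q f g)"
  let ?Y = "vdash_op scale (Suc p) (Suc q) f (coface q (Suc m) 0 g)"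
  have 1: "hochschild scale (p + q) (vdash_op scale (Suc p) q f g)
      = (\<Sum>i\<le>p. cscale ((-1) ^ i) (?D i)) + (\<Sum>j<Suc q. cscale ((-1) ^ Suc (p + j)) (?D (Suc (p + j))))"
    using hochschild_eq[OF vdash_in[OF f g]]
      sum_atMost_add[of "\<lambda>i. cscale ((-1) ^ i) (?D i)" p "Suc q"] by simp
  have 2: "vdash_op scale (Suc (Suc p)) q (hochschild scale (Suc p) f) g
      = (\<Sum>i\<le>p. cscale ((-1) ^ i) (?D i)) + cscale ((-1) ^ Suc p) ?Y + cscale ((-1) ^ p) (cup scale (Suc p) q f g)"
    by (simp add: hochschild_eq[OF f] linear_cochain_sum[OF linear_vdash_left] linear_cochain[OF linear_vdash_left]
        vdash_coface_low[OF f g] vdash_coface_mid[OF f g] vdash_coface_last[OF f g])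
  have "vdash_op scale (Suc p) (Suc q) f (hochschild scale q g)
      = (\<Sum>j\<le>Suc q. cscale ((-1) ^ j) (vdash_op scale (Suc p) (Suc q) f (coface q (Suc m) j g)))"
    by (simp only: hochschild_eq[OF g m1] linear_cochain_sum[OF linear_vdash_right])
  also have "\<dots> = ?Y + (\<Sum>j<Suc q. cscale ((-1) ^ Suc j) (?D (Suc (p + j))))"
    using m by (simp add: sum_atMost_first[of _ "Suc q"] vdash_coface_high[OF f g] del: sum.lessThan_Suc sum.atMost_Suc)
  finally have 3: "cscale ((-1) ^ p) (vdash_op scale (Suc p) (Suc q) f (hochschild scale q g) - cup scale (Suc p) q f g)
      = cscale ((-1) ^ p) ?Y + (\<Sum>j<Suc q. cscale ((-1) ^ Suc (p + j)) (?D (Suc (p + j))))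
        - cscale ((-1) ^ p) (cup scale (Suc p) q f g)"
    by (simp add: cscale.scale_right_distrib cscale.scale_right_diff_distrib cscale.scale_sum_right
        power_add del: sum.lessThan_Suc)
  show ?thesis unfolding 1 2 3 by simp
qed

text \<open>Here the surplus cup product is the zeroth coface of \<open>g\<close>, and
  \<open>?Y\<close> arises from the last coface of \<open>f\<close> and from the first inner coface
  of \<open>g\<close>.\<close>

lemma dashv_Leibniz:
  assumes f: "f \<in> cochains scale (Suc p) (Suc k)" and g: "g \<in> cochains scale (Suc q) (Suc m)" and k: "k \<ge> 1"
  shows "hochschild scale (p + Suc q) (dashv_op scale (Suc p) (Suc q) (Suc k) f g)
     = dashv_op scale (Suc (Suc p)) (Suc q) (Suc k) (hochschild scale (Suc p) f) g
       + cscale ((-1) ^ p) (dashv_op scale (Suc p) (Suc (Suc q)) (Suc k) f (hochschild scale (Suc q) g)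
           - cup scale (Suc p) (Suc q) f g)"
proof -
  have m1: "Suc m \<ge> 1" by simp
  let ?D = "\<lambda>i. coface (Suc (p + q)) (Suc (k + m)) i (dashv_op scale (Suc p) (Suc q) (Suc k) f g)"
  let ?Y = "dashv_op scale (Suc p) (Suc (Suc q)) (Suc k) f (coface (Suc q) (Suc m) 1 g)"
  have 1: "hochschild scale (p + Suc q) (dashv_op scale (Suc p) (Suc q) (Suc k) f g)
      = (\<Sum>i\<le>Suc p. cscale ((-1) ^ i) (?D i)) + (\<Sum>j<Suc q. cscale ((-1) ^ (p + j)) (?D (Suc (Suc (p + j)))))"
    using hochschild_eq[OF dashv_in[OF f g]]
      sum_atMost_add[of "\<lambda>i. cscale ((-1) ^ i) (?D i)" "Suc p" "Suc q"] by simp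
  have 2: "dashv_op scale (Suc (Suc p)) (Suc q) (Suc k) (hochschild scale (Suc p) f) g
      = (\<Sum>i\<le>Suc p. cscale ((-1) ^ i) (?D i)) + cscale ((-1) ^ p) ?Y"
    using k by (simp add: hochschild_eq[OF f] linear_cochain_sum[OF linear_dashv_left]
        linear_cochain[OF linear_dashv_left] dashv_coface_low[OF f g] dashv_coface_mid[OF f g])
  have "dashv_op scale (Suc p) (Suc (Suc q)) (Suc k) f (hochschild scale (Suc q) g)
      = (\<Sum>j\<le>Suc (Suc q). cscale ((-1) ^ j) (dashv_op scale (Suc p) (Suc (Suc q)) (Suc k) f (coface (Suc q) (Suc m) j g)))"
    by (simp only: hochschild_eq[OF g m1] linear_cochain_sum[OF linear_dashv_right])
  also have "\<dots> = cup scale (Suc p) (Suc q) f g - ?Y + (\<Sum>j<Suc q. cscale ((-1) ^ j) (?D (Suc (Suc (p + j)))))"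
    by (simp add: sum_atMost_first[of _ "Suc (Suc q)"] sum.lessThan_Suc_shift[of _ "Suc q"]
        dashv_coface_first[OF f g] dashv_coface_high[OF f g] del: sum.lessThan_Suc sum.atMost_Suc)
  finally have 3: "cscale ((-1) ^ p) (dashv_op scale (Suc p) (Suc (Suc q)) (Suc k) f (hochschild scale (Suc q) g)
        - cup scale (Suc p) (Suc q) f g)
      = (\<Sum>j<Suc q. cscale ((-1) ^ (p + j)) (?D (Suc (Suc (p + j))))) - cscale ((-1) ^ p) ?Y"
    by (simp add: cscale.scale_right_distrib cscale.scale_right_diff_distrib cscale.scale_sum_right
        power_add del: sum.lessThan_Suc)
  show ?thesis unfolding 1 2 3 by simp
qed

text \<open>The defects of the two one-sided rules are the same cup product with the same sign, so
  they cancel in the difference.\<close>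

lemma vee_Leibniz:
  assumes f: "f \<in> cochains scale (Suc p) (Suc k)" and g: "g \<in> cochains scale (Suc q) (Suc m)"
    and km: "k \<ge> 1" "m \<ge> 1"
  shows "hochschild scale (p + Suc q) (vee scale (Suc p) (Suc q) (Suc k) f g)
     = vee scale (Suc (Suc p)) (Suc q) (Suc k) (hochschild scale (Suc p) f) g
       + cscale ((-1) ^ p) (vee scale (Suc p) (Suc (Suc q)) (Suc k) f (hochschild scale (Suc q) g))"
  using vdash_Leibniz[OF f g km(2)] dashv_Leibniz[OF f g km(1)]
  by (simp add: vee_def linear_cochain[OF linear_hochschild] cscale.scale_right_diff_distrib)

lemma vee_in:
  assumes "f \<in> cochains scale (Suc p) (Suc k)" "g \<in> cochains scale (Suc q) (Suc m)"
  shows "vee scale (Suc p) (Suc q) (Suc k) f g \<in> cochains scale (Suc (p + q)) (Suc (k + m))"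
  using vdash_in[OF assms] dashv_in[OF assms] cscale.subspace_diff[OF subspace_cochains]
  by (simp add: vee_def)


section \<open>Associativity of both products and their compatibility\<close>

section \<open>Associativity and compatibility\<close>

text \<open>Each of the four terms on one side equals one term on the other. The two pure identities
  are mere regrouping; the mixed ones require \<open>f\<close> and \<open>h\<close> to act at
  different places of \<open>g\<close>.\<close>

lemma vee_assoc:
  assumes f: "f \<in> cochains scale (Suc p) (Suc k)" and g: "g \<in> cochains scale (Suc q) (Suc m)"
    and h: "h \<in> cochains scale (Suc r) (Suc n)" and q: "q \<ge> 1" and m: "m \<ge> 1"
  shows "vee scale (Suc p) (Suc (q + r)) (Suc k) f (vee scale (Suc q) (Suc r) (Suc m) g h)
     = vee scale (Suc (p + q)) (Suc r) (Suc (k + m)) (vee scale (Suc p) (Suc q) (Suc k) f g) h"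
proof -
  have vfg: "vdash_op scale (Suc p) (Suc q) f g \<in> cochains scale (Suc (p + q)) (Suc (k + m))"
    using vdash_in[OF f g] by simp
  have dfg: "dashv_op scale (Suc p) (Suc q) (Suc k) f g \<in> cochains scale (Suc (p + q)) (Suc (k + m))"
    using dashv_in[OF f g] by simp
  have vgh: "vdash_op scale (Suc q) (Suc r) g h \<in> cochains scale (Suc (q + r)) (Suc (m + n))"
    using vdash_in[OF g h] by simp
  have dgh: "dashv_op scale (Suc q) (Suc r) (Suc m) g h \<in> cochains scale (Suc (q + r)) (Suc (m + n))"
    using dashv_in[OF g h] by simp
  let ?C = "cochains scale (Suc (p + q + r)) (Suc (k + m + n))"
  have in_C: "vdash_op scale (Suc p) (Suc (q + r)) f G \<in> ?C" "dashv_op scale (Suc p) (Suc (q + r)) (Suc k) f G \<in> ?C"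
    if "G \<in> cochains scale (Suc (q + r)) (Suc (m + n))" for G
    using vdash_in[OF f that] dashv_in[OF f that] by (simp_all add: ac_simps)
  have in_C': "vdash_op scale (Suc (p + q)) (Suc r) F h \<in> ?C" "dashv_op scale (Suc (p + q)) (Suc r) (Suc (k + m)) F h \<in> ?C"
    if "F \<in> cochains scale (Suc (p + q)) (Suc (k + m))" for F
    using vdash_in[OF that h] dashv_in[OF that h] by (simp_all add: ac_simps)
  have km: "Suc x \<ge> 1" for x by simp
  let ?eq = "\<lambda>F G x. act scale F 0 (Suc (p + q + r)) x = act scale G 0 (Suc (p + q + r)) x"
  have main: "?eq (vdash_op scale (Suc p) (Suc (q + r)) f (vdash_op scale (Suc q) (Suc r) g h))
      (vdash_op scale (Suc (p + q)) (Suc r) (vdash_op scale (Suc p) (Suc q) f g) h) x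
    \<and> ?eq (vdash_op scale (Suc p) (Suc (q + r)) f (dashv_op scale (Suc q) (Suc r) (Suc m) g h))
      (dashv_op scale (Suc (p + q)) (Suc r) (Suc (k + m)) (vdash_op scale (Suc p) (Suc q) f g) h) x
    \<and> ?eq (dashv_op scale (Suc p) (Suc (q + r)) (Suc k) f (vdash_op scale (Suc q) (Suc r) g h))
      (vdash_op scale (Suc (p + q)) (Suc r) (dashv_op scale (Suc p) (Suc q) (Suc k) f g) h) x
    \<and> ?eq (dashv_op scale (Suc p) (Suc (q + r)) (Suc k) f (dashv_op scale (Suc q) (Suc r) (Suc m) g h))
      (dashv_op scale (Suc (p + q)) (Suc r) (Suc (k + m)) (dashv_op scale (Suc p) (Suc q) (Suc k) f g) h) x"
    if x: "x \<in> tpow scale (Suc (p + q + r))" for x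
  proof -
    have f_x: "act scale f 0 (Suc p) x \<in> tpow scale (Suc (k + q + r))"
      by (intro act_in[OF f x]) auto
    have g_x: "act scale g p (Suc q) x \<in> tpow scale (Suc (p + m + r))"
      by (intro act_in[OF g x]) auto
    have h_x: "act scale h (p + q) (Suc r) x \<in> tpow scale (Suc (p + q + n))"
      by (intro act_in[OF h x]) auto
    \<comment> \<open>By \<open>m \<ge> 1\<close>, the factor of the value of \<open>g\<close> taken
      by \<open>f\<close> (the first) and the one taken by \<open>h\<close> (the last) are
      distinct.\<close>
    have f_h_g: "act scale f 0 (Suc p) (act scale h (p + m) (Suc r) (act scale g p (Suc q) x))
        = act scale h (k + m) (Suc r) (act scale f 0 (Suc p) (act scale g p (Suc q) x))"
      using m by (intro act_commute[OF f h g_x]) auto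
    \<comment> \<open>By \<open>q \<ge> 1\<close>, the argument of \<open>g\<close> supplied by
      \<open>f\<close> (the first) and the one supplied by \<open>h\<close> (the last) are
      distinct.\<close>
    have f_h: "act scale f 0 (Suc p) (act scale h (p + q) (Suc r) x)
        = act scale h (k + q) (Suc r) (act scale f 0 (Suc p) x)"
      using q by (intro act_commute[OF f h x]) auto
    note v = act_vdash(2)[OF f vgh km _ x refl refl refl, where c = 0, simplified]
      act_vdash(2)[OF f dgh km _ x refl refl refl, where c = 0, simplified]
      act_vdash(2)[OF g h km _ x refl refl refl, where c = p, simplified]
      act_vdash(2)[OF vfg h km _ x refl refl refl, where c = 0, simplified]
      act_vdash(2)[OF dfg h km _ x refl refl refl, where c = 0, simplified]
      act_vdash(2)[OF f g km _ x refl refl refl, where c = 0, simplified]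
      act_vdash(2)[OF f g km _ h_x refl refl refl, where c = 0, simplified]
      act_vdash(2)[OF g h km _ f_x refl refl refl, where c = k, simplified]
    note d = act_dashv(2)[OF f vgh _ x refl refl refl refl, where c = 0, simplified]
      act_dashv(2)[OF f dgh _ x refl refl refl refl, where c = 0, simplified]
      act_dashv(2)[OF g h _ x refl refl refl refl, where c = p, simplified]
      act_dashv(2)[OF vfg h _ x refl refl refl refl, where c = 0, simplified]
      act_dashv(2)[OF dfg h _ x refl refl refl refl, where c = 0, simplified]
      act_dashv(2)[OF f g _ x refl refl refl refl, where c = 0, simplified]
      act_dashv(2)[OF f g _ h_x refl refl refl refl, where c = 0, simplified]
      act_dashv(2)[OF g h _ f_x refl refl refl refl, where c = k, simplified]
    \<comment> \<open>Positions are sums of arities and exponents; regrouping them all to the left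
      makes the expansions of the two sides agree literally.\<close>
    show ?thesis
      by (simp add: v[simplified add.assoc[symmetric]] d[simplified add.assoc[symmetric]] add.assoc[symmetric] f_h_g f_h)
  qed
  show ?thesis
    using main
    by (simp add: vee_def linear_cochain[OF linear_vdash_left] linear_cochain[OF linear_vdash_right]
        linear_cochain[OF linear_dashv_left] linear_cochain[OF linear_dashv_right]
        cochain_eqI[OF in_C(1)[OF vgh] in_C'(1)[OF vfg]] cochain_eqI[OF in_C(1)[OF dgh] in_C'(2)[OF vfg]]
        cochain_eqI[OF in_C(2)[OF vgh] in_C'(1)[OF dfg]] cochain_eqI[OF in_C(2)[OF dgh] in_C'(2)[OF dfg]])
qed


text \<open>The value of \<open>g\<close> is multiplied at both of its ends. If it is a single
  factor, the order of the two products is a matter of associativity; otherwise they are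
  disjoint.\<close>

lemma cup_assoc:
  assumes f: "f \<in> cochains scale p (Suc k)" and g: "g \<in> cochains scale q (Suc m)"
    and h: "h \<in> cochains scale r (Suc n)"
  shows "cup scale p (q + r) f (cup scale q r g h) = cup scale (p + q) r (cup scale p q f g) h"
proof (rule cochain_eqI)
  have n1: "Suc x \<ge> 1" for x by simp
  note fg = cup_in_Suc[OF f g] and gh = cup_in_Suc[OF g h]
  show "cup scale p (q + r) f (cup scale q r g h) \<in> cochains scale (p + q + r) (Suc (k + m + n))"
    using cup_in_Suc[OF f gh] by (simp add: ac_simps)
  show "cup scale (p + q) r (cup scale p q f g) h \<in> cochains scale (p + q + r) (Suc (k + m + n))"
    using cup_in_Suc[OF fg h] by (simp add: ac_simps)
  fix x :: "('a, 'k) tensor" assume x: "x \<in> tpow scale (p + q + r)"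
  let ?y = "act scale g (Suc k) q (act scale f 0 p x)"
  have f_x: "act scale f 0 p x \<in> tpow scale (Suc (k + q + r))"
    by (intro act_in[OF f x]) auto
  have y: "?y \<in> tpow scale (Suc (Suc (k + m + r)))"
    by (intro act_in[OF g f_x]) auto
  have h_y: "act scale h (Suc (Suc (k + m))) r ?y \<in> tpow scale (Suc (Suc (Suc (k + m + n))))"
    by (intro act_in[OF h y]) auto
  have h_mu: "act scale mu k 2 (act scale h (Suc (Suc (k + m))) r ?y)
      = act scale h (Suc (k + m)) r (act scale mu k 2 ?y)"
    by (intro act_commute[OF mu_in h y]) auto
  have mu_mu: "act scale mu k 2 (act scale mu (Suc (k + m)) 2 z)
      = act scale mu (k + m) 2 (act scale mu k 2 z)"
    if z: "z \<in> tpow scale (Suc (Suc (Suc (k + m + n))))" for z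
    by (cases m) (use z in \<open>auto intro: act_mu_assoc[OF z] act_commute[OF mu_in mu_in z]\<close>)
  note c = act_cup[OF f gh n1 _ x refl refl refl, where c = 0, simplified]
    act_cup[OF g h n1 _ f_x refl refl refl, where c = "Suc k", simplified]
    act_cup[OF fg h n1 _ x refl refl refl, where c = 0, simplified]
    act_cup[OF f g n1 _ x refl refl refl, where c = 0, simplified]
  show "act scale (cup scale p (q + r) f (cup scale q r g h)) 0 (p + q + r) x
      = act scale (cup scale (p + q) r (cup scale p q f g) h) 0 (p + q + r) x"
    by (simp add: c[simplified add.assoc[symmetric]] add.assoc[symmetric] mu_mu[OF h_y] h_mu)
qed

text \<open>\<open>h\<close> enters through the last argument of \<open>g\<close>, while the cup
  product merges values; only \<open>f\<close> and \<open>h\<close>, which act on disjoint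
  arguments, have to be interchanged.\<close>

lemma cup_vdash:
  assumes f: "f \<in> cochains scale p (Suc k)" and g: "g \<in> cochains scale (Suc q) (Suc m)"
    and h: "h \<in> cochains scale r (Suc n)"
  shows "vdash_op scale (Suc (p + q)) r (cup scale p (Suc q) f g) h
     = cup scale p (q + r) f (vdash_op scale (Suc q) r g h)"
proof (rule cochain_eqI)
  have n1: "Suc x \<ge> 1" for x by simp
  have fg: "cup scale p (Suc q) f g \<in> cochains scale (Suc (p + q)) (Suc (k + m))"
    using cup_in_Suc[OF f g] by simp
  note gh = vdash_in[OF g h]
  show "vdash_op scale (Suc (p + q)) r (cup scale p (Suc q) f g) h
      \<in> cochains scale (p + q + r) (Suc (k + m + n))"
    using vdash_in[OF fg h] by (simp add: ac_simps)
  show "cup scale p (q + r) f (vdash_op scale (Suc q) r g h)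
      \<in> cochains scale (p + q + r) (Suc (k + m + n))"
    using cup_in_Suc[OF f gh] by (simp add: ac_simps)
  fix x :: "('a, 'k) tensor" assume x: "x \<in> tpow scale (p + q + r)"
  have f_x: "act scale f 0 p x \<in> tpow scale (Suc (k + q + r))"
    by (intro act_in[OF f x]) auto
  have h_x: "act scale h (p + q) r x \<in> tpow scale (Suc (p + q + n))"
    by (intro act_in[OF h x]) auto
  have f_h: "act scale f 0 p (act scale h (p + q) r x) = act scale h (Suc (k + q)) r (act scale f 0 p x)"
    by (intro act_commute[OF f h x]) auto
  note c = act_cup[OF f gh n1 _ x refl refl refl, where c = 0, simplified]
    act_cup[OF f g n1 _ h_x refl refl refl, where c = 0, simplified]
    act_vdash(2)[OF fg h n1 _ x refl refl refl, where c = 0, simplified]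
    act_vdash(2)[OF g h n1 _ f_x refl refl refl, where c = "Suc k", simplified]
  show "act scale (vdash_op scale (Suc (p + q)) r (cup scale p (Suc q) f g) h) 0 (p + q + r) x
      = act scale (cup scale p (q + r) f (vdash_op scale (Suc q) r g h)) 0 (p + q + r) x"
    by (simp add: c[simplified add.assoc[symmetric]] add.assoc[symmetric] f_h)
qed

text \<open>The first factor of the value of \<open>g\<close> is multiplied and the last one is fed
  to \<open>h\<close>; \<open>m \<ge> 1\<close> makes these two factors different.\<close>

lemma cup_dashv:
  assumes f: "f \<in> cochains scale p (Suc k)" and g: "g \<in> cochains scale q (Suc m)"
    and h: "h \<in> cochains scale (Suc r) (Suc n)" and m: "m \<ge> 1"
  shows "dashv_op scale (p + q) (Suc r) (Suc (k + m)) (cup scale p q f g) h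
     = cup scale p (q + r) f (dashv_op scale q (Suc r) (Suc m) g h)"
proof (rule cochain_eqI)
  have n1: "Suc x \<ge> 1" for x by simp
  note fg = cup_in_Suc[OF f g] and gh = dashv_in[OF g h]
  show "dashv_op scale (p + q) (Suc r) (Suc (k + m)) (cup scale p q f g) h
      \<in> cochains scale (p + q + r) (Suc (k + m + n))"
    using dashv_in[OF fg h] by (simp add: ac_simps)
  show "cup scale p (q + r) f (dashv_op scale q (Suc r) (Suc m) g h)
      \<in> cochains scale (p + q + r) (Suc (k + m + n))"
    using cup_in_Suc[OF f gh] by (simp add: ac_simps)
  fix x :: "('a, 'k) tensor" assume x: "x \<in> tpow scale (p + q + r)"
  let ?y = "act scale g (Suc k) q (act scale f 0 p x)"
  have f_x: "act scale f 0 p x \<in> tpow scale (Suc (k + q + r))"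
    by (intro act_in[OF f x]) auto
  have y: "?y \<in> tpow scale (Suc (Suc (k + m + r)))"
    by (intro act_in[OF g f_x]) auto
  have mu_h: "act scale mu k 2 (act scale h (Suc (k + m)) (Suc r) ?y)
      = act scale h (k + m) (Suc r) (act scale mu k 2 ?y)"
    using m by (intro act_commute[OF mu_in h y]) auto
  note c = act_cup[OF f gh n1 _ x refl refl refl, where c = 0, simplified]
    act_cup[OF f g n1 _ x refl refl refl, where c = 0, simplified]
    act_dashv(2)[OF fg h _ x refl refl refl refl, where c = 0, simplified]
    act_dashv(2)[OF g h _ f_x refl refl refl refl, where c = "Suc k", simplified]
  show "act scale (dashv_op scale (p + q) (Suc r) (Suc (k + m)) (cup scale p q f g) h) 0 (p + q + r) x
      = act scale (cup scale p (q + r) f (dashv_op scale q (Suc r) (Suc m) g h)) 0 (p + q + r) x"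
    by (simp add: c[simplified add.assoc[symmetric]] add.assoc[symmetric] mu_h)
qed

text \<open>The first factor of the value of \<open>g\<close> is fed to \<open>f\<close> and the
  last one is multiplied; again \<open>m \<ge> 1\<close> separates them.\<close>

lemma vdash_cup:
  assumes f: "f \<in> cochains scale (Suc p) (Suc k)" and g: "g \<in> cochains scale q (Suc m)"
    and h: "h \<in> cochains scale r (Suc n)" and m: "m \<ge> 1"
  shows "vdash_op scale (Suc p) (q + r) f (cup scale q r g h)
     = cup scale (p + q) r (vdash_op scale (Suc p) q f g) h"
proof (rule cochain_eqI)
  have n1: "Suc x \<ge> 1" for x by simp
  note fg = vdash_in[OF f g] and gh = cup_in_Suc[OF g h]
  show "vdash_op scale (Suc p) (q + r) f (cup scale q r g h)
      \<in> cochains scale (p + q + r) (Suc (k + m + n))"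
    using vdash_in[OF f gh] by (simp add: ac_simps)
  show "cup scale (p + q) r (vdash_op scale (Suc p) q f g) h
      \<in> cochains scale (p + q + r) (Suc (k + m + n))"
    using cup_in_Suc[OF fg h] by (simp add: ac_simps)
  fix x :: "('a, 'k) tensor" assume x: "x \<in> tpow scale (p + q + r)"
  let ?y = "act scale g p q x"
  have y: "?y \<in> tpow scale (Suc (p + m + r))"
    by (intro act_in[OF g x]) auto
  have h_y: "act scale h (Suc (p + m)) r ?y \<in> tpow scale (Suc (Suc (p + m + n)))"
    by (intro act_in[OF h y]) auto
  have f_mu: "act scale f 0 (Suc p) (act scale mu (p + m) 2 z)
      = act scale mu (k + m) 2 (act scale f 0 (Suc p) z)"
    if "z \<in> tpow scale (Suc (Suc (p + m + n)))" for z
    using m by (intro act_commute[OF f mu_in that]) auto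
  have f_h: "act scale f 0 (Suc p) (act scale h (Suc (p + m)) r ?y)
      = act scale h (Suc (k + m)) r (act scale f 0 (Suc p) ?y)"
    by (intro act_commute[OF f h y]) auto
  note c = act_cup[OF g h n1 _ x refl refl refl, where c = p, simplified]
    act_cup[OF fg h n1 _ x refl refl refl, where c = 0, simplified]
    act_vdash(2)[OF f gh n1 _ x refl refl refl, where c = 0, simplified]
    act_vdash(2)[OF f g n1 _ x refl refl refl, where c = 0, simplified]
  show "act scale (vdash_op scale (Suc p) (q + r) f (cup scale q r g h)) 0 (p + q + r) x
      = act scale (cup scale (p + q) r (vdash_op scale (Suc p) q f g) h) 0 (p + q + r) x"
    by (simp add: c[simplified add.assoc[symmetric]] add.assoc[symmetric] f_mu[OF h_y] f_h)
qed

lemma dashv_cup: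
  assumes f: "f \<in> cochains scale p (Suc k)" and g: "g \<in> cochains scale (Suc q) (Suc m)"
    and h: "h \<in> cochains scale r (Suc n)"
  shows "dashv_op scale p (Suc (q + r)) (Suc k) f (cup scale (Suc q) r g h)
     = cup scale (p + q) r (dashv_op scale p (Suc q) (Suc k) f g) h"
proof (rule cochain_eqI)
  have n1: "Suc x \<ge> 1" for x by simp
  have gh: "cup scale (Suc q) r g h \<in> cochains scale (Suc (q + r)) (Suc (m + n))"
    using cup_in_Suc[OF g h] by simp
  note fg = dashv_in[OF f g]
  show "dashv_op scale p (Suc (q + r)) (Suc k) f (cup scale (Suc q) r g h)
      \<in> cochains scale (p + q + r) (Suc (k + m + n))"
    using dashv_in[OF f gh] by (simp add: ac_simps)
  show "cup scale (p + q) r (dashv_op scale p (Suc q) (Suc k) f g) h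
      \<in> cochains scale (p + q + r) (Suc (k + m + n))"
    using cup_in_Suc[OF fg h] by (simp add: ac_simps)
  fix x :: "('a, 'k) tensor" assume x: "x \<in> tpow scale (p + q + r)"
  have f_x: "act scale f 0 p x \<in> tpow scale (Suc (k + q + r))"
    by (intro act_in[OF f x]) auto
  note c = act_cup[OF g h n1 _ f_x refl refl refl, where c = k, simplified]
    act_cup[OF fg h n1 _ x refl refl refl, where c = 0, simplified]
    act_dashv(2)[OF f gh _ x refl refl refl refl, where c = 0, simplified]
    act_dashv(2)[OF f g _ x refl refl refl refl, where c = 0, simplified]
  show "act scale (dashv_op scale p (Suc (q + r)) (Suc k) f (cup scale (Suc q) r g h)) 0 (p + q + r) x
      = act scale (cup scale (p + q) r (dashv_op scale p (Suc q) (Suc k) f g) h) 0 (p + q + r) x"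
    by (simp add: c[simplified add.assoc[symmetric]] add.assoc[symmetric])
qed

lemma cup_vee:
  assumes f: "f \<in> cochains scale p (Suc k)" and g: "g \<in> cochains scale (Suc q) (Suc m)"
    and h: "h \<in> cochains scale (Suc r) (Suc n)" and m: "m \<ge> 1"
  shows "vee scale (Suc (p + q)) (Suc r) (Suc (k + m)) (cup scale p (Suc q) f g) h
     = cup scale p (Suc (q + r)) f (vee scale (Suc q) (Suc r) (Suc m) g h)"
  using cup_vdash[OF f g h] cup_dashv[OF f g h m]
  by (simp add: vee_def linear_cochain[OF linear_cup_right])

lemma vee_cup:
  assumes f: "f \<in> cochains scale (Suc p) (Suc k)" and g: "g \<in> cochains scale (Suc q) (Suc m)"
    and h: "h \<in> cochains scale r (Suc n)" and m: "m \<ge> 1"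
  shows "vee scale (Suc p) (Suc (q + r)) (Suc k) f (cup scale (Suc q) r g h)
     = cup scale (Suc (p + q)) r (vee scale (Suc p) (Suc q) (Suc k) f g) h"
  using vdash_cup[OF f g h m] dashv_cup[OF f g h]
  by (simp add: vee_def linear_cochain[OF linear_cup_left])

end


section \<open>Passage from homogeneous cochains to families\<close>

section \<open>Direct sums of cochain spaces\<close>

interpretation sum_scale: vector_space "sum_scale :: 'k::field \<Rightarrow> ('a, 'k) cochain_family \<Rightarrow> _"
  by unfold_locales
    (auto simp: sum_scale_def fun_eq_iff fscale.scale_right_distrib fscale.scale_left_distrib)

lemma subspace_cochain_sum: "module.subspace sum_scale (cochain_sum s p0 k0)"
proof -
  have "finite {(p, k). F p k + G p k \<noteq> 0}"
    if "finite {(p, k). F p k \<noteq> 0}" "finite {(p, k). G p k \<noteq> 0}" for F G :: "('b, 'a) cochain_family"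
    by (rule finite_subset[OF _ finite_UnI[OF that]]) auto
  moreover have "finite {(p, k). cscale c (F p k) \<noteq> 0}"
    if "finite {(p, k). F p k \<noteq> 0}" for c and F :: "('b, 'a) cochain_family"
    by (rule finite_subset[OF _ that]) auto
  ultimately show ?thesis
    unfolding sum_scale.subspace_def cochain_sum_def
    by (auto simp: sum_scale_def zero_cochain_in cscale.subspace_add[OF subspace_cochains]
        cscale.subspace_scale[OF subspace_cochains])
qed

lemma homogeneous_in:
  assumes "p0 \<le> p" "k0 \<le> k" "f \<in> cochains s p k"
  shows "homogeneous p k f \<in> cochain_sum s p0 k0"
proof -
  have "finite {(p', k'). homogeneous p k f p' k' \<noteq> 0}"
    by (rule finite_subset[of _ "{(p, k)}"]) (auto simp: homogeneous_def split: if_splits)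
  with assms show ?thesis
    by (auto simp: cochain_sum_def homogeneous_def zero_cochain_in)
qed

lemma cochain_sum_component:
  assumes "F \<in> cochain_sum s p0 k0" "F p k \<noteq> 0"
  shows "p0 \<le> p" "k0 \<le> k" "F p k \<in> cochains s p k"
  using assms by (auto simp: cochain_sum_def split: if_splits)

text \<open>A family is the finite sum of its homogeneous components. The homogeneous case retains
  \<open>F p k \<noteq> 0\<close>, because for a family of known degree this determines
  \<open>p\<close>.\<close>

lemma cochain_sum_induct [consumes 1, case_names zero homogeneous add]:
  assumes F: "F \<in> cochain_sum s p0 k0"
    and "P 0"
    and "\<And>p k. F p k \<noteq> 0 \<Longrightarrow> p0 \<le> p \<Longrightarrow> k0 \<le> k \<Longrightarrow> F p k \<in> cochains s p k \<Longrightarrow> P (homogeneous p k (F p k))"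
    and "\<And>G H. P G \<Longrightarrow> P H \<Longrightarrow> P (G + H)"
  shows "P F"
proof -
  let ?S = "{(p, k). F p k \<noteq> 0}"
  have fin: "finite ?S" using F by (simp add: cochain_sum_def)
  have "F = (\<Sum>(p, k)\<in>?S. homogeneous p k (F p k))"
  proof (intro ext)
    fix p k x
    have "(\<Sum>(p, k)\<in>?S. homogeneous p k (F p k)) p k x
        = (\<Sum>pk\<in>?S. if pk = (p, k) then F p k x else 0)"
      by (auto simp: sum_fun_apply homogeneous_def case_prod_unfold intro!: sum.cong)
    then show "F p k x = (\<Sum>(p, k)\<in>?S. homogeneous p k (F p k)) p k x"
      by (simp add: sum.delta[OF fin])
  qed
  then have eq: "(\<Sum>(p, k)\<in>?S. homogeneous p k (F p k)) = F" by (rule sym)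
  have "P (\<Sum>(p, k)\<in>I. homogeneous p k (F p k))" if "finite I" "I \<subseteq> ?S" for I
    using that by (induction I rule: finite_induct) (auto intro!: assms cochain_sum_component[OF F])
  from back_subst[of P, OF this[OF fin order_refl] eq] show ?thesis .
qed

lemma sum_scale_apply: "sum_scale c F p k = cscale c (F p k)"
  by (simp add: sum_scale_def)

lemma family_eqI: "(\<And>r n. F r n = G r n) \<Longrightarrow> F = G" for F G :: "('a, 'k) cochain_family"
  by (intro ext) (simp add: fun_eq_iff)

lemma sum_vee_apply: "sum_vee s F G r n = (\<Sum>x | fst x + snd x = r + 1. \<Sum>y | fst y + snd y = n + 1.
    vee s (fst x) (snd x) (fst y) (F (fst x) (fst y)) (G (snd x) (snd y)))"
  unfolding sum_vee_def split_beta by (rule refl)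

lemma sum_cup_apply: "sum_cup s F G r n = (\<Sum>x | fst x + snd x = r. \<Sum>y | fst y + snd y = n + 1.
    cup s (fst x) (snd x) (F (fst x) (fst y)) (G (snd x) (snd y)))"
  unfolding sum_cup_def split_beta by (rule refl)

lemma sum_vee_linear:
  "sum_vee s (F + G) H = sum_vee s F H + sum_vee s G H"
  "sum_vee s H (F + G) = sum_vee s H F + sum_vee s H G"
  "sum_vee s (sum_scale c F) H = sum_scale c (sum_vee s F H)"
  "sum_vee s H (sum_scale c F) = sum_scale c (sum_vee s H F)"
  "sum_vee s 0 H = 0" "sum_vee s H 0 = 0"
  by (rule family_eqI; simp add: sum_vee_apply sum_scale_apply linear_cochain[OF linear_vee_left]
      linear_cochain[OF linear_vee_right] sum.distrib cscale.scale_sum_right)+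

lemma sum_cup_linear:
  "sum_cup s (F + G) H = sum_cup s F H + sum_cup s G H"
  "sum_cup s H (F + G) = sum_cup s H F + sum_cup s H G"
  "sum_cup s 0 H = 0" "sum_cup s H 0 = 0"
  by (rule family_eqI; simp add: sum_cup_apply linear_cochain[OF linear_cup_left]
      linear_cochain[OF linear_cup_right] sum.distrib)+

lemma sum_b_linear:
  "sum_b s (F + G) = sum_b s F + sum_b s G"
  "sum_b s (sum_scale c F) = sum_scale c (sum_b s F)"
  "sum_b s 0 = 0"
  by (rule family_eqI; simp add: sum_b_def sum_scale_apply linear_cochain[OF linear_hochschild] split: nat.split)+

lemma homogeneous_linear:
  "homogeneous p k (f + g) = homogeneous p k f + homogeneous p k g"
  "homogeneous p k (cscale c f) = sum_scale c (homogeneous p k f)"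
  by (intro ext; simp add: homogeneous_def sum_scale_def)+

lemma finite_nat_sum_eq: "finite {(p, q). p + q = (n::nat)}"
  by (rule finite_subset[of _ "{..n} \<times> {..n}"]) auto

text \<open>All summands but one have a zero argument. A general \<open>B\<close> lets the lemma
  serve \<open>vee\<close> and \<open>cup\<close> alike.\<close>

lemma sum_homogeneous:
  assumes "\<And>p q k f g. B p q k 0 g = 0" "\<And>p q k f g. B p q k f 0 = 0"
  shows "(\<Sum>(p', q')\<in>{(p, q). p + q = r}. \<Sum>(k', m')\<in>{(k, m). k + m = n}.
      B p' q' k' (homogeneous p k f p' k') (homogeneous q m g q' m'))
    = (if p + q = r \<and> k + m = n then B p q k f g else (0::('a, 'k::field) cochain))"
proof -
  have "(\<Sum>(p', q')\<in>{(p, q). p + q = r}. \<Sum>(k', m')\<in>{(k, m). k + m = n}.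
      B p' q' k' (homogeneous p k f p' k') (homogeneous q m g q' m'))
    = (\<Sum>pq\<in>{(p, q). p + q = r}. if pq = (p, q) then
        (\<Sum>km\<in>{(k, m). k + m = n}. if km = (k, m) then B p q k f g else 0) else 0)"
  proof (rule sum.cong[OF refl], clarify)
    fix p' q'
    have "B p' q' k' (homogeneous p k f p' k') (homogeneous q m g q' m')
        = (if (p', q') = (p, q) then if (k', m') = (k, m) then B p q k f g else 0 else 0)" for k' m'
      by (cases "p' = p \<and> k' = k"; cases "q' = q \<and> m' = m") (auto simp: homogeneous_def assms)
    then show "(\<Sum>(k', m')\<in>{(k, m). k + m = n}.
          B p' q' k' (homogeneous p k f p' k') (homogeneous q m g q' m'))
        = (if (p', q') = (p, q) then
            (\<Sum>km\<in>{(k, m). k + m = n}. if km = (k, m) then B p q k f g else 0) else 0)"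
      by (cases "(p', q') = (p, q)") (auto simp: case_prod_unfold prod_eq_iff)
  qed
  then show ?thesis by (simp add: sum.delta finite_nat_sum_eq)
qed

text \<open>Successors are used so that the bidegree of the product can be written without truncated
  subtraction.\<close>

lemma sum_vee_homogeneous:
  "sum_vee s (homogeneous (Suc p) k f) (homogeneous (Suc q) (Suc m) g)
    = homogeneous (Suc (p + q)) (k + m) (vee s (Suc p) (Suc q) k f g)"
  unfolding sum_vee_def
  by (subst sum_homogeneous)
    (auto simp: fun_eq_iff homogeneous_def linear_cochain[OF linear_vee_left] linear_cochain[OF linear_vee_right])

lemma sum_cup_homogeneous:
  "sum_cup s (homogeneous p k f) (homogeneous q (Suc m) g)
    = homogeneous (p + q) (k + m) (cup s p q f g)"
  unfolding sum_cup_def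
  by (subst sum_homogeneous[where B = "\<lambda>p q k. cup s p q"])
    (auto simp: fun_eq_iff homogeneous_def linear_cochain[OF linear_cup_left] linear_cochain[OF linear_cup_right])

lemma sum_b_homogeneous: "sum_b s (homogeneous p k f) = homogeneous (Suc p) k (hochschild s p f)"
  by (auto simp: fun_eq_iff sum_b_def homogeneous_def linear_cochain[OF linear_hochschild] split: nat.split)

lemma cochain_degree_outside: "F \<in> cochain_degree s d \<Longrightarrow> p \<noteq> d + 1 \<Longrightarrow> F p k = 0"
  unfolding cochain_degree_def by blast

context unital_algebra
begin

text \<open>
  Rule application can leave families eta-expanded, and pointwise simplification would then destroy
  the sums to which the additivity lemmas apply.
\<close>

context
  notes plus_fun_apply [simp del] zero_fun_apply [simp del]
begin

lemma sum_vee_in: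
  assumes F: "F \<in> cochain_sum scale 2 2" and G: "G \<in> cochain_sum scale 2 2"
  shows "sum_vee scale F G \<in> cochain_sum scale 2 2"
  using F
proof (induction rule: cochain_sum_induct)
  case (homogeneous p k)
  define f where "f = F p k"
  obtain p' k' where pk: "p = Suc (Suc p')" "k = Suc (Suc k')"
    using homogeneous(2,3) by (metis add_2_eq_Suc le_Suc_ex)
  have f: "f \<in> cochains scale (Suc (Suc p')) (Suc (Suc k'))" using homogeneous pk by (simp add: f_def)
  show ?case
    unfolding f_def[symmetric] using G
  proof (induction rule: cochain_sum_induct)
    case (homogeneous q m)
    obtain q' m' where qm: "q = Suc (Suc q')" "m = Suc (Suc m')"
      using homogeneous(2,3) by (metis add_2_eq_Suc le_Suc_ex)
    show ?case
      using vee_in[OF f homogeneous(4)[unfolded qm]]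
      by (simp add: pk qm sum_vee_homogeneous homogeneous_in)
  qed (simp_all add: sum_vee_linear sum_scale.subspace_add[OF subspace_cochain_sum]
      sum_scale.subspace_0[OF subspace_cochain_sum])
qed (simp_all add: sum_vee_linear sum_scale.subspace_add[OF subspace_cochain_sum]
    sum_scale.subspace_0[OF subspace_cochain_sum])

lemma sum_b_in:
  assumes F: "F \<in> cochain_sum scale 2 2"
  shows "sum_b scale F \<in> cochain_sum scale 2 2"
  using F
proof (induction rule: cochain_sum_induct)
  case (homogeneous p k)
  then show ?case
    using hochschild_in[OF homogeneous(4)] by (simp add: sum_b_homogeneous homogeneous_in)
qed (simp_all add: sum_b_linear sum_scale.subspace_add[OF subspace_cochain_sum]
    sum_scale.subspace_0[OF subspace_cochain_sum])

lemma sum_b_sum_b: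
  assumes F: "F \<in> cochain_sum scale 2 2"
  shows "sum_b scale (sum_b scale F) = 0"
  using F
proof (induction rule: cochain_sum_induct)
  case (homogeneous p k)
  then show ?case
    using hochschild_hochschild[OF homogeneous(4)]
    by (simp add: sum_b_homogeneous) (simp add: homogeneous_def fun_eq_iff zero_fun_apply)
qed (simp_all add: sum_b_linear)

text \<open>Both sides of each identity below are additive in every argument, so homogeneous arguments suffice.\<close>

lemma cochain_sum_induct3:
  assumes FGH: "F \<in> cochain_sum scale p0 k0" "G \<in> cochain_sum scale p0 k0" "H \<in> cochain_sum scale p0 k0"
    and hom: "\<And>p k f q m g r n h. f \<in> cochains scale (p0 + p) (k0 + k) \<Longrightarrow>
        g \<in> cochains scale (p0 + q) (k0 + m) \<Longrightarrow> h \<in> cochains scale (p0 + r) (k0 + n) \<Longrightarrow>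
        L (homogeneous (p0 + p) (k0 + k) f) (homogeneous (p0 + q) (k0 + m) g) (homogeneous (p0 + r) (k0 + n) h)
          = R (homogeneous (p0 + p) (k0 + k) f) (homogeneous (p0 + q) (k0 + m) g) (homogeneous (p0 + r) (k0 + n) h)"
    and add: "\<And>F F' G H. L (F + F') G H = L F G H + L F' G H" "\<And>F G G' H. L F (G + G') H = L F G H + L F G' H"
      "\<And>F G H H'. L F G (H + H') = L F G H + L F G H'"
      "\<And>F F' G H. R (F + F') G H = R F G H + R F' G H" "\<And>F G G' H. R F (G + G') H = R F G H + R F G' H"
      "\<And>F G H H'. R F G (H + H') = R F G H + R F G (H'::('a, 'k) cochain_family)"
  shows "L F G H = (R F G H :: ('a, 'k) cochain_family)"
proof -
  have zero: "L 0 G H = 0" "L F 0 H = 0" "L F G 0 = 0" "R 0 G H = 0" "R F 0 H = 0" "R F G 0 = 0" for F G H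
    using add(1)[of 0 0] add(2)[of _ 0 0] add(3)[of _ _ 0 0] add(4)[of 0 0] add(5)[of _ 0 0] add(6)[of _ _ 0 0]
    by simp_all
  have hom': "L (homogeneous p k f) (homogeneous q m g) (homogeneous r n h)
      = R (homogeneous p k f) (homogeneous q m g) (homogeneous r n h)"
    if "p0 \<le> p" "k0 \<le> k" "f \<in> cochains scale p k" "p0 \<le> q" "k0 \<le> m" "g \<in> cochains scale q m"
      "p0 \<le> r" "k0 \<le> n" "h \<in> cochains scale r n" for p k f q m g r n h
    using that hom[of f "p - p0" "k - k0" g "q - p0" "m - k0" h "r - p0" "n - k0"] by simp
  show ?thesis
    using FGH(1)
  proof (induction rule: cochain_sum_induct)
    case (homogeneous p k)
    note f = homogeneous(2-4)
    show ?case
      using FGH(2)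
    proof (induction rule: cochain_sum_induct)
      case (homogeneous q m)
      note g = homogeneous(2-4)
      show ?case
        using FGH(3) by (induction rule: cochain_sum_induct) (simp_all add: zero add hom' f g)
    qed (simp_all add: zero add)
  qed (simp_all add: zero add)
qed

lemma sum_vee_assoc:
  assumes "F \<in> cochain_sum scale 2 2" "G \<in> cochain_sum scale 2 2" "H \<in> cochain_sum scale 2 2"
  shows "sum_vee scale F (sum_vee scale G H) = sum_vee scale (sum_vee scale F G) H"
  using assms
proof (rule cochain_sum_induct3)
  fix p k f q m g r n h
  assume "f \<in> cochains scale (2 + p) (2 + k)" "g \<in> cochains scale (2 + q) (2 + m)" "h \<in> cochains scale (2 + r) (2 + n)"
  then show "sum_vee scale (homogeneous (2 + p) (2 + k) f) (sum_vee scale (homogeneous (2 + q) (2 + m) g) (homogeneous (2 + r) (2 + n) h))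
      = sum_vee scale (sum_vee scale (homogeneous (2 + p) (2 + k) f) (homogeneous (2 + q) (2 + m) g)) (homogeneous (2 + r) (2 + n) h)"
    using vee_assoc[of f "Suc p" "Suc k" g "Suc q" "Suc m" h "Suc r" "Suc n"] by (simp add: sum_vee_homogeneous ac_simps)
qed (simp_all add: sum_vee_linear)

lemma sum_cup_assoc:
  assumes "F \<in> cochain_sum scale 0 1" "G \<in> cochain_sum scale 0 1" "H \<in> cochain_sum scale 0 1"
  shows "sum_cup scale F (sum_cup scale G H) = sum_cup scale (sum_cup scale F G) H"
  using assms
proof (rule cochain_sum_induct3)
  fix p k f q m g r n h
  assume "f \<in> cochains scale (0 + p) (1 + k)" "g \<in> cochains scale (0 + q) (1 + m)" "h \<in> cochains scale (0 + r) (1 + n)"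
  then show "sum_cup scale (homogeneous (0 + p) (1 + k) f) (sum_cup scale (homogeneous (0 + q) (1 + m) g) (homogeneous (0 + r) (1 + n) h))
      = sum_cup scale (sum_cup scale (homogeneous (0 + p) (1 + k) f) (homogeneous (0 + q) (1 + m) g)) (homogeneous (0 + r) (1 + n) h)"
    using cup_assoc[of f p k g q m h r n] by (simp add: sum_cup_homogeneous ac_simps)
qed (simp_all add: sum_cup_linear)

lemma sum_cup_vee:
  assumes "F \<in> cochain_sum scale 2 2" "G \<in> cochain_sum scale 2 2" "H \<in> cochain_sum scale 2 2"
  shows "sum_vee scale (sum_cup scale F G) H = sum_cup scale F (sum_vee scale G H)"
  using assms
proof (rule cochain_sum_induct3)
  fix p k f q m g r n h
  assume "f \<in> cochains scale (2 + p) (2 + k)" "g \<in> cochains scale (2 + q) (2 + m)" "h \<in> cochains scale (2 + r) (2 + n)"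
  then show "sum_vee scale (sum_cup scale (homogeneous (2 + p) (2 + k) f) (homogeneous (2 + q) (2 + m) g)) (homogeneous (2 + r) (2 + n) h)
      = sum_cup scale (homogeneous (2 + p) (2 + k) f) (sum_vee scale (homogeneous (2 + q) (2 + m) g) (homogeneous (2 + r) (2 + n) h))"
    using cup_vee[of f "Suc (Suc p)" "Suc k" g "Suc q" "Suc m" h "Suc r" "Suc n"] by (simp add: sum_vee_homogeneous sum_cup_homogeneous ac_simps)
qed (simp_all add: sum_vee_linear sum_cup_linear)

lemma sum_vee_cup:
  assumes "F \<in> cochain_sum scale 2 2" "G \<in> cochain_sum scale 2 2" "H \<in> cochain_sum scale 2 2"
  shows "sum_vee scale F (sum_cup scale G H) = sum_cup scale (sum_vee scale F G) H"
  using assms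
proof (rule cochain_sum_induct3)
  fix p k f q m g r n h
  assume "f \<in> cochains scale (2 + p) (2 + k)" "g \<in> cochains scale (2 + q) (2 + m)" "h \<in> cochains scale (2 + r) (2 + n)"
  then show "sum_vee scale (homogeneous (2 + p) (2 + k) f) (sum_cup scale (homogeneous (2 + q) (2 + m) g) (homogeneous (2 + r) (2 + n) h))
      = sum_cup scale (sum_vee scale (homogeneous (2 + p) (2 + k) f) (homogeneous (2 + q) (2 + m) g)) (homogeneous (2 + r) (2 + n) h)"
    using vee_cup[of f "Suc p" "Suc k" g "Suc q" "Suc m" h "Suc (Suc r)" "Suc n"] by (simp add: sum_vee_homogeneous sum_cup_homogeneous ac_simps)
qed (simp_all add: sum_vee_linear sum_cup_linear)

lemma sum_vee_Leibniz:
  assumes "2 \<le> p" "2 \<le> k" and f: "f \<in> cochains scale p k" and G: "G \<in> cochain_sum scale 2 2"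
  shows "sum_b scale (sum_vee scale (homogeneous p k f) G)
    = sum_vee scale (sum_b scale (homogeneous p k f)) G
      + sum_scale ((-1) ^ (p - 1)) (sum_vee scale (homogeneous p k f) (sum_b scale G))"
proof -
  obtain p' k' where pk: "p = Suc p'" "k = Suc (Suc k')"
    using assms(1,2) by (metis add_2_eq_Suc le_Suc_ex)
  show ?thesis
    using G
  proof (induction rule: cochain_sum_induct)
    case (homogeneous q m)
    obtain q' m' where qm: "q = Suc (Suc q')" "m = Suc (Suc m')"
      using homogeneous(2,3) by (metis add_2_eq_Suc le_Suc_ex)
    show ?case
      using vee_Leibniz[of f p' "Suc k'" "G q m" "Suc q'" "Suc m'"] f homogeneous(4)
      by (simp add: pk qm sum_vee_homogeneous sum_b_homogeneous homogeneous_linear)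
  qed (simp_all add: sum_vee_linear sum_b_linear sum_scale.scale_right_distrib)
qed

end

lemma subspace_cochain_degree: "module.subspace sum_scale (cochain_degree scale d)"
proof -
  \<comment> \<open>In contrapositive form the degree condition is visibly linear.\<close>
  have "G \<in> cochain_degree scale d \<longleftrightarrow> G \<in> cochain_sum scale 2 2 \<and> (\<forall>p k. p \<noteq> d + 1 \<longrightarrow> G p k = 0)" for G
    by (auto simp: cochain_degree_def)
  then show ?thesis
    using subspace_cochain_sum[of scale 2 2]
    unfolding sum_scale.subspace_def by (simp add: sum_scale_def)
qed

lemma cochain_sum_eq_span: "cochain_sum scale 2 2 = module.span sum_scale (\<Union>d. cochain_degree scale d)"
proof
  show "cochain_sum scale 2 2 \<subseteq> module.span sum_scale (\<Union>d. cochain_degree scale d)"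
  proof
    fix F assume "F \<in> cochain_sum scale 2 2"
    then show "F \<in> module.span sum_scale (\<Union>d. cochain_degree scale d)"
    proof (induction rule: cochain_sum_induct)
      case (homogeneous p k)
      then have "homogeneous p k (F p k) \<in> cochain_degree scale (p - 1)"
        by (auto simp: cochain_degree_def homogeneous_in) (auto simp: homogeneous_def split: if_splits)
      then show ?case by (intro sum_scale.span_base) blast
    qed (simp_all add: sum_scale.span_zero sum_scale.span_add del: plus_fun_apply zero_fun_apply)
  qed
  show "module.span sum_scale (\<Union>d. cochain_degree scale d) \<subseteq> cochain_sum scale 2 2"
    by (rule sum_scale.span_minimal) (auto simp: cochain_degree_def subspace_cochain_sum)
qed

text \<open>The degree is the arity minus one: it is additive under \<open>sum_vee\<close>, raised
  by one under \<open>sum_b\<close>, and turns the sign (-1)^(p-1) into (-1)^n.\<close>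

lemma dg_algebra_cochain_sum:
  "dg_algebra sum_scale (cochain_sum scale 2 2) (cochain_degree scale) (sum_vee scale) (sum_b scale)"
proof
  show "module.subspace sum_scale (cochain_degree scale n)" for n
    by (rule subspace_cochain_degree)
  show "cochain_sum scale 2 2 = module.span sum_scale (\<Union>n. cochain_degree scale n)"
    by (rule cochain_sum_eq_span)
  show "x n = 0" if fin: "finite I" and x: "\<And>n. n \<in> I \<Longrightarrow> x n \<in> cochain_degree scale n"
    and sum: "(\<Sum>n\<in>I. x n) = 0" and n: "n \<in> I" for I and x :: "nat \<Rightarrow> ('a, 'k) cochain_family" and n
  proof (intro ext)
    fix p k y
    \<comment> \<open>Only the summand of degree \<open>n\<close> can have components of arity
      \<open>n + 1\<close>.\<close>
    have "(\<Sum>i\<in>I. x i p k) = (\<Sum>i\<in>I. if i = n then x n p k else 0)" if "p = n + 1"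
      by (rule sum.cong) (use x that in \<open>auto simp: cochain_degree_def\<close>)
    then have "p = n + 1 \<Longrightarrow> (\<Sum>i\<in>I. x i p k) = x n p k"
      using fin n by (simp add: sum.delta)
    moreover have "(\<Sum>i\<in>I. x i p k) = 0"
      using sum by (simp add: fun_eq_iff sum_fun_apply)
    moreover have "x n p k = 0" if "p \<noteq> n + 1"
      using cochain_degree_outside[OF x[OF n] that] .
    ultimately show "x n p k y = 0 p k y"
      by (cases "p = n + 1") auto
  qed
  show "sum_vee scale u v \<in> cochain_degree scale (m + n)"
    if u: "u \<in> cochain_degree scale m" and v: "v \<in> cochain_degree scale n" for u v m n
  proof -
    have "r = m + n + 1" if "sum_vee scale u v r l \<noteq> 0" for r l
    proof (rule ccontr)
      assume "r \<noteq> m + n + 1"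
      \<comment> \<open>If the total arity is wrong, then \<open>p \<noteq> m + 1\<close> or
        \<open>q \<noteq> n + 1\<close>, so one of the two arguments is 0.\<close>
      then have "vee scale p q k (u p k) (v q i) = 0" if "p + q = r + 1" for p q k i
        using that cochain_degree_outside[OF u, of p k] cochain_degree_outside[OF v, of q i]
        by (cases "p = m + 1"; cases "q = n + 1")
          (auto simp: linear_cochain[OF linear_vee_left] linear_cochain[OF linear_vee_right])
      then have "sum_vee scale u v r l = 0"
        unfolding sum_vee_def by (intro sum.neutral ballI) (auto intro!: sum.neutral)
      with that show False by simp
    qed
    then show ?thesis
      using u v sum_vee_in by (auto simp: cochain_degree_def)
  qed
  show "sum_b scale u \<in> cochain_degree scale (n + 1)" if u: "u \<in> cochain_degree scale n" for u n
  proof -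
    have "r = n + 2" if "sum_b scale u r l \<noteq> 0" for r l
    proof (cases r)
      case (Suc p)
      then have "u p l \<noteq> 0"
        using that linear_cochain(1)[OF linear_hochschild, of scale p] by (auto simp: sum_b_def)
      then show ?thesis using cochain_degree_outside[OF u] Suc by auto
    qed (use that in \<open>simp add: sum_b_def\<close>)
    then show ?thesis
      using u sum_b_in by (auto simp: cochain_degree_def)
  qed
  show "sum_b scale (sum_vee scale u v)
      = sum_vee scale (sum_b scale u) v + sum_scale ((-1) ^ n) (sum_vee scale u (sum_b scale v))"
    if u: "u \<in> cochain_degree scale n" and v: "v \<in> cochain_sum scale 2 2" for u v n
  proof -
    have "u \<in> cochain_sum scale 2 2" using u by (simp add: cochain_degree_def)
    then show ?thesis
    proof (induction rule: cochain_sum_induct)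
      case (homogeneous p k)
      \<comment> \<open>All nonzero components of \<open>u\<close> have arity \<open>n + 1\<close>,
        so the sign is the same for each of them.\<close>
      then have "n = p - 1" using u by (auto simp: cochain_degree_def)
      then show ?case using sum_vee_Leibniz[OF homogeneous(2-4) v] by simp
    qed (simp_all add: sum_vee_linear sum_b_linear sum_scale.scale_right_distrib
        del: plus_fun_apply zero_fun_apply)
  qed
qed (simp_all add: sum_vee_linear sum_b_linear sum_vee_assoc sum_b_sum_b)

end


section \<open>The cup product on cohomology and its vanishing\<close>

section \<open>Cohomology\<close>

context unital_algebra
begin

lemma subspace_cocycles: "module.subspace cscale (cocycles scale p k)"
  using subspace_cochains[of scale p k] unfolding cscale.subspace_def cocycles_def
  by (simp add: linear_cochain[OF linear_hochschild] cscale.scale_zero_right)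

lemma subspace_coboundaries: "module.subspace cscale (coboundaries scale p k)"
proof (cases p)
  case 0
  then show ?thesis by (simp add: coboundaries_def cscale.subspace_single_0)
next
  case (Suc p')
  interpret Vector_Spaces.linear cscale cscale "hochschild scale p'" by (rule linear_hochschild)
  show ?thesis using subspace_image[OF subspace_cochains] by (simp add: Suc coboundaries_def)
qed

lemma coboundaries_subset_cocycles:
  assumes "k \<ge> 1"
  shows "coboundaries scale p k \<subseteq> cocycles scale p k"
  using hochschild_in[OF _ assms] hochschild_hochschild[OF _ assms]
  by (cases p) (auto simp: coboundaries_def cocycles_def zero_cochain_in linear_cochain[OF linear_hochschild])

lemma linear_coh_class: "Vector_Spaces.linear cscale cscale (coh_class scale p k)"
  unfolding coh_class_def by (rule quotient_map(1)[OF cscale.vector_space_axioms subspace_coboundaries])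

lemma coh_class_eq_0_iff: "coh_class scale p k f = 0 \<longleftrightarrow> f \<in> coboundaries scale p k"
  unfolding coh_class_def by (rule quotient_map(3)[OF cscale.vector_space_axioms subspace_coboundaries])

text \<open>The projection \<open>coh_class\<close> is idempotent and kills exactly the
  coboundaries; applied to this difference it gives 0.\<close>

lemma coh_class_diff: "coh_class scale p k f - f \<in> coboundaries scale p k"
proof -
  have "coh_class scale p k (coh_class scale p k f) = coh_class scale p k f"
    unfolding coh_class_def by (rule quotient_map(2)[OF cscale.vector_space_axioms subspace_coboundaries])
  then show ?thesis
    by (simp add: coh_class_eq_0_iff[symmetric] linear_cochain[OF linear_coh_class])
qed

lemma coh_class_eqI: "f - g \<in> coboundaries scale p k \<Longrightarrow> coh_class scale p k f = coh_class scale p k g"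
  using coh_class_eq_0_iff[of p k "f - g"] by (simp add: linear_cochain[OF linear_coh_class])

lemma subspace_cohomology: "module.subspace cscale (cohomology scale p k)"
proof -
  interpret Vector_Spaces.linear cscale cscale "coh_class scale p k" by (rule linear_coh_class)
  show ?thesis unfolding cohomology_def by (rule subspace_image[OF subspace_cocycles])
qed

lemma cohomology_subset_cocycles:
  assumes "k \<ge> 1"
  shows "cohomology scale p k \<subseteq> cocycles scale p k"
proof -
  have "coh_class scale p k f \<in> cocycles scale p k" if "f \<in> cocycles scale p k" for f
  proof -
    have "coh_class scale p k f - f \<in> cocycles scale p k"
      using coh_class_diff coboundaries_subset_cocycles[OF assms] by (rule set_mp[rotated])
    from cscale.subspace_add[OF subspace_cocycles that this] show ?thesis by simp
  qed
  then show ?thesis by (auto simp: cohomology_def)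
qed

lemma cup_cocycle:
  assumes f: "f \<in> cocycles scale p (Suc k)" and g: "g \<in> cocycles scale q (Suc m)"
  shows "cup scale p q f g \<in> cocycles scale (p + q) (Suc (k + m))"
  using assms cup_Leibniz[of f p k g q m] cup_in_Suc[of f p k g q m]
  by (simp add: cocycles_def linear_cochain[OF linear_cup_left] linear_cochain[OF linear_cup_right]
      cscale.scale_zero_right)

text \<open>If f = b f' and b g = 0, the Leibniz rule reads b(f' cup g) = f cup g. In arity 0 the
  only coboundary is 0.\<close>

lemma cup_coboundary_left:
  assumes f: "f \<in> coboundaries scale p (Suc k)" and g: "g \<in> cocycles scale q (Suc m)"
  shows "cup scale p q f g \<in> coboundaries scale (p + q) (Suc (k + m))"
proof (cases p)
  case 0
  then have "f = 0" using f by (simp add: coboundaries_def)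
  then show ?thesis
    using cscale.subspace_0[OF subspace_coboundaries] by (simp add: linear_cochain[OF linear_cup_left])
next
  case (Suc p')
  then obtain f' where f': "f' \<in> cochains scale p' (Suc k)" "f = hochschild scale p' f'"
    using f by (auto simp: coboundaries_def)
  have g': "g \<in> cochains scale q (Suc m)" "hochschild scale q g = 0"
    using g by (auto simp: cocycles_def)
  have "cup scale p q f g = hochschild scale (p' + q) (cup scale p' q f' g)"
    using cup_Leibniz[OF f'(1) g'(1)]
    by (simp add: Suc f'(2) g'(2) linear_cochain[OF linear_cup_right] cscale.scale_zero_right)
  then show ?thesis
    using cup_in_Suc[OF f'(1) g'(1)] by (simp add: Suc coboundaries_def)
qed

text \<open>If g = b g' and b f = 0, the Leibniz rule reads b(f cup g') = (-1)^p f cup g; scaling by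
  (-1)^p once more removes the sign.\<close>

lemma cup_coboundary_right:
  assumes f: "f \<in> cocycles scale p (Suc k)" and g: "g \<in> coboundaries scale q (Suc m)"
  shows "cup scale p q f g \<in> coboundaries scale (p + q) (Suc (k + m))"
proof (cases q)
  case 0
  then have "g = 0" using g by (simp add: coboundaries_def)
  then show ?thesis
    using cscale.subspace_0[OF subspace_coboundaries] by (simp add: linear_cochain[OF linear_cup_right])
next
  case (Suc q')
  then obtain g' where g': "g' \<in> cochains scale q' (Suc m)" "g = hochschild scale q' g'"
    using g by (auto simp: coboundaries_def)
  have f': "f \<in> cochains scale p (Suc k)" "hochschild scale p f = 0"
    using f by (auto simp: cocycles_def)
  have "hochschild scale (p + q') (cup scale p q' f g') = cscale ((-1) ^ p) (cup scale p q f g)"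
    using cup_Leibniz[OF f'(1) g'(1)]
    by (simp add: Suc f'(2) g'(2) linear_cochain[OF linear_cup_left])
  then have "cscale ((-1) ^ p) (cup scale p q f g) \<in> coboundaries scale (p + q) (Suc (k + m))"
    using cup_in_Suc[OF f'(1) g'(1)] by (auto simp: Suc coboundaries_def intro!: image_eqI[OF sym])
  from cscale.subspace_scale[OF subspace_coboundaries this, of "(-1) ^ p"]
  show ?thesis by (simp add: power_mult_distrib[symmetric])
qed

text \<open>On cocycles the one-sided Leibniz rules leave nothing but their cup term. The primitive
  is f |- g up to sign if the value of \<open>g\<close> has two or more factors, and f -| g up to
  sign otherwise.\<close>

lemma cup_cocycle_coboundary:
  assumes f: "f \<in> cocycles scale (Suc p) (Suc k)" and g: "g \<in> cocycles scale (Suc q) (Suc m)"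
    and km: "k \<ge> 1 \<or> m \<ge> 1"
  shows "cup scale (Suc p) (Suc q) f g \<in> coboundaries scale (Suc p + Suc q) (Suc (k + m))"
proof -
  have f': "f \<in> cochains scale (Suc p) (Suc k)" "hochschild scale (Suc p) f = 0"
    and g': "g \<in> cochains scale (Suc q) (Suc m)" "hochschild scale (Suc q) g = 0"
    using f g by (auto simp: cocycles_def)
  obtain h where h: "h \<in> cochains scale (p + Suc q) (Suc (k + m))"
    "hochschild scale (p + Suc q) h = cscale ((-1) ^ p) (- cup scale (Suc p) (Suc q) f g)"
  proof (cases "m \<ge> 1")
    case True
    show ?thesis
      using vdash_Leibniz[OF f'(1) g'(1) True] vdash_in[OF f'(1) g'(1)] that
      by (simp add: f'(2) g'(2) linear_cochain[OF linear_vdash_left] linear_cochain[OF linear_vdash_right])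
  next
    case False
    then have "k \<ge> 1" using km by simp
    then show ?thesis
      using dashv_Leibniz[OF f'(1) g'(1)] dashv_in[OF f'(1) g'(1)] that
      by (simp add: f'(2) g'(2) linear_cochain[OF linear_dashv_left] linear_cochain[OF linear_dashv_right])
  qed
  then have "cscale ((-1) ^ p) (- cup scale (Suc p) (Suc q) f g)
      \<in> coboundaries scale (Suc p + Suc q) (Suc (k + m))"
    by (auto simp: coboundaries_def intro!: image_eqI[OF sym])
  \<comment> \<open>The factor -(-1)^p undoes both the sign (-1)^p and the minus in front of the cup
    product.\<close>
  from cscale.subspace_scale[OF subspace_coboundaries this, of "- ((-1) ^ p)"]
  show ?thesis by (simp add: power_mult_distrib[symmetric])
qed

text \<open>Independence of representatives: with f', g' the chosen ones, f' cup g' - f cup g = (f'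
  - f) cup g' + f cup (g' - g), a sum of coboundaries.\<close>

lemma coh_class_cup:
  assumes f: "f \<in> cocycles scale p (Suc k)" and g: "g \<in> cocycles scale q (Suc m)"
  shows "coh_class scale (p + q) (Suc (k + m))
      (cup scale p q (coh_class scale p (Suc k) f) (coh_class scale q (Suc m) g))
    = coh_class scale (p + q) (Suc (k + m)) (cup scale p q f g)"
proof (rule coh_class_eqI)
  let ?f = "coh_class scale p (Suc k) f" and ?g = "coh_class scale q (Suc m) g"
  have g': "?g \<in> cocycles scale q (Suc m)"
    using cohomology_subset_cocycles[of "Suc m" q] g by (auto simp: cohomology_def)
  have "cup scale p q ?f ?g - cup scale p q f g = cup scale p q (?f - f) ?g + cup scale p q f (?g - g)"
    by (simp add: linear_cochain[OF linear_cup_left] linear_cochain[OF linear_cup_right])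
  also have "\<dots> \<in> coboundaries scale (p + q) (Suc (k + m))"
    by (intro cscale.subspace_add[OF subspace_coboundaries] cup_coboundary_left[OF coh_class_diff g']
        cup_coboundary_right[OF f coh_class_diff])
  finally show "cup scale p q ?f ?g - cup scale p q f g \<in> coboundaries scale (p + q) (Suc (k + m))" .
qed

section \<open>The induced map on the tensor product of two cohomology spaces\<close>

context
  fixes p q k m :: nat
begin

abbreviation (input) "factors \<equiv> [cohomology scale p (Suc k), cohomology scale q (Suc m)]"

abbreviation (input) "cup_word \<equiv> (\<lambda>w. coh_class scale (p + q) (Suc (k + m)) (cup scale p q (w ! 0) (w ! 1)))"

lemma factorsE:
  assumes "w \<in> listset factors"
  obtains f g where "w = [f, g]" "f \<in> cohomology scale p (Suc k)" "g \<in> cohomology scale q (Suc m)"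
  using assms by (auto simp: set_Cons_def)

lemma cup_word_linear:
  assumes "us @ f # vs \<in> listset factors"
  shows "cup_word (us @ (f + g) # vs) = cup_word (us @ f # vs) + cup_word (us @ g # vs)"
    and "cup_word (us @ cscale c f # vs) = cscale c (cup_word (us @ f # vs))"
proof -
  have "length (us @ f # vs) = 2" using assms by (rule factorsE) simp
  then consider h where "us = []" "vs = [h]" | h where "us = [h]" "vs = []"
    by (cases us; cases vs) auto
  then show "cup_word (us @ (f + g) # vs) = cup_word (us @ f # vs) + cup_word (us @ g # vs)"
    and "cup_word (us @ cscale c f # vs) = cscale c (cup_word (us @ f # vs))"
    by (cases; simp add: linear_cochain[OF linear_coh_class] linear_cochain[OF linear_cup_left]
        linear_cochain[OF linear_cup_right])+
qed

text \<open>The words occurring in \<open>x\<close> are not known to consist of cohomology classes,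
  since \<open>x\<close> is the output of a chosen projection. Those of \<open>v\<close> are, so the
  value can be studied word by word.\<close>

lemma coh_cup_eq:
  assumes "x \<in> tensor_space cscale factors"
  obtains v where "v \<in> formal_sums factors"
    "coh_cup scale p (Suc k) q (Suc m) x = lin_ext cscale cup_word v"
proof -
  obtain v where v: "v \<in> formal_sums factors"
    and x: "x = quotient_map fscale (tensor_relations cscale factors) v"
    using assms by (auto simp: tensor_space_def)
  have "lin_ext cscale cup_word x = lin_ext cscale cup_word v"
    unfolding x by (rule lin_ext_tensor_quotient[OF cscale.vector_space_axioms]) (rule cup_word_linear, assumption)+
  then have "coh_cup scale p (Suc k) q (Suc m) x = lin_ext cscale cup_word v"
    using assms by (simp add: coh_cup_def zero_outside_def)
  with v show ?thesis by (rule that)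
qed

text \<open>Serves twice: with \<open>S\<close> the target cohomology space it gives the codomain of
  the induced map, and with \<open>S\<close> the zero space its vanishing.\<close>

lemma cup_word_in_subspace:
  assumes "x \<in> tensor_space cscale factors" "module.subspace cscale S"
    and "\<And>f g. f \<in> cocycles scale p (Suc k) \<Longrightarrow> g \<in> cocycles scale q (Suc m) \<Longrightarrow>
      coh_class scale (p + q) (Suc (k + m)) (cup scale p q f g) \<in> S"
  shows "coh_cup scale p (Suc k) q (Suc m) x \<in> S"
proof -
  obtain v where v: "v \<in> formal_sums factors" "coh_cup scale p (Suc k) q (Suc m) x = lin_ext cscale cup_word v"
    using coh_cup_eq[OF assms(1)] .
  have "lin_ext cscale cup_word v \<in> S"
  proof (rule lin_ext_in_subspace[OF cscale.vector_space_axioms assms(2)])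
    fix w assume "w \<in> Poly_Mapping.keys v"
    then have "w \<in> listset factors" using v(1) by (auto simp: formal_sums_def)
    then obtain f g where "w = [f, g]" "f \<in> cohomology scale p (Suc k)" "g \<in> cohomology scale q (Suc m)"
      by (rule factorsE)
    then show "cup_word w \<in> S"
      using cohomology_subset_cocycles[of "Suc k" p] cohomology_subset_cocycles[of "Suc m" q]
      by (auto intro!: assms(3))
  qed
  then show ?thesis by (simp add: v(2))
qed

lemma coh_cup_in_hom_space:
  "coh_cup scale p (Suc k) q (Suc m) \<in> hom_space fscale cscale
     (tensor_space cscale factors) (cohomology scale (p + q) (Suc (k + m)))"
proof -
  have "coh_cup scale p (Suc k) q (Suc m) x \<in> cohomology scale (p + q) (Suc (k + m))"
    if "x \<in> tensor_space cscale factors" for x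
    using that subspace_cohomology
    by (rule cup_word_in_subspace) (auto simp: cohomology_def intro: cup_cocycle)
  then show ?thesis
    by (auto simp: hom_space_def coh_cup_def zero_outside_def fscale.subspace_add[OF subspace_tensor_space]
        fscale.subspace_scale[OF subspace_tensor_space] lin_ext_add[OF cscale.vector_space_axioms]
        lin_ext_scale[OF cscale.vector_space_axioms])
qed

lemma coh_cup_pure_tensor:
  assumes f: "f \<in> cocycles scale p (Suc k)" and g: "g \<in> cocycles scale q (Suc m)"
  shows "coh_cup scale p (Suc k) q (Suc m)
      (pure_tensor cscale factors [coh_class scale p (Suc k) f, coh_class scale q (Suc m) g])
    = coh_class scale (p + q) (Suc (k + m)) (cup scale p q f g)"
proof -
  let ?w = "[coh_class scale p (Suc k) f, coh_class scale q (Suc m) g]"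
  have "?w \<in> listset factors" using f g by (auto simp: set_Cons_def cohomology_def)
  then have "pure_tensor cscale factors ?w \<in> tensor_space cscale factors" by (rule pure_tensor_in)
  then have "coh_cup scale p (Suc k) q (Suc m) (pure_tensor cscale factors ?w)
      = lin_ext cscale cup_word (pure_tensor cscale factors ?w)"
    by (simp add: coh_cup_def zero_outside_def)
  also have "\<dots> = cup_word ?w"
    by (rule lin_ext_pure_tensor[OF cscale.vector_space_axioms]) (rule cup_word_linear, assumption)+
  also have "\<dots> = coh_class scale (p + q) (Suc (k + m)) (cup scale p q f g)"
    by (simp add: coh_class_cup[OF f g])
  finally show ?thesis .
qed

lemma coh_cup_eq_0:
  assumes "p \<ge> 1" "q \<ge> 1" "k \<ge> 1 \<or> m \<ge> 1" "x \<in> tensor_space cscale factors"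
  shows "coh_cup scale p (Suc k) q (Suc m) x = 0"
proof -
  obtain p' q' where "p = Suc p'" "q = Suc q'" using assms(1,2) by (cases p; cases q) auto
  then have "coh_cup scale p (Suc k) q (Suc m) x \<in> {0}"
    using assms(4) cscale.subspace_single_0 cup_cocycle_coboundary[OF _ _ assms(3)]
    by (intro cup_word_in_subspace) (auto simp: coh_class_eq_0_iff)
  then show ?thesis by simp
qed

end

end

theorem proposition7p2p1:
  fixes s :: "'k::field_char_0 \<Rightarrow> 'a::{ring, monoid_mult} \<Rightarrow> 'a"
  assumes "unital_algebra s"
  shows
    "(dg_algebra sum_scale (cochain_sum s 2 2) (cochain_degree s) (sum_vee s) (sum_b s)
     \<and> (\<forall>F\<in>cochain_sum s 2 2. \<forall>G\<in>cochain_sum s 2 2. \<forall>H\<in>cochain_sum s 2 2.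
          sum_vee s F (sum_vee s G H) = sum_vee s (sum_vee s F G) H)
     \<and> (\<forall>p\<ge>2. \<forall>k\<ge>2. \<forall>f\<in>cochains s p k. \<forall>G\<in>cochain_sum s 2 2.
          sum_b s (sum_vee s (homogeneous p k f) G)
            = sum_vee s (sum_b s (homogeneous p k f)) G
              + sum_scale ((-1) ^ (p - 1)) (sum_vee s (homogeneous p k f) (sum_b s G))))
     \<and>
     ((\<forall>F\<in>cochain_sum s 0 1. \<forall>G\<in>cochain_sum s 0 1. \<forall>H\<in>cochain_sum s 0 1.
        sum_cup s F (sum_cup s G H) = sum_cup s (sum_cup s F G) H)
     \<and> (\<forall>p\<ge>1. \<forall>q\<ge>1. \<forall>k\<ge>1. \<forall>m\<ge>1.
          coh_cup s p k q m \<in> hom_space fscale cscale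
            (tensor_space cscale [cohomology s p k, cohomology s q m])
            (cohomology s (p + q) (k + m - 1))
          \<and> (\<forall>f\<in>cocycles s p k. \<forall>g\<in>cocycles s q m.
               cup s p q f g \<in> cocycles s (p + q) (k + m - 1)
               \<and> coh_cup s p k q m
                   (pure_tensor cscale [cohomology s p k, cohomology s q m]
                      [coh_class s p k f, coh_class s q m g])
                 = coh_class s (p + q) (k + m - 1) (cup s p q f g))
          \<and> (k \<ge> 2 \<or> m \<ge> 2 \<longrightarrow>
               (\<forall>x\<in>tensor_space cscale [cohomology s p k, cohomology s q m].
                  coh_cup s p k q m x = 0))))
     \<and>
     (\<forall>F\<in>cochain_sum s 2 2. \<forall>G\<in>cochain_sum s 2 2. \<forall>H\<in>cochain_sum s 2 2.
        sum_vee s (sum_cup s F G) H = sum_cup s F (sum_vee s G H)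
        \<and> sum_vee s F (sum_cup s G H) = sum_cup s (sum_vee s F G) H)"
proof -
  interpret unital_algebra s by fact
  have cohom: "coh_cup s p k q m \<in> hom_space fscale cscale
        (tensor_space cscale [cohomology s p k, cohomology s q m])
        (cohomology s (p + q) (k + m - 1))
      \<and> (\<forall>f\<in>cocycles s p k. \<forall>g\<in>cocycles s q m.
           cup s p q f g \<in> cocycles s (p + q) (k + m - 1)
           \<and> coh_cup s p k q m
               (pure_tensor cscale [cohomology s p k, cohomology s q m]
                  [coh_class s p k f, coh_class s q m g])
             = coh_class s (p + q) (k + m - 1) (cup s p q f g))
      \<and> (k \<ge> 2 \<or> m \<ge> 2 \<longrightarrow>
           (\<forall>x\<in>tensor_space cscale [cohomology s p k, cohomology s q m].
              coh_cup s p k q m x = 0))"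
    if pq: "p \<ge> 1" "q \<ge> 1" and km: "k \<ge> 1" "m \<ge> 1" for p q k m
  proof -
    \<comment> \<open>In successor form \<open>k + m - 1\<close> becomes
      \<open>Suc (k' + m')\<close>, the exponent used throughout.\<close>
    obtain k' m' where "k = Suc k'" "m = Suc m'" using km by (cases k; cases m) auto
    then show ?thesis
      using coh_cup_in_hom_space[of p k' q m'] cup_cocycle coh_cup_pure_tensor coh_cup_eq_0[OF pq, of k' m']
      by auto
  qed
  show ?thesis
    by (intro conjI ballI allI impI)
      (simp_all add: dg_algebra_cochain_sum sum_vee_assoc sum_vee_Leibniz sum_cup_assoc
        sum_cup_vee sum_vee_cup cohom del: One_nat_def)
qed

end
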